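(* Let $g\ge1$. For every $\delta\in\operatorname{Sp}_{2g}(\mathbf{C})$, the image of the map $\varphi_\delta:U_\delta\to B_g(\mathbf{C})$ is a leaf of the higher Ramanujan foliation on $B_g(\mathbf{C})$, and coincides with the image of $\delta^{-1}U_g(\mathbf{C})\cap\mathbf{B}_g$ in $B_g(\mathbf{C})$ under the quotient map $\operatorname{Sp}_{2g}(\mathbf{C})\to\operatorname{Sp}_{2g}(\mathbf{Z})\backslash\operatorname{Sp}_{2g}(\mathbf{C})$. Moreover, every leaf is of this form.
   Context: $\mathbf{H}_g=\{\tau\in M_{g\times g}(\mathbf{C}):\tau^{\mathsf T}=\tau,\operatorname{Im}\tau>0\}$. $\operatorname{Sp}_{2g}$ is the group of $M$ with $MJM^{\mathsf T}=J$, $J=\begin{pmatrix}0&\mathbf{1}_g\\-\mathbf{1}_g&0\end{pmatrix}$. $U_g(\mathbf{C})=\left\{\begin{pmatrix}\mathbf{1}_g&Z\\0&\mathbf{1}_g\end{pmatrix}:Z^{\mathsf T}=Z\right\}$. Put $\mathbf{B}_g=\left\{\begin{pmatrix}A&B\\C&D\end{pmatrix}\in\operatorname{Sp}_{2g}(\mathbf{C}):D\in\operatorname{GL}_g(\mathbf{C}),\ BD^{-1}\in\mathbf{H}_g\right\}$, an open submanifold stable under left multiplication by $\operatorname{Sp}_{2g}(\mathbf{Z})$. The complex manifold $B_g(\mathbf{C})$ is the moduli space of isomorphism classes of $(X,E,b)$ with $(X,E)$ a principally polarized complex torus of dimension $g$ and $b=(\omega_1,\ldots,\omega_g,\eta_1,\ldots,\eta_g)$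 a symplectic-Hodge basis: a basis of $\mathcal{H}^1_{\mathrm{dR}}(X)\cong\operatorname{Hom}(H_1(X,\mathbf{Z}),\mathbf{C})$ with $\omega_i$ holomorphic differentials, symplectic for the form determined by $\langle E(\gamma,\cdot),E(\gamma',\cdot)\rangle_E=\frac1{2\pi i}E(\gamma,\gamma')$ ($\langle\omega_i,\eta_j\rangle_E=\delta_{ij}$, other pairings zero). It is identified with the open submanifold $\operatorname{Sp}_{2g}(\mathbf{Z})\backslash\mathbf{B}_g$ of $\operatorname{Sp}_{2g}(\mathbf{Z})\backslash\operatorname{Sp}_{2g}(\mathbf{C})$ by sending $[(X,E,b)]$ to the class of $\begin{pmatrix}N_2&\frac1{2\pi i}\Omega_2\\N_1&\frac1{2\pi i}\Omega_1\end{pmatrix}$, where for a basis $(\gamma_i,\delta_i)$ of $H_1(X,\mathbf{Z})$ with $E(\gamma_i,\delta_j)=\delta_{ij}$, $E(\gamma_i,\gamma_j)=E(\delta_i,\delta_j)=0$, one sets $(\Omega_1)_{ij}=\int_{\gamma_i}\omega_j$, $(\Omega_2)_{ij}=\int_{\delta_i}\omega_j$, $(N_1)_{ij}=\int_{\gamma_i}\eta_j$, $(N_2)_{ij}=\int_{\delta_i}\eta_j$. The higher Ramanujan foliation on $B_g(\mathbf{C})$ is the holomorphic foliation defined by the integrable subbundle of vector fields $v$ with $\nabla_v\eta_j=0$ for all $j$, where $(\omega_1,\ldots,\omega_g,\eta_1,\ldots,\eta_g)$ is the universal symplectic-Hodge basis and $\nabla$ the Gauss–Manin connection on the de Rham cohomology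 of the universal torus over $B_g(\mathbf{C})$. For $\delta=\begin{pmatrix}A&B\\C&D\end{pmatrix}\in\operatorname{Sp}_{2g}(\mathbf{C})$ put $U_\delta=\{\tau\in\mathbf{H}_g:C\tau+D\in\operatorname{GL}_g(\mathbf{C})\}$ and, for $\tau\in U_\delta$, $\delta\cdot\tau=(A\tau+B)(C\tau+D)^{-1}$ and $\psi_\delta(\tau)=\delta^{-1}\begin{pmatrix}\mathbf{1}_g&\delta\cdot\tau\\0&\mathbf{1}_g\end{pmatrix}\in\mathbf{B}_g$. Then $\varphi_\delta(\tau)=\operatorname{Sp}_{2g}(\mathbf{Z})\psi_\delta(\tau)\in B_g(\mathbf{C})$. *)

theory Defs
  imports "HOL-Analysis.Analysis"
begin

text \<open>
  The genus is \<open>g = CARD('n)\<close>. A \<open>2g \<times> 2g\<close> matrix is indexed by \<open>'n + 'n\<close>, with \<open>Inl\<close> for the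
  first and \<open>Inr\<close> for the second block. The scalar multiple \<open>c \<cdot> X\<close> of a square matrix is written
  \<open>mat c ** X\<close>, since \<open>(*s)\<close> on nested vectors would multiply by a vector and \<open>(*\<^sub>R)\<close> by a real.
\<close>

type_synonym 'n cmat = "((complex, 'n) vec, 'n) vec"
type_synonym 'n cmat2 = "((complex, 'n + 'n) vec, 'n + 'n) vec"

definition block :: "('n::finite) cmat \<Rightarrow> 'n cmat \<Rightarrow> 'n cmat \<Rightarrow> 'n cmat \<Rightarrow> 'n cmat2" where
  "block A B C D = (\<chi> i j. case i of
       Inl a \<Rightarrow> (case j of Inl b \<Rightarrow> A $ a $ b | Inr b \<Rightarrow> B $ a $ b)
     | Inr a \<Rightarrow> (case j of Inl b \<Rightarrow> C $ a $ b | Inr b \<Rightarrow> D $ a $ b))"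

definition blkA :: "('n::finite) cmat2 \<Rightarrow> 'n cmat" where
  "blkA M = (\<chi> a b. M $ Inl a $ Inl b)"

definition blkB :: "('n::finite) cmat2 \<Rightarrow> 'n cmat" where
  "blkB M = (\<chi> a b. M $ Inl a $ Inr b)"

definition blkC :: "('n::finite) cmat2 \<Rightarrow> 'n cmat" where
  "blkC M = (\<chi> a b. M $ Inr a $ Inl b)"

definition blkD :: "('n::finite) cmat2 \<Rightarrow> 'n cmat" where
  "blkD M = (\<chi> a b. M $ Inr a $ Inr b)"


section \<open>Symplectic groups and Siegel space\<close>

definition siegel_H :: "('n::finite) cmat set" where
  "siegel_H = {\<tau>. transpose \<tau> = \<tau> \<and>
     (\<forall>x :: real^'n. x \<noteq> 0 \<longrightarrow> x \<bullet> ((\<chi> i j. Im (\<tau> $ i $ j)) *v x) > 0)}"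

definition sympJ :: "('n::finite) cmat2" where
  "sympJ = block 0 (mat 1) (- mat 1) 0"

definition Sp_C :: "('n::finite) cmat2 set" where
  "Sp_C = {M. M ** sympJ ** transpose M = sympJ}"

definition Sp_Z :: "('n::finite) cmat2 set" where
  "Sp_Z = {M \<in> Sp_C. \<forall>i j. M $ i $ j \<in> \<int>}"

definition U_C :: "('n::finite) cmat2 set" where
  "U_C = {block (mat 1) Z 0 (mat 1) | Z. transpose Z = Z}"

text \<open>The open submanifold \<open>\<^bold>B\<^sub>g\<close> of \<open>Sp_C\<close>.\<close>

definition bold_B :: "('n::finite) cmat2 set" where
  "bold_B = {M \<in> Sp_C. invertible (blkD M) \<and> blkB M ** matrix_inv (blkD M) \<in> siegel_H}"

text \<open>
  A point of \<open>Sp_Z \ Sp_C\<close> is an orbit of matrices, \<open>cls\<close> is the quotient map, and \<open>B_pts\<close> is the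
  moduli space \<open>B\<^sub>g(\<^bold>C)\<close> in its period coordinates, i.e. as the set \<open>Sp_Z \ \<^bold>B\<^sub>g\<close>.
\<close>

definition cls :: "('n::finite) cmat2 \<Rightarrow> 'n cmat2 set" where
  "cls M = {\<gamma> ** M | \<gamma>. \<gamma> \<in> Sp_Z}"

definition B_pts :: "('n::finite) cmat2 set set" where
  "B_pts = cls ` bold_B"


section \<open>Principally polarized complex tori with symplectic-Hodge basis\<close>

text \<open>
  A torus of dimension \<open>g\<close> is \<open>X = \<^bold>C\<^sup>g / L\<close>, so that \<open>H\<^sub>1(X, \<^bold>Z) = L\<close>.
  The polarization \<open>E\<close> is extended to a real bilinear form on \<open>\<^bold>C\<^sup>g = L \<otimes> \<^bold>R\<close>. In the same way a
  class in \<open>Hom(L, \<^bold>C)\<close> is represented by its unique real-linear extension \<open>\<^bold>C\<^sup>g \<Rightarrow> \<^bold>C\<close>, that is by a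
  translation invariant complex 1-form on \<open>X\<close>; its integral along a cycle \<open>\<lambda> \<in> L\<close> is its value
  at \<open>\<lambda>\<close>. The holomorphic differentials are the complex-linear forms.
\<close>

definition is_lattice :: "(complex^('n::finite)) set \<Rightarrow> bool" where
  "is_lattice L \<longleftrightarrow> (\<exists>S. independent S \<and> span S = UNIV \<and>
     L = {\<Sum>v\<in>S. of_int (c v) *\<^sub>R v | c :: complex^'n \<Rightarrow> int. True})"

text \<open>
  The positivity condition \<open>E(v, iv) > 0\<close> is the one for which the period matrix \<open>\<tau>\<close>, given by
  \<open>\<delta>\<^sub>i = \<Sum>\<^sub>j \<tau>\<^sub>i\<^sub>j \<gamma>\<^sub>j\<close> for a symplectic basis with \<open>E(\<gamma>\<^sub>i, \<delta>\<^sub>i) = 1\<close>, has positive imaginary part.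
  In the last condition only surjectivity of \<open>L \<Rightarrow> Hom(L, \<^bold>Z)\<close> is required: it is injective
  because \<open>E\<close> is nondegenerate.
\<close>

definition pp_torus ::
  "(complex^('n::finite)) set \<Rightarrow> (complex^'n \<Rightarrow> complex^'n \<Rightarrow> real) \<Rightarrow> bool" where
  "pp_torus L E \<longleftrightarrow>
     is_lattice L \<and> bilinear E \<and> (\<forall>v. E v v = 0) \<and>
     (\<forall>k\<in>L. \<forall>l\<in>L. E k l \<in> \<int>) \<and>
     (\<forall>v w. E (\<i> *s v) (\<i> *s w) = E v w) \<and>
     (\<forall>v. v \<noteq> 0 \<longrightarrow> E v (\<i> *s v) > 0) \<and>
     (\<forall>f :: complex^'n \<Rightarrow> int. (\<forall>k\<in>L. \<forall>l\<in>L. f (k + l) = f k + f l) \<longrightarrow>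
        (\<exists>\<gamma>\<in>L. \<forall>k\<in>L. of_int (f k) = E \<gamma> k))"

definition H1_dR :: "(complex^('n::finite) \<Rightarrow> complex) set" where
  "H1_dR = {\<alpha>. linear \<alpha>}"

definition holomorphic_forms :: "(complex^('n::finite) \<Rightarrow> complex) set" where
  "holomorphic_forms = {\<alpha> \<in> H1_dR. \<forall>c v. \<alpha> (c *s v) = c * \<alpha> v}"

text \<open>
  The classes \<open>E(\<gamma>, \<cdot>)\<close> with \<open>\<gamma> \<in> L\<close> span \<open>H1_dR\<close> over \<open>\<^bold>C\<close>, so the conditions below determine
  \<open>Q\<close> on \<open>H1_dR\<close>.
\<close>

definition is_dR_form ::
  "(complex^('n::finite)) set \<Rightarrow> (complex^'n \<Rightarrow> complex^'n \<Rightarrow> real) \<Rightarrow>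
   ((complex^'n \<Rightarrow> complex) \<Rightarrow> (complex^'n \<Rightarrow> complex) \<Rightarrow> complex) \<Rightarrow> bool" where
  "is_dR_form L E Q \<longleftrightarrow>
     (\<forall>\<alpha>\<in>H1_dR. \<forall>\<alpha>'\<in>H1_dR. \<forall>\<beta>\<in>H1_dR. \<forall>c.
        Q (\<lambda>v. \<alpha> v + c * \<alpha>' v) \<beta> = Q \<alpha> \<beta> + c * Q \<alpha>' \<beta> \<and>
        Q \<beta> (\<lambda>v. \<alpha> v + c * \<alpha>' v) = Q \<beta> \<alpha> + c * Q \<beta> \<alpha>') \<and>
     (\<forall>\<gamma>\<in>L. \<forall>\<gamma>'\<in>L. Q (\<lambda>v. of_real (E \<gamma> v)) (\<lambda>v. of_real (E \<gamma>' v))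
        = 1 / (2 * of_real pi * \<i>) * of_real (E \<gamma> \<gamma>'))"

text \<open>
  That \<open>(\<omega>, \<eta>)\<close> is a basis of \<open>H1_dR\<close>, whose complex dimension is \<open>2g\<close>, follows from the pairing
  conditions.
\<close>

definition sh_basis ::
  "(complex^('n::finite)) set \<Rightarrow> (complex^'n \<Rightarrow> complex^'n \<Rightarrow> real) \<Rightarrow>
   ('n \<Rightarrow> complex^'n \<Rightarrow> complex) \<Rightarrow> ('n \<Rightarrow> complex^'n \<Rightarrow> complex) \<Rightarrow> bool" where
  "sh_basis L E \<omega> \<eta> \<longleftrightarrow>
     (\<forall>j. \<omega> j \<in> holomorphic_forms) \<and> (\<forall>j. \<eta> j \<in> H1_dR) \<and>
     (\<exists>Q. is_dR_form L E Q \<and>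
        (\<forall>i j. Q (\<omega> i) (\<eta> j) = (if i = j then 1 else 0) \<and>
               Q (\<omega> i) (\<omega> j) = 0 \<and> Q (\<eta> i) (\<eta> j) = 0))"

text \<open>Linear independence of the \<open>\<gamma> i, \<delta> i\<close> follows from the values of \<open>E\<close>.\<close>

definition symp_H1_basis ::
  "(complex^('n::finite)) set \<Rightarrow> (complex^'n \<Rightarrow> complex^'n \<Rightarrow> real) \<Rightarrow>
   ('n \<Rightarrow> complex^'n) \<Rightarrow> ('n \<Rightarrow> complex^'n) \<Rightarrow> bool" where
  "symp_H1_basis L E \<gamma> \<delta> \<longleftrightarrow>
     L = {(\<Sum>i\<in>UNIV. of_int (m i) *\<^sub>R \<gamma> i) + (\<Sum>i\<in>UNIV. of_int (n i) *\<^sub>R \<delta> i)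
            | (m :: 'n \<Rightarrow> int) (n :: 'n \<Rightarrow> int). True} \<and>
     (\<forall>i j. E (\<gamma> i) (\<delta> j) = (if i = j then 1 else 0) \<and>
            E (\<gamma> i) (\<gamma> j) = 0 \<and> E (\<delta> i) (\<delta> j) = 0)"

definition period_mat ::
  "('n \<Rightarrow> complex^'n \<Rightarrow> complex) \<Rightarrow> ('n \<Rightarrow> complex^'n) \<Rightarrow> ('n::finite) cmat" where
  "period_mat \<alpha> \<gamma> = (\<chi> i j. \<alpha> j (\<gamma> i))"

text \<open>The point of \<open>Sp_Z \ Sp_C\<close> attached to the triple \<open>(X, E, b)\<close> with \<open>b = (\<omega>, \<eta>)\<close>.\<close>

definition period_class ::
  "(complex^('n::finite)) set \<Rightarrow> (complex^'n \<Rightarrow> complex^'n \<Rightarrow> real) \<Rightarrow>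
   ('n \<Rightarrow> complex^'n \<Rightarrow> complex) \<Rightarrow> ('n \<Rightarrow> complex^'n \<Rightarrow> complex) \<Rightarrow> 'n cmat2 set" where
  "period_class L E \<omega> \<eta> =
     {block (period_mat \<eta> \<delta>) (mat (1 / (2 * of_real pi * \<i>)) ** period_mat \<omega> \<delta>)
            (period_mat \<eta> \<gamma>) (mat (1 / (2 * of_real pi * \<i>)) ** period_mat \<omega> \<gamma>)
        | \<gamma> \<delta>. symp_H1_basis L E \<gamma> \<delta>}"


section \<open>Universal torus, Gauss-Manin connection, higher Ramanujan foliation\<close>

text \<open>
  The basis \<open>\<omega>\<close> trivializes the cotangent space at the origin, so that each isomorphism class of
  triples contains exactly one with \<open>\<omega>\<^sub>j = dz\<^sub>j\<close>. This normalized representative is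
  the fibre at \<open>x\<close> of the universal torus \<open>{(x, z). z \<in> \<^bold>C\<^sup>g / L\<^sub>x}\<close> over \<open>B\<^sub>g(\<^bold>C)\<close>, with its
  universal basis \<open>(\<omega>, \<eta>)\<close>. It is unique for \<open>x \<in> B_pts\<close>, so \<open>SOME\<close> makes no choice there.
\<close>

definition univ_triple ::
  "('n::finite) cmat2 set \<Rightarrow> (complex^'n) set \<times> (complex^'n \<Rightarrow> complex^'n \<Rightarrow> real) \<times>
     ('n \<Rightarrow> complex^'n \<Rightarrow> complex)" where
  "univ_triple x = (SOME (L, E, \<eta>). pp_torus L E \<and> sh_basis L E (\<lambda>j z. z $ j) \<eta> \<and>
     period_class L E (\<lambda>j z. z $ j) \<eta> = x)"

definition univ_H1 :: "('n::finite) cmat2 set \<Rightarrow> (complex^'n) set" where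
  "univ_H1 x = fst (univ_triple x)"

definition univ_eta :: "'n \<Rightarrow> ('n::finite) cmat2 set \<Rightarrow> complex^'n \<Rightarrow> complex" where
  "univ_eta j x = snd (snd (univ_triple x)) j"

text \<open>
  The quotient map \<open>cls : \<^bold>B\<^sub>g \<Rightarrow> B\<^sub>g(\<^bold>C)\<close> is a holomorphic covering, so tangent vectors and
  local functions on \<open>B\<^sub>g(\<^bold>C)\<close> near \<open>cls M\<close> are written on \<open>\<^bold>B\<^sub>g\<close> near \<open>M\<close>.
  \<open>tangent_Sp M\<close> is the tangent space of \<open>Sp_C\<close> at \<open>M\<close>, obtained by differentiating
  \<open>M J M\<^sup>T = J\<close>.
\<close>

definition tangent_Sp :: "('n::finite) cmat2 \<Rightarrow> 'n cmat2 set" where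
  "tangent_Sp M = {V. V ** sympJ ** transpose M + M ** sympJ ** transpose V = 0}"

text \<open>
  The local system of the lattices \<open>H\<^sub>1(X\<^sub>x, \<^bold>Z)\<close>: as they are discrete and vary continuously
  in \<open>\<^bold>C\<^sup>g\<close>, its sections are the continuous families of lattice vectors.
\<close>

definition H1_section :: "('n::finite) cmat2 set \<Rightarrow> ('n cmat2 \<Rightarrow> complex^'n) \<Rightarrow> bool" where
  "H1_section W c \<longleftrightarrow> continuous_on W c \<and> (\<forall>N\<in>W. c N \<in> univ_H1 (cls N))"

text \<open>
  The Gauss-Manin connection is the one for which \<open>d \<integral>\<^sub>c s = \<integral>\<^sub>c \<nabla>s\<close> for every local section
  \<open>c\<close> of this local system. \<open>gauss_manin s M V u\<close> says that \<open>\<nabla>\<^sub>V s = u\<close> at \<open>cls M\<close>, where \<open>V\<close> is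
  tangent at \<open>M\<close> and \<open>s\<close> is a section of the de Rham cohomology of the universal torus.
\<close>

definition gauss_manin ::
  "(('n::finite) cmat2 set \<Rightarrow> complex^'n \<Rightarrow> complex) \<Rightarrow> 'n cmat2 \<Rightarrow> 'n cmat2 \<Rightarrow>
   (complex^'n \<Rightarrow> complex) \<Rightarrow> bool" where
  "gauss_manin s M V u \<longleftrightarrow> u \<in> H1_dR \<and>
     (\<forall>W c. openin (top_of_set bold_B) W \<and> M \<in> W \<and> H1_section W c \<longrightarrow>
        (\<exists>D. ((\<lambda>N. s (cls N) (c N)) has_derivative D) (at M within W) \<and> D V = u (c M)))"

definition ramanujan_dist :: "('n::finite) cmat2 \<Rightarrow> 'n cmat2 set" where
  "ramanujan_dist M = {V \<in> tangent_Sp M. \<forall>j. gauss_manin (univ_eta j) M V (\<lambda>_. 0)}"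


section \<open>Leaves\<close>

definition complex_subspace :: "('n::finite) cmat2 set \<Rightarrow> bool" where
  "complex_subspace P \<longleftrightarrow> subspace P \<and> (\<forall>c. \<forall>X\<in>P. mat c ** X \<in> P)"

text \<open>
  \<open>F\<close> is a holomorphic immersion of an open subset \<open>U\<close> of the complex vector space \<open>P\<close> into
  \<open>\<^bold>B\<^sub>g\<close>, whose tangent space at every point is the whole fibre of the Ramanujan subbundle.
\<close>

definition integral_immersion ::
  "('n::finite) cmat2 set \<Rightarrow> 'n cmat2 set \<Rightarrow> ('n cmat2 \<Rightarrow> 'n cmat2) \<Rightarrow> bool" where
  "integral_immersion P U F \<longleftrightarrow>
     complex_subspace P \<and> openin (top_of_set P) U \<and> F ` U \<subseteq> bold_B \<and>
     (\<forall>t\<in>U. \<exists>D. (F has_derivative D) (at t within U) \<and>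
        (\<forall>c. \<forall>X\<in>P. D (mat c ** X) = mat c ** D X) \<and>
        inj_on D P \<and> D ` P = ramanujan_dist (F t))"

text \<open>
  An integral manifold of the foliation: an immersed complex submanifold of \<open>B\<^sub>g(\<^bold>C)\<close>, whose
  topology \<open>T\<close> may be finer than the subspace topology, tangent to the foliation and of the same
  rank. Its local parametrizations lift to \<open>\<^bold>B\<^sub>g\<close>, as \<open>cls\<close> is a covering.
\<close>

definition integral_manifold :: "('n::finite) cmat2 set topology \<Rightarrow> bool" where
  "integral_manifold T \<longleftrightarrow>
     topspace T \<subseteq> B_pts \<and> Hausdorff_space T \<and> second_countable T \<and>
     (\<forall>x\<in>topspace T. \<exists>P U F W. integral_immersion P U F \<and>
        openin T W \<and> x \<in> W \<and>
        homeomorphic_map (top_of_set U) (subtopology T W) (cls \<circ> F))"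

definition ramanujan_leaf :: "('n::finite) cmat2 set set \<Rightarrow> bool" where
  "ramanujan_leaf S \<longleftrightarrow> S \<noteq> {} \<and>
     (\<exists>T. integral_manifold T \<and> connected_space T \<and> topspace T = S) \<and>
     (\<forall>T. integral_manifold T \<and> connected_space T \<and> S \<subseteq> topspace T \<longrightarrow> topspace T = S)"


section \<open>The parametrizations\<close>

definition U_dom :: "('n::finite) cmat2 \<Rightarrow> 'n cmat set" where
  "U_dom \<delta> = {\<tau> \<in> siegel_H. invertible (blkC \<delta> ** \<tau> + blkD \<delta>)}"

definition moebius :: "('n::finite) cmat2 \<Rightarrow> 'n cmat \<Rightarrow> 'n cmat" where
  "moebius \<delta> \<tau> = (blkA \<delta> ** \<tau> + blkB \<delta>) ** matrix_inv (blkC \<delta> ** \<tau> + blkD \<delta>)"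

definition psi :: "('n::finite) cmat2 \<Rightarrow> 'n cmat \<Rightarrow> 'n cmat2" where
  "psi \<delta> \<tau> = matrix_inv \<delta> ** block (mat 1) (moebius \<delta> \<tau>) 0 (mat 1)"

definition phi :: "('n::finite) cmat2 \<Rightarrow> 'n cmat \<Rightarrow> 'n cmat2 set" where
  "phi \<delta> \<tau> = cls (psi \<delta> \<tau>)"

end

theory Submission
  imports Defs "HOL-Computational_Algebra.Polynomial"
begin

text \<open>
  In period coordinates the section \<open>\<integral>\<^sub>c \<eta>\<^sub>j\<close> is an integral combination, with locally constant
  coefficients, of the entries in the \<open>j\<close>-th column of the first block column of \<open>M\<close>. The Ramanujan
  subbundle at \<open>M\<close> is therefore the space of tangent vectors whose first block column vanishes, which
  is \<open>M \<cdot> Lie U_C\<close>, and the foliation on \<open>bold_B\<close> is the one by the cosets \<open>M U_C\<close>. Declaring small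
  pieces of these cosets open gives a Hausdorff topology on all of \<open>B_pts\<close>, into which every integral
  manifold maps continuously. The images of the sets \<open>M U_C \<inter> bold_B\<close> are open and disjoint in it,
  and connected because \<open>U_dom \<delta>\<close> is connected, so they are exactly its components.
\<close>


section \<open>Block matrices and symplectic groups\<close>

text \<open>The Siegel condition is used as positivity of a Hermitian form attached to M. This
  removes the inverse from the definition of \<open>bold_B\<close>; openness, stability under
  \<open>Sp_Z\<close>, independence of the periods over the reals and positivity of the polarization
  all come from that one form. Since the universal triple is chosen by \<open>SOME\<close>, a
  polarized torus with symplectic-Hodge basis must first be built from every M in
  \<open>bold_B\<close>; the chosen triple is then pinned down because M itself occurs among its
  period matrices. As \<open>bold_B\<close> is not open in the space of all matrices, a derivative
  within it is not unique, and only its values on tangent vectors mean anything. The set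
  \<open>U_dom \<delta>\<close> is the convex set \<open>siegel_H\<close> minus the zero set of
  det(C \<tau> + D). That it is connected depends on the equation being complex, and that it is
  nonempty depends on \<delta> being invertible. The Hausdorff property of the leaf topology comes
  from the discreteness of the integral matrices.\<close>

lemma sum_UNIV_Plus:
  fixes f :: "'a::finite + 'b::finite \<Rightarrow> 'c::comm_monoid_add"
  shows "sum f UNIV = (\<Sum>a\<in>UNIV. f (Inl a)) + (\<Sum>b\<in>UNIV. f (Inr b))"
  using sum.Plus[of "UNIV :: 'a set" "UNIV :: 'b set" f] by (simp add: comp_def)

lemma matrix_mult_minus_left [simp]: "(- A) ** B = - (A ** B)" for A :: "'a::ring_1^'n^'m"
  by (simp add: matrix_matrix_mult_def vec_eq_iff sum_negf)

lemma matrix_mult_minus_right [simp]: "A ** (- B) = - (A ** B)" for A :: "'a::ring_1^'n^'m"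
  by (simp add: matrix_matrix_mult_def vec_eq_iff sum_negf)

lemma transpose_minus [simp]: "transpose (- A) = - transpose A" for A :: "'a::ring_1^'n^'m"
  by (simp add: transpose_def vec_eq_iff)

lemma transpose_add: "transpose (A + B) = transpose A + transpose B"
  by (simp add: transpose_def vec_eq_iff)

lemma transpose_zero [simp]: "transpose (0 :: 'a::zero^'n^'m) = 0"
  by (simp add: transpose_def vec_eq_iff)

lemma matrix_add_rdistrib: "(A + B) ** C = A ** C + B ** C" for A :: "'a::semiring_1^'n^'m"
  by (simp add: matrix_matrix_mult_def vec_eq_iff distrib_right sum.distrib)

lemma linear_matrix_mult_left: "linear (\<lambda>B. A ** B)" for A :: "complex^'n^'m"
  by (rule linearI, rule matrix_add_ldistrib) (simp add: matrix_matrix_mult_def vec_eq_iff scaleR_right.sum)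

lemma linear_matrix_mult_right: "linear (\<lambda>A. A ** B)" for B :: "complex^'n^'m"
  by (rule linearI, rule matrix_add_rdistrib) (simp add: matrix_matrix_mult_def vec_eq_iff scaleR_right.sum)

lemma transpose_block:
  "transpose (block A B C D) = block (transpose A) (transpose C) (transpose B) (transpose D)"
  by (simp add: transpose_def block_def vec_eq_iff split: sum.split)

lemma block_mult:
  "block A B C D ** block A' B' C' D' =
   block (A ** A' + B ** C') (A ** B' + B ** D') (C ** A' + D ** C') (C ** B' + D ** D')"
  by (simp add: block_def matrix_matrix_mult_def vec_eq_iff sum_UNIV_Plus split: sum.split)

lemma block_add: "block A B C D + block A' B' C' D' = block (A + A') (B + B') (C + C') (D + D')"
  by (simp add: block_def vec_eq_iff split: sum.split)

lemma block_minus: "- block A B C D = block (- A) (- B) (- C) (- D)"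
  by (simp add: block_def vec_eq_iff split: sum.split)

lemma block_eq_iff:
  "block A B C D = block A' B' C' D' \<longleftrightarrow> A = A' \<and> B = B' \<and> C = C' \<and> D = D'"
proof
  assume *: "block A B C D = block A' B' C' D'"
  have "block A B C D $ i $ j = block A' B' C' D' $ i $ j" for i j
    using * by simp
  from this[of "Inl _" "Inl _"] this[of "Inl _" "Inr _"] this[of "Inr _" "Inl _"]
    this[of "Inr _" "Inr _"]
  show "A = A' \<and> B = B' \<and> C = C' \<and> D = D'"
    by (simp add: block_def vec_eq_iff)
qed simp

lemma block_blk: "block (blkA M) (blkB M) (blkC M) (blkD M) = M"
  by (simp add: block_def blkA_def blkB_def blkC_def blkD_def vec_eq_iff split: sum.split)

lemma blk_block [simp]:
  "blkA (block A B C D) = A" "blkB (block A B C D) = B"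
  "blkC (block A B C D) = C" "blkD (block A B C D) = D"
  by (simp_all add: block_def blkA_def blkB_def blkC_def blkD_def vec_eq_iff)

lemma block_zero: "block 0 0 0 0 = 0"
  by (simp add: block_def vec_eq_iff split: sum.split)

lemma mat_1_block: "mat 1 = block (mat 1) 0 0 (mat 1)"
  by (simp add: block_def mat_def vec_eq_iff split: sum.split)

lemma block_cases: obtains A B C D where "M = block A B C D"
  using block_blk[of M] by metis

section \<open>Inversion in the symplectic group\<close>

lemma sympJ_sq: "sympJ ** sympJ = - mat 1"
  by (simp add: sympJ_def block_mult block_minus mat_1_block)

lemma transpose_sympJ: "transpose sympJ = - sympJ"
  by (simp add: sympJ_def transpose_block block_minus)

text \<open>As J^2 = -1, the relation M J M^T = J can be solved for the inverse of M. The formula is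
  polynomial in the entries, so it visibly preserves integrality.\<close>

definition sp_inv :: "('n::finite) cmat2 \<Rightarrow> 'n cmat2" where
  "sp_inv M = - (sympJ ** transpose M ** sympJ)"

lemma sp_inv_right: assumes "M \<in> Sp_C" shows "M ** sp_inv M = mat 1"
proof -
  have "M ** sp_inv M = - ((M ** sympJ ** transpose M) ** sympJ)"
    by (simp add: sp_inv_def matrix_mul_assoc)
  then show ?thesis
    using assms by (simp add: Sp_C_def sympJ_sq)
qed

lemma sp_inv_left: assumes "M \<in> Sp_C" shows "sp_inv M ** M = mat 1"
  using sp_inv_right[OF assms] by (simp add: matrix_left_right_inverse)

text \<open>A right inverse of a square matrix is also a left inverse; expanding
  \<open>sp_inv M ** M\<close> turns relations between rows into relations between columns.\<close>

lemma Sp_C_transpose: assumes "M \<in> Sp_C" shows "transpose M ** sympJ ** M = sympJ"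
proof -
  have "sympJ ** (sp_inv M ** M) = transpose M ** sympJ ** M"
    by (simp add: sp_inv_def matrix_mul_assoc sympJ_sq)
  then show ?thesis
    using sp_inv_left[OF assms] by simp
qed

lemma invertible_Sp_C: assumes "M \<in> Sp_C" shows "invertible M"
  using sp_inv_left[OF assms] sp_inv_right[OF assms] unfolding invertible_def by blast

lemma matrix_inv_Sp_C: assumes "M \<in> Sp_C" shows "matrix_inv M = sp_inv M"
proof -
  have "matrix_inv M = matrix_inv M ** (M ** sp_inv M)"
    using sp_inv_right[OF assms] by simp
  also have "\<dots> = (matrix_inv M ** M) ** sp_inv M"
    by (simp add: matrix_mul_assoc)
  also have "matrix_inv M ** M = mat 1"
    using invertible_Sp_C[OF assms] unfolding invertible_def matrix_inv_def
    by (metis (mono_tags, lifting) someI_ex)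
  finally show ?thesis by simp
qed

lemma Sp_C_mult: assumes "M \<in> Sp_C" "N \<in> Sp_C" shows "M ** N \<in> Sp_C"
proof -
  have "(M ** N) ** sympJ ** transpose (M ** N) = M ** (N ** sympJ ** transpose N) ** transpose M"
    by (simp add: matrix_transpose_mul matrix_mul_assoc)
  then show ?thesis using assms by (simp add: Sp_C_def)
qed

lemma Sp_C_one: "mat 1 \<in> Sp_C"
  unfolding Sp_C_def by simp

lemma sp_inv_Sp_C: assumes "M \<in> Sp_C" shows "sp_inv M \<in> Sp_C"
proof -
  have "transpose (sp_inv M) = - (sympJ ** M ** sympJ)"
    by (simp add: sp_inv_def matrix_transpose_mul transpose_sympJ matrix_mul_assoc)
  then have "sp_inv M ** sympJ ** transpose (sp_inv M)
      = sympJ ** transpose M ** (sympJ ** sympJ) ** sympJ ** M ** sympJ"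
    by (simp add: sp_inv_def matrix_mul_assoc)
  also have "\<dots> = - (sympJ ** (transpose M ** sympJ ** M) ** sympJ)"
    by (simp add: sympJ_sq matrix_mul_assoc)
  also have "\<dots> = sympJ"
    by (simp add: Sp_C_transpose[OF assms] sympJ_sq)
  finally show ?thesis by (simp add: Sp_C_def)
qed

section \<open>The integral subgroup and its orbits\<close>

lemma Sp_Z_subset: "Sp_Z \<subseteq> Sp_C"
  by (auto simp: Sp_Z_def)

lemma Sp_Z_one: "mat 1 \<in> Sp_Z"
  using Sp_C_one by (auto simp: Sp_Z_def) (simp add: mat_def)

lemma Ints_matrix_mult:
  fixes M N :: "('n::finite) cmat2"
  assumes "\<forall>i j. M $ i $ j \<in> \<int>" "\<forall>i j. N $ i $ j \<in> \<int>" shows "\<forall>i j. (M ** N) $ i $ j \<in> \<int>"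
  using assms by (auto simp: matrix_matrix_mult_def intro!: Ints_sum Ints_mult)

lemma Sp_Z_mult: assumes "M \<in> Sp_Z" "N \<in> Sp_Z" shows "M ** N \<in> Sp_Z"
  using assms Ints_matrix_mult[of M N] Sp_C_mult[of M N] by (simp add: Sp_Z_def)

lemma Ints_sympJ: "\<forall>i j. (sympJ :: ('n::finite) cmat2) $ i $ j \<in> \<int>"
  by (simp add: sympJ_def block_def mat_def split: sum.split)

lemma sp_inv_Sp_Z: assumes "M \<in> Sp_Z" shows "sp_inv M \<in> Sp_Z"
proof -
  have "\<forall>i j. transpose M $ i $ j \<in> \<int>"
    using assms by (simp add: Sp_Z_def transpose_def)
  then have "\<forall>i j. (sympJ ** transpose M ** sympJ) $ i $ j \<in> \<int>"
    by (intro Ints_matrix_mult Ints_sympJ)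
  then show ?thesis
    using assms sp_inv_Sp_C[of M] by (simp add: Sp_Z_def sp_inv_def)
qed

lemma self_in_cls: "M \<in> cls M"
  unfolding cls_def using Sp_Z_one by (auto intro!: exI[of _ "mat 1"])

lemma cls_mult_Sp_Z: assumes "\<gamma> \<in> Sp_Z" shows "cls (\<gamma> ** M) = cls M"
proof
  show "cls (\<gamma> ** M) \<subseteq> cls M"
    using assms by (auto simp: cls_def matrix_mul_assoc intro: Sp_Z_mult)
  show "cls M \<subseteq> cls (\<gamma> ** M)"
  proof
    fix N assume "N \<in> cls M"
    then obtain \<beta> where \<beta>: "\<beta> \<in> Sp_Z" "N = \<beta> ** M" by (auto simp: cls_def)
    have "sp_inv \<gamma> ** \<gamma> = mat 1"
      using assms Sp_Z_subset sp_inv_left by blast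
    then have "N = (\<beta> ** sp_inv \<gamma>) ** (\<gamma> ** M)"
      using \<beta> by (metis matrix_mul_assoc matrix_mul_rid)
    then show "N \<in> cls (\<gamma> ** M)"
      using \<beta> assms by (auto simp: cls_def intro: Sp_Z_mult sp_inv_Sp_Z)
  qed
qed

lemma cls_eqD: assumes "cls M = cls N" obtains \<gamma> where "\<gamma> \<in> Sp_Z" "M = \<gamma> ** N"
  using self_in_cls[of M] assms by (auto simp: cls_def)


section \<open>The Siegel condition without inverses\<close>

lemma matrix_inv_cancel:
  fixes K :: "complex^'n^'n"
  assumes "invertible K"
  shows "K ** matrix_inv K = mat 1" "matrix_inv K ** K = mat 1"
proof -
  have "K ** matrix_inv K = mat 1 \<and> matrix_inv K ** K = mat 1"
    using assms unfolding invertible_def matrix_inv_def by (rule someI_ex)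
  then show "K ** matrix_inv K = mat 1" "matrix_inv K ** K = mat 1" by auto
qed

text \<open>Bilinear rather than Hermitian, so that transposes move across it; conjugation is
  inserted separately by \<open>vcnj\<close>.\<close>

definition cdot :: "complex^('k::finite) \<Rightarrow> complex^'k \<Rightarrow> complex" where
  "cdot x y = (\<Sum>i\<in>UNIV. x $ i * y $ i)"

lemma cdot_matrix_left: "cdot (M *v x) y = cdot x (transpose M *v y)"
proof -
  have "cdot (M *v x) y = (\<Sum>i\<in>UNIV. \<Sum>j\<in>UNIV. M $ i $ j * x $ j * y $ i)"
    by (simp add: cdot_def matrix_vector_mult_def sum_distrib_right)
  also have "\<dots> = (\<Sum>j\<in>UNIV. \<Sum>i\<in>UNIV. M $ i $ j * x $ j * y $ i)"
    by (rule sum.swap)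
  also have "\<dots> = cdot x (transpose M *v y)"
    unfolding cdot_def by (simp add: vector_matrix_mult_def sum_distrib_left mult.commute mult.left_commute)
  finally show ?thesis .
qed

lemma cdot_commute: "cdot x y = cdot y x"
  by (simp add: cdot_def mult.commute)

definition vjoin :: "complex^('n::finite) \<Rightarrow> complex^'n \<Rightarrow> complex^('n + 'n)" where
  "vjoin p q = (\<chi> k. case k of Inl a \<Rightarrow> p $ a | Inr b \<Rightarrow> q $ b)"

lemma vjoin_component [simp]: "vjoin p q $ Inl a = p $ a" "vjoin p q $ Inr a = q $ a"
  by (simp_all add: vjoin_def)

lemma vjoin_cases: obtains p q where "z = vjoin p q"
proof
  show "z = vjoin (\<chi> a. z $ Inl a) (\<chi> a. z $ Inr a)"
    by (simp add: vjoin_def vec_eq_iff split: sum.split)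
qed

lemma vjoin_eq_iff: "vjoin p q = vjoin p' q' \<longleftrightarrow> p = p' \<and> q = q'"
  unfolding vec_eq_iff by (metis vjoin_component sum.exhaust)

lemma vjoin_zero: "vjoin 0 0 = 0"
  by (simp add: vjoin_def vec_eq_iff split: sum.split)

lemma block_mult_vjoin: "block A B C D *v vjoin p q = vjoin (A *v p + B *v q) (C *v p + D *v q)"
  by (simp add: vjoin_def block_def matrix_vector_mult_def vec_eq_iff sum_UNIV_Plus split: sum.split)

lemma vjoin_mult_block: "vjoin p q v* block A B C D = vjoin (p v* A + q v* C) (p v* B + q v* D)"
  by (simp add: vjoin_def block_def vector_matrix_mult_def vec_eq_iff sum_UNIV_Plus split: sum.split)

lemma matrix_vector_mult_minus_left: "(- A) *v x = - (A *v x)" for A :: "complex^'n^'m"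
  by (simp add: matrix_vector_mult_def vec_eq_iff sum_negf)

lemma cdot_vjoin: "cdot (vjoin p q) (vjoin p' q') = cdot p p' + cdot q q'"
  by (simp add: cdot_def sum_UNIV_Plus)

lemma cdot_minus_right: "cdot p (- q) = - cdot p q"
  by (simp add: cdot_def sum_negf)

lemma cdot_sympJ: "cdot (vjoin p q) (sympJ *v vjoin p' q') = cdot p q' - cdot q p'"
  by (simp add: sympJ_def block_mult_vjoin cdot_vjoin matrix_vector_mult_minus_left cdot_minus_right)

lemma cdot_sympJ_Sp_C:
  assumes "M \<in> Sp_C" shows "cdot (M *v x) (sympJ *v (M *v y)) = cdot x (sympJ *v y)"
proof -
  have "cdot (M *v x) (sympJ *v (M *v y)) = cdot x ((transpose M ** sympJ ** M) *v y)"
    unfolding cdot_matrix_left matrix_vector_mul_assoc by (simp only: matrix_mul_assoc)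
  then show ?thesis by (simp only: Sp_C_transpose[OF assms])
qed

definition vcnj :: "complex^('k::finite) \<Rightarrow> complex^'k" where
  "vcnj x = (\<chi> i. cnj (x $ i))"

lemma vcnj_vjoin: "vcnj (vjoin p q) = vjoin (vcnj p) (vcnj q)"
  by (simp add: vcnj_def vjoin_def vec_eq_iff split: sum.split)

lemma vcnj_matrix_mult:
  assumes "\<forall>i j. M $ i $ j \<in> \<int>" shows "vcnj (M *v x) = M *v vcnj x"
proof -
  have "cnj (M $ i $ j) = M $ i $ j" for i j
    using assms by (metis Ints_cases complex_cnj_of_int)
  then show ?thesis by (simp add: vcnj_def matrix_vector_mult_def vec_eq_iff)
qed

text \<open>
  Writing \<open>\<tau> = B D\<^sup>-\<^sup>1\<close>, this is \<open>w \<mapsto> (Dw)\<^sup>* (Im \<tau>) (Dw)\<close>; in this form the condition that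
  \<open>M\<close> lies in \<open>bold_B\<close> involves no matrix inverse.
\<close>

definition siegel_form :: "('n::finite) cmat2 \<Rightarrow> complex^'n \<Rightarrow> real" where
  "siegel_form M w = Im (cdot (vcnj (blkD M *v w)) (blkB M *v w))"

text \<open>The vector z = M (0, w) has the halves Bw and Dw. Written through conj(z)^T J z, the
  form is visibly invariant under real symplectic matrices, which preserve J and commute with
  conjugation.\<close>

lemma siegel_form_sympJ:
  "siegel_form M w =
   - Im (cdot (vcnj (M *v vjoin 0 w)) (sympJ *v (M *v vjoin 0 w))) / 2"
proof -
  obtain A B C D where M: "M = block A B C D" by (rule block_cases)
  have "Im (cdot (vcnj p) q) = - Im (cdot (vcnj q) p)" for p q :: "complex^'n"
    by (simp add: cdot_def vcnj_def sum_negf[symmetric] algebra_simps)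
  from this[of "B *v w" "D *v w"] show ?thesis
    by (simp add: M siegel_form_def block_mult_vjoin vcnj_vjoin cdot_sympJ)
qed

lemma siegel_form_Sp_Z:
  assumes "\<gamma> \<in> Sp_Z" shows "siegel_form (\<gamma> ** M) w = siegel_form M w"
proof -
  have 1: "\<forall>i j. \<gamma> $ i $ j \<in> \<int>" "\<gamma> \<in> Sp_C" using assms by (auto simp: Sp_Z_def)
  show ?thesis
    unfolding siegel_form_sympJ matrix_vector_mul_assoc[of \<gamma>, symmetric] vcnj_matrix_mult[OF 1(1)]
      cdot_sympJ_Sp_C[OF 1(2)] ..
qed

text \<open>With z split into real and imaginary parts, the cross terms involve only Re \<tau> and
  cancel because \<tau> is symmetric.\<close>

lemma siegel_H_form:
  assumes "transpose \<tau> = \<tau>"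
  shows "Im (cdot (vcnj z) (\<tau> *v z)) =
     (\<chi> i. Re (z $ i)) \<bullet> ((\<chi> i j. Im (\<tau> $ i $ j)) *v (\<chi> i. Re (z $ i))) +
     (\<chi> i. Im (z $ i)) \<bullet> ((\<chi> i j. Im (\<tau> $ i $ j)) *v (\<chi> i. Im (z $ i)))"
proof -
  have sym: "\<tau> $ i $ j = \<tau> $ j $ i" for i j
    using assms by (metis transpose_def vec_lambda_beta)
  have "(\<Sum>i\<in>UNIV. \<Sum>j\<in>UNIV. Re (\<tau> $ i $ j) * Re (z $ i) * Im (z $ j))
      = (\<Sum>j\<in>UNIV. \<Sum>i\<in>UNIV. Re (\<tau> $ i $ j) * Re (z $ i) * Im (z $ j))"
    by (rule sum.swap)
  also have "\<dots> = (\<Sum>i\<in>UNIV. \<Sum>j\<in>UNIV. Re (\<tau> $ i $ j) * Im (z $ i) * Re (z $ j))"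
    by (intro sum.cong refl) (subst sym, simp)
  finally have swap: "(\<Sum>i\<in>UNIV. \<Sum>j\<in>UNIV. Re (\<tau> $ i $ j) * Re (z $ i) * Im (z $ j))
      = (\<Sum>i\<in>UNIV. \<Sum>j\<in>UNIV. Re (\<tau> $ i $ j) * Im (z $ i) * Re (z $ j))" .
  have "Im (cdot (vcnj z) (\<tau> *v z)) = (\<Sum>i\<in>UNIV. \<Sum>j\<in>UNIV.
      Im (\<tau> $ i $ j) * (Re (z $ i) * Re (z $ j)) + Im (\<tau> $ i $ j) * (Im (z $ i) * Im (z $ j)) +
      (Re (\<tau> $ i $ j) * Re (z $ i) * Im (z $ j) - Re (\<tau> $ i $ j) * Im (z $ i) * Re (z $ j)))"
    by (simp add: cdot_def vcnj_def matrix_vector_mult_def sum_distrib_left algebra_simps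
        flip: sum.distrib sum_subtractf)
  also have "\<dots> = (\<Sum>i\<in>UNIV. \<Sum>j\<in>UNIV. Im (\<tau> $ i $ j) * (Re (z $ i) * Re (z $ j))) +
      (\<Sum>i\<in>UNIV. \<Sum>j\<in>UNIV. Im (\<tau> $ i $ j) * (Im (z $ i) * Im (z $ j)))"
    using swap by (simp add: sum.distrib sum_subtractf)
  finally show ?thesis
    by (simp add: inner_vec_def matrix_vector_mult_def sum_distrib_left mult.left_commute)
qed

lemma siegel_H_pos:
  assumes "\<tau> \<in> siegel_H" "z \<noteq> 0" shows "Im (cdot (vcnj z) (\<tau> *v z)) > 0"
proof -
  let ?q = "\<lambda>x :: real^'a. x \<bullet> ((\<chi> i j. Im (\<tau> $ i $ j)) *v x)"
  have pos: "?q x > 0" if "x \<noteq> 0" for x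
    using assms(1) that by (simp add: siegel_H_def)
  then have nn: "?q x \<ge> 0" for x
    by (cases "x = 0") (auto simp: less_imp_le)
  have "(\<chi> i. Re (z $ i)) \<noteq> 0 \<or> (\<chi> i. Im (z $ i)) \<noteq> 0"
    using assms(2) by (auto simp: vec_eq_iff complex_eq_iff)
  moreover have "transpose \<tau> = \<tau>"
    using assms(1) by (simp add: siegel_H_def)
  ultimately show ?thesis
    using pos nn by (auto simp: siegel_H_form intro: add_pos_nonneg add_nonneg_pos)
qed

lemma Sp_C_blocks:
  assumes "block A B C D \<in> Sp_C"
  shows "transpose B ** D = transpose D ** B"
proof -
  have "block (transpose A) (transpose C) (transpose B) (transpose D) ** sympJ ** block A B C D = sympJ"
    using Sp_C_transpose[OF assms] by (simp add: transpose_block)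
  then have "transpose B ** D - transpose D ** B = 0"
    by (simp add: sympJ_def block_mult block_eq_iff)
  then show ?thesis by simp
qed

text \<open>Forwards, B = \<tau> D reduces the form to \<tau> evaluated at Dw. Backwards, positivity
  alone makes D injective, and the symmetry of B D^-1 is the symplectic relation B^T D = D^T
  B.\<close>

lemma bold_B_iff: "M \<in> bold_B \<longleftrightarrow> M \<in> Sp_C \<and> (\<forall>w. w \<noteq> 0 \<longrightarrow> siegel_form M w > 0)"
proof
  assume M: "M \<in> bold_B"
  define \<tau> where "\<tau> = blkB M ** matrix_inv (blkD M)"
  have inv: "invertible (blkD M)" and \<tau>: "\<tau> \<in> siegel_H" and "M \<in> Sp_C"
    using M by (auto simp: bold_B_def \<tau>_def)
  have B: "blkB M = \<tau> ** blkD M"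
    by (simp add: \<tau>_def flip: matrix_mul_assoc) (simp add: matrix_inv_cancel[OF inv])
  have "siegel_form M w > 0" if "w \<noteq> 0" for w
  proof -
    have "blkD M *v w \<noteq> 0"
      using that inv by (metis invertible_left_inverse matrix_left_invertible_ker)
    from siegel_H_pos[OF \<tau> this] show ?thesis
      by (simp add: siegel_form_def B matrix_vector_mul_assoc)
  qed
  with \<open>M \<in> Sp_C\<close> show "M \<in> Sp_C \<and> (\<forall>w. w \<noteq> 0 \<longrightarrow> siegel_form M w > 0)" by blast
next
  assume *: "M \<in> Sp_C \<and> (\<forall>w. w \<noteq> 0 \<longrightarrow> siegel_form M w > 0)"
  obtain A B C D where M: "M = block A B C D" by (rule block_cases)
  have sp: "block A B C D \<in> Sp_C" and pos: "\<And>w. w \<noteq> 0 \<Longrightarrow> Im (cdot (vcnj (D *v w)) (B *v w)) > 0"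
    using * by (auto simp: M siegel_form_def)
  have "w = 0" if "D *v w = 0" for w
    using pos[of w] that by (force simp: cdot_def vcnj_def)
  then have inv: "invertible D"
    by (simp add: invertible_left_inverse matrix_left_invertible_ker)
  define \<tau> where "\<tau> = B ** matrix_inv D"
  have "transpose \<tau> = transpose (matrix_inv D) ** transpose B ** (D ** matrix_inv D)"
    by (simp add: \<tau>_def matrix_transpose_mul matrix_inv_cancel[OF inv])
  also have "\<dots> = transpose (matrix_inv D) ** (transpose B ** D) ** matrix_inv D"
    by (simp add: matrix_mul_assoc)
  also have "\<dots> = transpose (D ** matrix_inv D) ** (B ** matrix_inv D)"
    by (simp add: Sp_C_blocks[OF sp] matrix_mul_assoc matrix_transpose_mul)
  also have "\<dots> = \<tau>"
    by (simp add: matrix_inv_cancel[OF inv] \<tau>_def)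
  finally have sym: "transpose \<tau> = \<tau>" .
  have "x \<bullet> ((\<chi> i j. Im (\<tau> $ i $ j)) *v x) > 0" if "x \<noteq> 0" for x :: "real^'a"
  proof -
    \<comment> \<open>The test vector w = D^-1 x makes Dw real, so only the real quadratic form of
      Im \<tau> at x survives.\<close>
    let ?z = "\<chi> i. complex_of_real (x $ i)"
    have z: "D *v (matrix_inv D *v ?z) = ?z" "B *v (matrix_inv D *v ?z) = \<tau> *v ?z"
      by (simp_all add: matrix_vector_mul_assoc matrix_inv_cancel[OF inv] \<tau>_def)
    moreover have "?z \<noteq> 0" using that by (simp add: vec_eq_iff)
    ultimately have "Im (cdot (vcnj ?z) (\<tau> *v ?z)) > 0"
      using pos[of "matrix_inv D *v ?z"] by (metis matrix_vector_mult_0_right)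
    then show ?thesis
      by (simp add: siegel_H_form[OF sym] zero_vec_def[symmetric])
  qed
  then show "M \<in> bold_B"
    using sym inv * by (simp add: bold_B_def siegel_H_def M \<tau>_def)
qed

lemma bold_B_subset: "bold_B \<subseteq> Sp_C"
  by (auto simp: bold_B_def)

lemma bold_B_Sp_Z: assumes "\<gamma> \<in> Sp_Z" "M \<in> bold_B" shows "\<gamma> ** M \<in> bold_B"
  using assms Sp_Z_subset by (auto simp: bold_B_iff siegel_form_Sp_Z intro: Sp_C_mult)

lemma cls_in_B_pts_iff: "cls M \<in> B_pts \<longleftrightarrow> M \<in> bold_B"
proof
  assume "cls M \<in> B_pts"
  then obtain N where N: "N \<in> bold_B" "cls M = cls N" by (auto simp: B_pts_def)
  then show "M \<in> bold_B" using bold_B_Sp_Z by (metis cls_eqD)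
qed (simp add: B_pts_def)

lemma siegel_form_scale: "siegel_form M (c *\<^sub>R w) = c\<^sup>2 * siegel_form M w"
  by (simp add: siegel_form_def linear_cmul[OF matrix_vector_mul_linear] vcnj_def cdot_def power2_eq_square
      sum_distrib_left algebra_simps)

lemma continuous_on_siegel_form: "continuous_on S (\<lambda>p. siegel_form (fst p) (snd p))"
  unfolding siegel_form_def cdot_def vcnj_def matrix_vector_mult_def blkB_def blkD_def
  by (simp, intro continuous_intros)

text \<open>The form is homogeneous of degree 2 in w, so positivity need only be kept on the unit
  sphere; its compactness gives, by the tube lemma, one radius for all w.\<close>

lemma bold_B_open:
  assumes "M \<in> bold_B"
  obtains e where "e > 0" "\<And>N. N \<in> Sp_C \<Longrightarrow> dist N M < e \<Longrightarrow> N \<in> bold_B"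
proof -
  let ?O = "{p :: 'a cmat2 \<times> (complex^'a). 0 < siegel_form (fst p) (snd p)}"
  have "open ?O"
    by (intro open_Collect_less continuous_on_const continuous_on_siegel_form)
  then have "openin (prod_topology euclidean euclidean) ?O" by simp
  moreover have "{M} \<times> sphere 0 1 \<subseteq> ?O"
    using assms by (auto simp: bold_B_iff) (metis norm_zero zero_neq_one)
  ultimately obtain U V where UV: "open U" "M \<in> U" "sphere 0 1 \<subseteq> V" "U \<times> V \<subseteq> ?O"
    using tube_lemma_right[of euclidean euclidean ?O "sphere 0 1" M]
    by auto
  from UV(1,2) obtain e where e: "e > 0" "\<And>N. dist N M < e \<Longrightarrow> N \<in> U"
    by (auto simp: open_dist)
  show ?thesis
  proof
    fix N assume N: "N \<in> Sp_C" "dist N M < e"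
    have "siegel_form N w > 0" if "w \<noteq> 0" for w
    proof -
      have "(1 / norm w) *\<^sub>R w \<in> sphere 0 1" using that by simp
      then have "0 < siegel_form N ((1 / norm w) *\<^sub>R w)"
        using UV(3,4) e(2)[OF N(2)] by force
      then show ?thesis
        by (simp add: siegel_form_scale zero_less_mult_iff)
    qed
    with N show "N \<in> bold_B" by (simp add: bold_B_iff)
  qed (fact e)
qed


section \<open>Lattices and polarizations from period matrices\<close>

definition cvec :: "real^('k::finite) \<Rightarrow> complex^'k" where
  "cvec x = (\<chi> i. complex_of_real (x $ i))"

lemma cvec_component [simp]: "cvec x $ i = complex_of_real (x $ i)"
  by (simp add: cvec_def)

text \<open>For \<omega>_j = dz_j the second block column of M holds the lattice basis divided by 2
  \<pi> i. Thus x is a coordinate vector in that basis, with the \<delta>_i at \<open>Inl\<close>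
  and the \<gamma>_i at \<open>Inr\<close>.\<close>

definition lat_vec :: "('n::finite) cmat2 \<Rightarrow> real^('n + 'n) \<Rightarrow> complex^'n" where
  "lat_vec M x = (\<chi> j. (2 * of_real pi * \<i>) * (cvec x v* M) $ Inr j)"

lemma linear_cvec_mult: "linear (\<lambda>x. (cvec x v* M) $ k)"
proof (rule linearI)
  show "(cvec (x + y) v* M) $ k = (cvec x v* M) $ k + (cvec y v* M) $ k" for x y
    by (simp add: vector_matrix_mult_def algebra_simps sum.distrib)
  show "(cvec (c *\<^sub>R x) v* M) $ k = c *\<^sub>R (cvec x v* M) $ k" for c x
    unfolding scaleR_conv_of_real[where 'a = complex]
    by (simp add: vector_matrix_mult_def sum_distrib_left mult.left_commute mult.commute)
qed

lemma linear_lat_vec: "linear (lat_vec M)"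
proof (rule linearI)
  note l = linear_add[OF linear_cvec_mult] linear_cmul[OF linear_cvec_mult]
  show "lat_vec M (x + y) = lat_vec M x + lat_vec M y" for x y
    by (simp add: lat_vec_def l vec_eq_iff algebra_simps)
  show "lat_vec M (c *\<^sub>R x) = c *\<^sub>R lat_vec M x" for c x
    by (simp add: lat_vec_def l vec_eq_iff algebra_simps)
qed

lemma vec_axis_expansion: "x = (\<Sum>k\<in>UNIV. x $ k *\<^sub>R axis k (1::real))"
  by (simp add: vec_eq_iff axis_def if_distrib cong: if_cong)

lemma linear_axis_expansion:
  fixes f :: "real^('k::finite) \<Rightarrow> 'b::real_vector"
  assumes "linear f" shows "f x = (\<Sum>k\<in>UNIV. x $ k *\<^sub>R f (axis k 1))"
proof -
  have "f x = f (\<Sum>k\<in>UNIV. x $ k *\<^sub>R axis k 1)"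
    using vec_axis_expansion[of x] by simp
  then show ?thesis
    by (simp add: linear_sum[OF assms] linear_cmul[OF assms])
qed

lemma cvec_axis_mult: "(cvec (axis k 1) v* M) $ l = M $ k $ l"
proof -
  have "(cvec (axis k 1) v* M) $ l = (\<Sum>i\<in>UNIV. if i = k then M $ i $ l else 0)"
    unfolding vector_matrix_mult_def vec_lambda_beta by (intro sum.cong) (auto simp: axis_def)
  then show ?thesis by simp
qed

lemma lat_vec_axis: "lat_vec M (axis k 1) $ j = (2 * of_real pi * \<i>) * M $ k $ Inr j"
  by (simp add: lat_vec_def cvec_axis_mult)

lemma sp_inv_block:
  "sp_inv (block A B C D) = block (transpose D) (- transpose B) (- transpose C) (transpose A)"
  by (simp add: sp_inv_def sympJ_def transpose_block block_mult block_minus)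

text \<open>If z M = (u, 0), then z = (u, 0) M^-1, and the first block row of
  \<open>sp_inv M\<close> consists of D^T and -B^T.\<close>

lemma right_columns_kernel:
  assumes "M \<in> Sp_C" "\<And>j. (z v* M) $ Inr j = 0"
  obtains w where "z = vjoin (blkD M *v w) (- (blkB M *v w))"
proof -
  obtain A B C D where M: "M = block A B C D" by (rule block_cases)
  obtain u v where uv: "z v* M = vjoin u v" by (rule vjoin_cases)
  have "v = 0"
    using assms(2) by (simp add: uv vec_eq_iff)
  have "z = (z v* M) v* sp_inv M"
    using sp_inv_right[OF assms(1)] by (simp add: vector_matrix_mul_assoc)
  also have "\<dots> = vjoin (D *v u) (u v* (- transpose B))"
    unfolding uv \<open>v = 0\<close> by (simp add: M sp_inv_block vjoin_mult_block)
  also have "u v* (- transpose B) = - (B *v u)"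
    by (simp add: vector_matrix_mult_def matrix_vector_mult_def transpose_def vec_eq_iff sum_negf mult.commute)
  finally show ?thesis using that[of u] by (simp add: M)
qed

text \<open>In real coordinates, multiplication by i on the torus sends x to y. The complex vector y
  - i x is then annihilated by the second block column, which ties the complex structure to the
  blocks B and D.\<close>

lemma riemann_relation:
  assumes "M \<in> bold_B" "lat_vec M y = \<i> *s lat_vec M x"
  obtains w where "cvec y - \<i> *s cvec x = vjoin (blkD M *v w) (- (blkB M *v w))"
proof (rule right_columns_kernel[of M "cvec y - \<i> *s cvec x"])
  show "M \<in> Sp_C" using assms(1) bold_B_subset by blast
  show "((cvec y - \<i> *s cvec x) v* M) $ Inr j = 0" for j
  proof -
    have "(cvec y v* M) $ Inr j = \<i> * (cvec x v* M) $ Inr j"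
    proof -
      let ?c = "2 * of_real pi * \<i> :: complex"
      have "?c * (cvec y v* M) $ Inr j = \<i> * (?c * (cvec x v* M) $ Inr j)"
        using arg_cong[OF assms(2), of "\<lambda>v. v $ j"]
        by (simp only: lat_vec_def vec_lambda_beta vector_smult_component)
      then have "?c * (cvec y v* M) $ Inr j = ?c * (\<i> * (cvec x v* M) $ Inr j)"
        by (simp only: mult.left_commute)
      moreover have "?c \<noteq> 0" by simp
      ultimately show ?thesis by (metis mult_left_cancel)
    qed
    moreover have "((cvec y - \<i> *s cvec x) v* M) $ Inr j
        = (cvec y v* M) $ Inr j - \<i> * (cvec x v* M) $ Inr j"
      by (simp add: vector_matrix_mult_def sum_distrib_left algebra_simps sum_subtractf)
    ultimately show ?thesis by simp
  qed
qed

text \<open>A real vector in the kernel gives a w with Dw and Bw both real, so the form, being an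
  imaginary part, vanishes at w; positivity forces w = 0.\<close>

lemma inj_lat_vec:
  assumes "M \<in> bold_B" shows "inj (lat_vec M)"
  unfolding linear_injective_0[OF linear_lat_vec]
proof (intro allI impI)
  fix x assume x: "lat_vec M x = 0"
  have M: "M \<in> Sp_C" using assms bold_B_subset by blast
  have "(cvec x v* M) $ Inr j = 0" for j
    using x by (simp add: lat_vec_def vec_eq_iff)
  from right_columns_kernel[OF M this]
  obtain w where w: "cvec x = vjoin (blkD M *v w) (- (blkB M *v w))" by blast
  have "(blkD M *v w) $ i = of_real (x $ Inl i)" "(blkB M *v w) $ i = of_real (- x $ Inr i)" for i
    using arg_cong[OF w, of "\<lambda>v. v $ Inl i"] arg_cong[OF w, of "\<lambda>v. v $ Inr i"] by auto
  then have "siegel_form M w = 0"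
    by (simp add: siegel_form_def cdot_def vcnj_def)
  then have "w = 0" using assms by (force simp: bold_B_iff)
  then have "cvec x = 0" using w by (simp add: vjoin_zero)
  then show "x = 0" by (simp add: vec_eq_iff)
qed

lemma bij_lat_vec:
  fixes M :: "('n::finite) cmat2"
  assumes "M \<in> bold_B" shows "bij (lat_vec M)"
proof -
  have "dim (range (lat_vec M)) = dim (UNIV :: (real^('n + 'n)) set)"
    using inj_lat_vec[OF assms] by (intro dim_image_eq linear_lat_vec) (auto intro: inj_on_subset)
  also have "\<dots> = DIM(complex^'n)"
    by (simp add: card_Plus flip: UNIV_Plus_UNIV)
  finally have "span (range (lat_vec M)) = UNIV"
    by (simp only: dim_eq_full)
  then have "surj (lat_vec M)"
    by (metis linear_lat_vec linear_subspace_image span_eq_iff subspace_UNIV)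
  with inj_lat_vec[OF assms] show ?thesis by (simp add: bij_def)
qed

definition lat_coord :: "('n::finite) cmat2 \<Rightarrow> complex^'n \<Rightarrow> real^('n + 'n)" where
  "lat_coord M = inv (lat_vec M)"

lemma lat_coord_lat_vec: "M \<in> bold_B \<Longrightarrow> lat_coord M (lat_vec M x) = x"
  by (simp add: lat_coord_def inj_lat_vec)

lemma lat_vec_lat_coord: "M \<in> bold_B \<Longrightarrow> lat_vec M (lat_coord M v) = v"
  unfolding lat_coord_def by (rule surj_f_inv_f[OF bij_is_surj[OF bij_lat_vec]])

lemma linear_lat_coord: assumes "M \<in> bold_B" shows "linear (lat_coord M)"
proof (rule linearI)
  note i = lat_coord_lat_vec[OF assms] lat_vec_lat_coord[OF assms]
  show "lat_coord M (v + w) = lat_coord M v + lat_coord M w" for v w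
    by (metis i linear_add linear_lat_vec)
  show "lat_coord M (c *\<^sub>R v) = c *\<^sub>R lat_coord M v" for c v
    by (metis i linear_cmul linear_lat_vec)
qed

section \<open>The standard lattice with its alternating form\<close>

definition int_vecs :: "(real^('k::finite)) set" where
  "int_vecs = {x. \<forall>k. x $ k \<in> \<int>}"

text \<open>This is -x^T J y: with \<gamma> at \<open>Inr\<close> and \<delta> at
  \<open>Inl\<close>, the sign makes E(\<gamma>_i, \<delta>_i) = 1.\<close>

definition std_form :: "real^(('n::finite) + 'n) \<Rightarrow> real^('n + 'n) \<Rightarrow> real" where
  "std_form x y = (\<Sum>i\<in>UNIV. x $ Inr i * y $ Inl i - x $ Inl i * y $ Inr i)"

lemma of_real_std_form: "complex_of_real (std_form x y) = - cdot (cvec x) (sympJ *v cvec y)"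
proof -
  obtain p q p' q' where "cvec x = vjoin p q" "cvec y = vjoin p' q'" by (metis vjoin_cases)
  moreover from this have "of_real (x $ Inl i) = p $ i" "of_real (x $ Inr i) = q $ i"
    "of_real (y $ Inl i) = p' $ i" "of_real (y $ Inr i) = q' $ i" for i
    by (metis cvec_component vjoin_component)+
  ultimately show ?thesis
    by (simp add: std_form_def cdot_sympJ sum_subtractf) (simp add: cdot_def)
qed

definition lattice_of :: "('n::finite) cmat2 \<Rightarrow> (complex^'n) set" where
  "lattice_of M = lat_vec M ` int_vecs"

definition polarization_of :: "('n::finite) cmat2 \<Rightarrow> complex^'n \<Rightarrow> complex^'n \<Rightarrow> real" where
  "polarization_of M v w = std_form (lat_coord M v) (lat_coord M w)"

text \<open>The real-linear form whose periods along the lattice basis are the j-th column of the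
  first block column.\<close>

definition eta_of :: "('n::finite) cmat2 \<Rightarrow> 'n \<Rightarrow> complex^'n \<Rightarrow> complex" where
  "eta_of M j v = (cvec (lat_coord M v) v* M) $ Inl j"

lemma is_lattice_lattice_of:
  assumes "M \<in> bold_B" shows "is_lattice (lattice_of M)"
proof -
  let ?b = "\<lambda>k. lat_vec M (axis k 1)"
  have inj: "inj ?b"
    by (intro injI) (auto dest!: injD[OF inj_lat_vec[OF assms]] simp: axis_eq_axis)
  have S: "range ?b = lat_vec M ` Basis"
    by (auto simp: Basis_vec_def)
  have 1: "independent (range ?b)"
    unfolding S using inj_lat_vec[OF assms]
    by (intro linear_independent_injective_image[OF linear_lat_vec] independent_Basis)
      (auto intro: inj_on_subset)
  have 2: "span (range ?b) = UNIV"
    unfolding S linear_span_image[OF linear_lat_vec] span_Basis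
    using bij_lat_vec[OF assms] by (simp add: bij_is_surj)
  have sum: "(\<Sum>v\<in>range ?b. of_int (c v) *\<^sub>R v) = lat_vec M (\<chi> k. of_int (c (?b k)))" for c
    using inj by (simp add: sum.reindex linear_axis_expansion[OF linear_lat_vec, of M "vec_lambda _"])
  have "lattice_of M = {\<Sum>v\<in>range ?b. of_int (c v) *\<^sub>R v | c :: complex^'a \<Rightarrow> int. True}"
  proof
    show "{\<Sum>v\<in>range ?b. of_int (c v) *\<^sub>R v | c :: complex^'a \<Rightarrow> int. True} \<subseteq> lattice_of M"
      unfolding sum by (auto simp: lattice_of_def int_vecs_def)
    show "lattice_of M \<subseteq> {\<Sum>v\<in>range ?b. of_int (c v) *\<^sub>R v | c :: complex^'a \<Rightarrow> int. True}"
    proof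
      fix v assume "v \<in> lattice_of M"
      then obtain x where x: "x \<in> int_vecs" "v = lat_vec M x" by (auto simp: lattice_of_def)
      \<comment> \<open>\<open>is_lattice\<close> indexes coefficients by basis vectors, so the
        coordinate index is recovered through \<open>inv ?b\<close>; the floor turns an integral
        real into an \<open>int\<close>.\<close>
      have "v = lat_vec M (\<chi> k. of_int (\<lfloor>x $ inv ?b (?b k)\<rfloor>))"
        using x by (simp add: inv_f_f[OF inj] int_vecs_def)
      then show "v \<in> {\<Sum>v\<in>range ?b. of_int (c v) *\<^sub>R v | c :: complex^'a \<Rightarrow> int. True}"
        unfolding sum by (auto intro!: exI[of _ "\<lambda>v. \<lfloor>x $ inv ?b v\<rfloor>"])
    qed
  qed
  with 1 2 show ?thesis unfolding is_lattice_def by blast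
qed

lemma int_vecs_scale: "x \<in> int_vecs \<Longrightarrow> of_int n *\<^sub>R x \<in> int_vecs"
  by (simp add: int_vecs_def)

lemma int_vecs_sum: "(\<And>k. k \<in> A \<Longrightarrow> x k \<in> int_vecs) \<Longrightarrow> sum x A \<in> int_vecs"
  by (simp add: int_vecs_def Ints_sum)

lemma axis_in_int_vecs: "axis k 1 \<in> int_vecs"
  by (simp add: int_vecs_def axis_def)

text \<open>Serves the unimodularity clause of \<open>pp_torus\<close>, where f is additive on the
  lattice only: additivity extends to integer multiples and finite sums, so the values at unit
  vectors determine everything.\<close>

lemma int_vecs_additive:
  fixes g :: "real^('k::finite) \<Rightarrow> int"
  assumes add: "\<And>x y. x \<in> int_vecs \<Longrightarrow> y \<in> int_vecs \<Longrightarrow> g (x + y) = g x + g y"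
    and x: "x \<in> int_vecs"
  shows "of_int (g x) = (\<Sum>k\<in>UNIV. x $ k * of_int (g (axis k 1)))"
proof -
  have zero: "g 0 = 0"
    using add[of 0 0] by (simp add: int_vecs_def)
  have nat: "g (of_nat n *\<^sub>R y) = of_nat n * g y" if "y \<in> int_vecs" for n y
  proof (induction n)
    case (Suc n)
    have "g (of_nat n *\<^sub>R y + y) = g (of_nat n *\<^sub>R y) + g y"
      using int_vecs_scale[OF that, of "int n"] that by (intro add) auto
    then show ?case using Suc by (simp add: algebra_simps)
  qed (simp add: zero)
  have neg: "g (- y) = - g y" if "y \<in> int_vecs" for y
    using add[OF that, of "- y"] that zero by (simp add: int_vecs_def)
  have scale: "g (of_int n *\<^sub>R y) = n * g y" if "y \<in> int_vecs" for n y
  proof (cases n)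
    case (nonneg m) then show ?thesis using nat[OF that] by simp
  next
    case (neg m)
    have "of_int n *\<^sub>R y = - (of_nat (Suc m) *\<^sub>R y)" by (simp add: neg algebra_simps)
    then show ?thesis
      using nat[OF that, of "Suc m"] \<open>\<And>y. y \<in> int_vecs \<Longrightarrow> g (- y) = - g y\<close>
        int_vecs_scale[OF that, of "int (Suc m)"] neg by (simp only: of_int_of_nat_eq)
  qed
  have sum: "g (sum y A) = (\<Sum>k\<in>A. g (y k))" if "finite A" "\<And>k. y k \<in> int_vecs" for y and A :: "'k set"
    using that(1)
  proof (induction A rule: finite_induct)
    case (insert a A) then show ?case using that(2) by (simp add: add int_vecs_sum)
  qed (simp add: zero)
  have "g x = g (\<Sum>k\<in>UNIV. of_int \<lfloor>x $ k\<rfloor> *\<^sub>R axis k 1)"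
    using x vec_axis_expansion[of x] by (simp add: int_vecs_def)
  also have "\<dots> = (\<Sum>k\<in>UNIV. \<lfloor>x $ k\<rfloor> * g (axis k 1))"
    by (subst sum) (auto simp: scale axis_in_int_vecs int_vecs_scale)
  finally show ?thesis using x by (simp add: int_vecs_def)
qed

lemma bilinear_std_form: "bilinear std_form"
  unfolding bilinear_def
  by (auto intro!: linearI simp: std_form_def algebra_simps sum_subtractf sum.distrib sum_distrib_left)

lemma pp_torus_lattice_of:
  fixes M :: "('n::finite) cmat2"
  assumes M: "M \<in> bold_B" shows "pp_torus (lattice_of M) (polarization_of M)"
  unfolding pp_torus_def
proof (intro conjI allI ballI impI)
  note co = lat_coord_lat_vec[OF M] lat_vec_lat_coord[OF M]
  show "is_lattice (lattice_of M)" by (rule is_lattice_lattice_of[OF M])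
  show "bilinear (polarization_of M)"
    using bilinear_std_form linear_lat_coord[OF M]
    by (auto simp: bilinear_def polarization_of_def[abs_def] intro: linear_compose[unfolded comp_def])
  show "polarization_of M v v = 0" for v
    by (simp add: polarization_of_def std_form_def mult.commute)
  show "polarization_of M k l \<in> \<int>" if "k \<in> lattice_of M" "l \<in> lattice_of M" for k l
    using that by (auto simp: lattice_of_def polarization_of_def co std_form_def int_vecs_def
        intro!: Ints_sum Ints_diff Ints_mult)
  \<comment> \<open>For each v the vector w encodes the coordinates x of v and y of i v: Dw is y - i
    x on the \<open>Inl\<close> half, and Bw is i x - y on the \<open>Inr\<close> half.\<close>
  have rel: "\<exists>w. (\<forall>i. (blkD M *v w) $ i = of_real (lat_coord M (\<i> *s v) $ Inl i) - \<i> * of_real (lat_coord M v $ Inl i)) \<and>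
      (\<forall>i. (blkB M *v w) $ i = \<i> * of_real (lat_coord M v $ Inr i) - of_real (lat_coord M (\<i> *s v) $ Inr i))" for v
  proof -
    obtain w where w: "cvec (lat_coord M (\<i> *s v)) - \<i> *s cvec (lat_coord M v)
        = vjoin (blkD M *v w) (- (blkB M *v w))"
      by (rule riemann_relation[OF M, of "lat_coord M (\<i> *s v)" "lat_coord M v"]) (simp_all add: co)
    have "(blkD M *v w) $ i = of_real (lat_coord M (\<i> *s v) $ Inl i) - \<i> * of_real (lat_coord M v $ Inl i)"
      and "(blkB M *v w) $ i = \<i> * of_real (lat_coord M v $ Inr i) - of_real (lat_coord M (\<i> *s v) $ Inr i)" for i
      using arg_cong[OF w, of "\<lambda>z. z $ Inl i"] arg_cong[OF w, of "\<lambda>z. z $ Inr i"]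
      by (auto simp: algebra_simps)
    then show ?thesis by blast
  qed
  show "polarization_of M (\<i> *s v) (\<i> *s v') = polarization_of M v v'" for v v'
  proof -
    from rel[of v] rel[of v'] obtain w w' where
      w: "\<And>i. (blkD M *v w) $ i = of_real (lat_coord M (\<i> *s v) $ Inl i) - \<i> * of_real (lat_coord M v $ Inl i)"
         "\<And>i. (blkB M *v w) $ i = \<i> * of_real (lat_coord M v $ Inr i) - of_real (lat_coord M (\<i> *s v) $ Inr i)" and
      w': "\<And>i. (blkD M *v w') $ i = of_real (lat_coord M (\<i> *s v') $ Inl i) - \<i> * of_real (lat_coord M v' $ Inl i)"
         "\<And>i. (blkB M *v w') $ i = \<i> * of_real (lat_coord M v' $ Inr i) - of_real (lat_coord M (\<i> *s v') $ Inr i)"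
      by blast
    obtain A B C D where blk: "M = block A B C D" by (rule block_cases)
    \<comment> \<open>The symmetric Riemann relation. Its real part is exactly the invariance of E
      under multiplication by i.\<close>
    have "cdot (D *v w) (B *v w') = cdot (D *v w') (B *v w)"
    proof -
      have "cdot (D *v w) (B *v w') = cdot w ((transpose D ** B) *v w')"
        unfolding cdot_matrix_left by (simp only: matrix_vector_mul_assoc)
      also have "\<dots> = cdot w ((transpose B ** D) *v w')"
        using M bold_B_subset by (subst Sp_C_blocks[of A B C D]) (auto simp: blk)
      also have "\<dots> = cdot (B *v w) (D *v w')"
        unfolding cdot_matrix_left by (simp only: matrix_vector_mul_assoc)
      finally show ?thesis by (simp add: cdot_commute)
    qed
    then have "Re (cdot (blkD M *v w) (blkB M *v w')) = Re (cdot (blkD M *v w') (blkB M *v w))"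
      by (simp add: blk)
    then have "(\<Sum>i\<in>UNIV. lat_coord M v $ Inl i * lat_coord M v' $ Inr i
          - lat_coord M (\<i> *s v) $ Inl i * lat_coord M (\<i> *s v') $ Inr i) =
        (\<Sum>i\<in>UNIV. lat_coord M v' $ Inl i * lat_coord M v $ Inr i
          - lat_coord M (\<i> *s v') $ Inl i * lat_coord M (\<i> *s v) $ Inr i)"
      by (simp add: cdot_def w w' algebra_simps)
    then show ?thesis
      by (simp add: polarization_of_def std_form_def sum_subtractf mult.commute)
  qed
  show "polarization_of M v (\<i> *s v) > 0" if "v \<noteq> 0" for v
  proof -
    obtain w where
      w: "\<And>i. (blkD M *v w) $ i = of_real (lat_coord M (\<i> *s v) $ Inl i) - \<i> * of_real (lat_coord M v $ Inl i)"
         "\<And>i. (blkB M *v w) $ i = \<i> * of_real (lat_coord M v $ Inr i) - of_real (lat_coord M (\<i> *s v) $ Inr i)"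
      using rel[of v] by blast
    \<comment> \<open>Expanding the imaginary part of conj(Dw) Bw in the coordinates of v and i v
      gives E(v, i v) with the right sign.\<close>
    have "siegel_form M w = polarization_of M v (\<i> *s v)"
      by (simp add: siegel_form_def cdot_def vcnj_def w polarization_of_def std_form_def algebra_simps)
    moreover have "w \<noteq> 0"
    proof
      assume "w = 0"
      then have "lat_coord M v $ Inl i = 0" "lat_coord M v $ Inr i = 0" for i
        using w(1)[of i] w(2)[of i] by (simp_all add: complex_eq_iff)
      then have "lat_coord M v = 0"
        unfolding vec_eq_iff by (metis sum.exhaust zero_index)
      then show False using that co(2)[of v] by (simp add: linear_0[OF linear_lat_vec])
    qed
    ultimately show ?thesis using M by (metis bold_B_iff)
  qed
  fix f :: "complex^'n \<Rightarrow> int" assume f: "\<forall>k\<in>lattice_of M. \<forall>l\<in>lattice_of M. f (k + l) = f k + f l"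
  let ?g = "\<lambda>k. of_int (f (lat_vec M (axis k 1))) :: real"
  \<comment> \<open>The Gram matrix of \<open>std_form\<close> is -J; solving for the vector dual to
    f swaps the two halves and changes one sign, so the solution stays integral.\<close>
  let ?y = "\<chi> k. case k of Inl i \<Rightarrow> - ?g (Inr i) | Inr i \<Rightarrow> ?g (Inl i)"
  have "of_int (f (lat_vec M x)) = polarization_of M (lat_vec M ?y) (lat_vec M x)" if "x \<in> int_vecs" for x
  proof -
    have "of_int (f (lat_vec M x)) = (\<Sum>k\<in>UNIV. x $ k * ?g k)"
      by (rule int_vecs_additive[of "\<lambda>x. f (lat_vec M x)", OF _ that])
        (simp add: linear_add[OF linear_lat_vec] f lattice_of_def)
    then show ?thesis
      by (simp add: polarization_of_def co std_form_def sum_UNIV_Plus sum.distrib mult.commute)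
  qed
  moreover have "?y \<in> int_vecs" by (simp add: int_vecs_def split: sum.split)
  ultimately show "\<exists>\<gamma>\<in>lattice_of M. \<forall>k\<in>lattice_of M. of_int (f k) = polarization_of M \<gamma> k"
    unfolding lattice_of_def by (intro bexI[of _ "lat_vec M ?y"]) auto
qed

lemma polarization_of_lat_vec:
  "M \<in> bold_B \<Longrightarrow> polarization_of M (lat_vec M x) (lat_vec M y) = std_form x y"
  by (simp add: polarization_of_def lat_coord_lat_vec)

lemma cdot_sympJ_sum:
  "cdot x (sympJ *v y) = (\<Sum>i\<in>UNIV. x $ Inl i * y $ Inr i - x $ Inr i * y $ Inl i)"
proof -
  obtain p q p' q' where "x = vjoin p q" "y = vjoin p' q'" by (metis vjoin_cases)
  then show ?thesis by (simp add: cdot_sympJ sum_subtractf) (simp add: cdot_def)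
qed

lemma conj_matrix_component: "(M ** N ** transpose M) $ a $ b = cdot (M $ a) (N *v (M $ b))"
  unfolding matrix_mul_assoc[symmetric]
  by (simp add: matrix_matrix_mult_def cdot_def matrix_vector_mult_def transpose_def)

lemma Sp_C_iff_rows: "M \<in> Sp_C \<longleftrightarrow> (\<forall>a b. cdot (M $ a) (sympJ *v (M $ b)) = sympJ $ a $ b)"
  unfolding Sp_C_def mem_Collect_eq vec_eq_iff conj_matrix_component ..

text \<open>The periods of a single form make up a column, so pairings of de Rham classes need
  column relations, whereas \<open>Sp_C\<close> is defined by row relations.\<close>

lemma Sp_C_columns:
  assumes "M \<in> Sp_C"
  shows "(\<Sum>k\<in>UNIV. M $ Inl k $ p * M $ Inr k $ q - M $ Inr k $ p * M $ Inl k $ q) = sympJ $ p $ q"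
proof -
  have "transpose M \<in> Sp_C"
    using Sp_C_transpose[OF assms] by (simp add: Sp_C_def)
  then have "cdot (transpose M $ p) (sympJ *v (transpose M $ q)) = sympJ $ p $ q"
    by (simp only: Sp_C_iff_rows)
  then show ?thesis by (simp add: cdot_sympJ_sum transpose_def)
qed

lemma sympJ_component [simp]:
  "sympJ $ Inl i $ Inl j = 0" "sympJ $ Inr i $ Inr j = 0"
  "sympJ $ Inl i $ Inr j = (if i = j then 1 else 0)"
  "sympJ $ Inr i $ Inl j = (if i = j then - 1 else 0)"
  by (simp_all add: sympJ_def block_def mat_def)

lemma linear_eta_of: assumes "M \<in> bold_B" shows "linear (eta_of M j)"
  unfolding eta_of_def[abs_def]
  using linear_compose[OF linear_lat_coord[OF assms] linear_cvec_mult] by (simp add: comp_def)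

lemma sh_basis_eta_of:
  fixes M :: "('n::finite) cmat2"
  assumes M: "M \<in> bold_B"
  shows "sh_basis (lattice_of M) (polarization_of M) (\<lambda>j z. z $ j) (eta_of M)"
  unfolding sh_basis_def
proof (intro conjI allI)
  let ?b = "\<lambda>k. lat_vec M (axis k 1)" and ?c = "2 * of_real pi * \<i> :: complex"
  define c where "c = 1 / ?c"
  \<comment> \<open>The classical formula: 1/(2 \<pi> i) times the sum of \<alpha>(\<gamma>_i)
    \<beta>(\<delta>_i) - \<alpha>(\<delta>_i) \<beta>(\<gamma>_i), as \<open>Inr\<close> indexes
    the \<gamma>_i. On the chosen basis its values are column relations of M.\<close>
  define Q where "Q = (\<lambda>\<alpha> \<beta> :: complex^'n \<Rightarrow> complex.
    c * (\<Sum>i\<in>UNIV. \<alpha> (?b (Inr i)) * \<beta> (?b (Inl i)) - \<alpha> (?b (Inl i)) * \<beta> (?b (Inr i))))"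
  have lin: "linear (\<lambda>z :: complex^'n. z $ j)" for j
    by (rule linearI) auto
  show "(\<lambda>z. z $ j) \<in> holomorphic_forms" for j :: 'n
    using lin by (simp add: holomorphic_forms_def H1_dR_def)
  show "eta_of M j \<in> H1_dR" for j
    using linear_eta_of[OF M] by (simp add: H1_dR_def)
  have Q: "is_dR_form (lattice_of M) (polarization_of M) Q"
    unfolding is_dR_form_def
  proof (intro conjI ballI allI)
    fix \<alpha> \<alpha>' \<beta> :: "complex^'n \<Rightarrow> complex" and d
    show "Q (\<lambda>v. \<alpha> v + d * \<alpha>' v) \<beta> = Q \<alpha> \<beta> + d * Q \<alpha>' \<beta>"
      unfolding Q_def sum_distrib_left sum.distrib[symmetric]
      by (intro sum.cong) (auto simp: algebra_simps)
    show "Q \<beta> (\<lambda>v. \<alpha> v + d * \<alpha>' v) = Q \<beta> \<alpha> + d * Q \<beta> \<alpha>'"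
      unfolding Q_def sum_distrib_left sum.distrib[symmetric]
      by (intro sum.cong) (auto simp: algebra_simps)
  next
    fix \<gamma> \<gamma>' assume "\<gamma> \<in> lattice_of M" "\<gamma>' \<in> lattice_of M"
    then obtain x y where xy: "\<gamma> = lat_vec M x" "\<gamma>' = lat_vec M y" by (auto simp: lattice_of_def)
    have "std_form x (axis (Inl i) 1) = (\<Sum>k\<in>UNIV. if k = i then x $ Inr k else 0)"
      "std_form x (axis (Inr i) 1) = (\<Sum>k\<in>UNIV. if k = i then - x $ Inl k else 0)" for x i
      unfolding std_form_def by (intro sum.cong; auto simp: axis_def)+
    then have E: "polarization_of M (lat_vec M x) (?b (Inl i)) = x $ Inr i"
      "polarization_of M (lat_vec M x) (?b (Inr i)) = - x $ Inl i" for x i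
      by (simp_all add: polarization_of_lat_vec[OF M])
    show "Q (\<lambda>v. of_real (polarization_of M \<gamma> v)) (\<lambda>v. of_real (polarization_of M \<gamma>' v))
        = 1 / (2 * of_real pi * \<i>) * of_real (polarization_of M \<gamma> \<gamma>')"
      unfolding Q_def xy E polarization_of_lat_vec[OF M, of x y]
      by (simp add: c_def std_form_def algebra_simps)
  qed
  have eta: "eta_of M j (?b k) = M $ k $ Inl j" for j k
    by (simp add: eta_of_def lat_coord_lat_vec[OF M] cvec_axis_mult)
  have "M \<in> Sp_C" using M bold_B_subset by blast
  note col = Sp_C_columns[OF this]
  have 1: "Q (\<lambda>z. z $ i) (eta_of M j) = (if i = j then 1 else 0)" for i j
  proof -
    have "Q (\<lambda>z. z $ i) (eta_of M j) = - (\<Sum>k\<in>UNIV. M $ Inl k $ Inr i * M $ Inr k $ Inl j - M $ Inr k $ Inr i * M $ Inl k $ Inl j)"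
      unfolding Q_def c_def eta lat_vec_axis sum_negf[symmetric] sum_distrib_left
      by (intro sum.cong) (auto simp: field_simps)
    then show ?thesis by (simp add: col)
  qed
  have 2: "Q (\<lambda>z. z $ i) (\<lambda>z. z $ j) = 0" for i j
  proof -
    have "Q (\<lambda>z. z $ i) (\<lambda>z. z $ j) = - ?c * (\<Sum>k\<in>UNIV. M $ Inl k $ Inr i * M $ Inr k $ Inr j - M $ Inr k $ Inr i * M $ Inl k $ Inr j)"
      unfolding Q_def c_def lat_vec_axis sum_distrib_left
      by (intro sum.cong) (auto simp: field_simps)
    then show ?thesis by (simp add: col)
  qed
  have 3: "Q (eta_of M i) (eta_of M j) = 0" for i j
  proof -
    have "Q (eta_of M i) (eta_of M j) = - 1 / ?c * (\<Sum>k\<in>UNIV. M $ Inl k $ Inl i * M $ Inr k $ Inl j - M $ Inr k $ Inl i * M $ Inl k $ Inl j)"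
      unfolding Q_def c_def eta sum_distrib_left
      by (intro sum.cong) (auto simp: field_simps)
    then show ?thesis by (simp add: col)
  qed
  from Q 1 2 3 show "\<exists>Q. is_dR_form (lattice_of M) (polarization_of M) Q \<and>
      (\<forall>i j. Q (\<lambda>z. z $ i) (eta_of M j) = (if i = j then 1 else 0) \<and>
        Q (\<lambda>z. z $ i) (\<lambda>z. z $ j) = 0 \<and> Q (eta_of M i) (eta_of M j) = 0)"
    by blast
qed

section \<open>Change of symplectic basis and the universal triple\<close>

lemma mat_mult_component: "(mat c ** X) $ i $ j = c * X $ i $ j" for X :: "complex^'n^'m"
proof -
  have "(mat c ** X) $ i $ j = (\<Sum>k\<in>UNIV. if i = k then c * X $ k $ j else 0)"
    unfolding matrix_matrix_mult_def vec_lambda_beta by (intro sum.cong) (auto simp: mat_def)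
  then show ?thesis by simp
qed

lemma matrix_mult_row: "(X ** M) $ a = X $ a v* M" for X :: "complex^'n^'m"
  by (simp add: matrix_matrix_mult_def vector_matrix_mult_def mult.commute)

text \<open>Periods are real-linear in the homology vector, so passing from the unit coordinates to
  the vectors y multiplies M on the left. The factor 1/(2 \<pi> i) undoes the one in
  \<open>lat_vec\<close>.\<close>

lemma period_matrix_of:
  fixes M :: "('n::finite) cmat2"
  assumes "M \<in> bold_B"
  shows "block (period_mat (eta_of M) (\<lambda>i. lat_vec M (y (Inl i))))
      (mat (1 / (2 * of_real pi * \<i>)) ** period_mat (\<lambda>j z. z $ j) (\<lambda>i. lat_vec M (y (Inl i))))
      (period_mat (eta_of M) (\<lambda>i. lat_vec M (y (Inr i))))
      (mat (1 / (2 * of_real pi * \<i>)) ** period_mat (\<lambda>j z. z $ j) (\<lambda>i. lat_vec M (y (Inr i))))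
    = (\<chi> a. cvec (y a)) ** M" (is "?P = ?R")
proof -
  have "eta_of M j (lat_vec M x) = (cvec x v* M) $ Inl j"
    "1 / (2 * of_real pi * \<i>) * lat_vec M x $ j = (cvec x v* M) $ Inr j" for j x
    by (simp add: eta_of_def lat_coord_lat_vec[OF assms]) (simp add: lat_vec_def)
  then have "?P $ a $ b = (cvec (y a) v* M) $ b" for a b
    by (simp add: block_def mat_mult_component period_mat_def split: sum.split)
  then show ?thesis by (simp add: vec_eq_iff matrix_mult_row)
qed

lemma cvec_rows_Sp_Z_iff:
  "(\<chi> a. cvec (y a)) \<in> Sp_Z \<longleftrightarrow>
   (\<forall>a. y a \<in> int_vecs) \<and>
   (\<forall>i j. std_form (y (Inr i)) (y (Inl j)) = (if i = j then 1 else 0) \<and>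
      std_form (y (Inr i)) (y (Inr j)) = 0 \<and> std_form (y (Inl i)) (y (Inl j)) = 0)"
proof -
  have int: "complex_of_real r \<in> \<int> \<longleftrightarrow> r \<in> \<int>" for r
    by (metis Ints_cases Ints_of_int of_real_eq_iff of_real_of_int_eq)
  have J: "cdot (cvec (y a)) (sympJ *v cvec (y b)) = sympJ $ a $ b \<longleftrightarrow>
      complex_of_real (std_form (y a) (y b)) = - sympJ $ a $ b" for a b
    unfolding of_real_std_form by auto
  have asym: "std_form x z = - std_form z x" for x z :: "real^('a + 'a)"
    by (simp add: std_form_def sum_negf[symmetric] mult.commute)
  have all: "(\<forall>a b. P a b) \<longleftrightarrow> (\<forall>i j. P (Inr i) (Inl j) \<and> P (Inl i) (Inr j) \<and> P (Inr i) (Inr j) \<and> P (Inl i) (Inl j))"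
    for P :: "'a + 'a \<Rightarrow> 'a + 'a \<Rightarrow> bool"
    unfolding split_sum_all by blast
  have of_real_if: "complex_of_real r = (if P then 1 else 0) \<longleftrightarrow> r = (if P then 1 else 0)"
     "complex_of_real r = (if P then - 1 else 0) \<longleftrightarrow> r = (if P then - 1 else 0)"  for r P
    by (auto simp: complex_eq_iff)
  have "(\<chi> a. cvec (y a)) \<in> Sp_C \<longleftrightarrow> (\<forall>a b. complex_of_real (std_form (y a) (y b)) = - sympJ $ a $ b)"
    by (simp add: Sp_C_iff_rows J)
  also have "\<dots> \<longleftrightarrow> (\<forall>i j. std_form (y (Inr i)) (y (Inl j)) = (if i = j then 1 else 0) \<and>
      std_form (y (Inl i)) (y (Inr j)) = (if i = j then - 1 else 0) \<and>
      std_form (y (Inr i)) (y (Inr j)) = 0 \<and> std_form (y (Inl i)) (y (Inl j)) = 0)"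
    unfolding all by (simp add: of_real_if if_distrib[of uminus] cong: if_cong)
  also have "\<dots> \<longleftrightarrow> (\<forall>i j. std_form (y (Inr i)) (y (Inl j)) = (if i = j then 1 else 0) \<and>
      std_form (y (Inr i)) (y (Inr j)) = 0 \<and> std_form (y (Inl i)) (y (Inl j)) = 0)"
    using asym[of "y (Inl _)" "y (Inr _)"] by auto
  finally show ?thesis by (auto simp: Sp_Z_def int int_vecs_def)
qed

lemma cvec_rows_eq:
  assumes "\<Gamma> \<in> Sp_Z" obtains y where "\<Gamma> = (\<chi> a. cvec (y a))"
proof
  have "\<Gamma> $ a $ k = complex_of_real (Re (\<Gamma> $ a $ k))" for a k
    using assms by (auto simp: Sp_Z_def elim!: Ints_cases) (metis Ints_cases Re_complex_of_real of_real_of_int_eq)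
  then show "\<Gamma> = (\<chi> a. cvec (\<chi> k. Re (\<Gamma> $ a $ k)))" by (simp add: vec_eq_iff)
qed

text \<open>The inverse of an integral symplectic matrix is integral, so the coefficients of x in
  the rows are the entries of x times that inverse.\<close>

lemma int_vecs_combination:
  assumes \<Gamma>: "(\<chi> a. cvec (y a)) \<in> Sp_Z" and x: "x \<in> int_vecs"
  obtains h :: "('n::finite) + 'n \<Rightarrow> int" where "x = (\<Sum>a\<in>UNIV. of_int (h a) *\<^sub>R y a)"
proof -
  define G where "G = (\<chi> a. cvec (y a))"
  have G: "G \<in> Sp_Z" "sp_inv G \<in> Sp_Z" "G \<in> Sp_C"
    using \<Gamma> sp_inv_Sp_Z Sp_Z_subset by (auto simp: G_def)
  define z where "z = cvec x v* sp_inv G"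
  have "complex_of_real r \<in> \<int>" if "r \<in> \<int>" for r
    using that by (auto elim!: Ints_cases)
  then have "z $ a \<in> \<int>" for a
    using G(2) x by (auto simp: z_def vector_matrix_mult_def Sp_Z_def int_vecs_def
        intro!: Ints_sum Ints_mult)
  then have "\<forall>a. \<exists>n. z $ a = of_int n" by (metis Ints_cases)
  then obtain h where h: "\<And>a. z $ a = of_int (h a)" by metis
  have "cvec x = z v* G"
    by (simp add: z_def vector_matrix_mul_assoc sp_inv_left[OF G(3)])
  then have "complex_of_real (x $ k) = (z v* G) $ k" for k
    by (metis cvec_component)
  then have "complex_of_real (x $ k) = complex_of_real (\<Sum>a\<in>UNIV. of_int (h a) * y a $ k)" for k
    by (simp add: vector_matrix_mult_def h G_def mult.commute)
  then have "x $ k = (\<Sum>a\<in>UNIV. of_int (h a) * y a $ k)" for k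
    by (simp only: of_real_eq_iff)
  then have "x = (\<Sum>a\<in>UNIV. of_int (h a) *\<^sub>R y a)" by (simp add: vec_eq_iff)
  then show ?thesis by (rule that)
qed

text \<open>Integral coordinates with the right pairings already generate the lattice, since their
  matrix is invertible over the integers. With \<open>period_matrix_of\<close>, this makes the set
  of all period matrices a full orbit of \<open>Sp_Z\<close>.\<close>

lemma symp_H1_basis_iff:
  fixes M :: "('n::finite) cmat2"
  assumes M: "M \<in> bold_B"
  shows "symp_H1_basis (lattice_of M) (polarization_of M)
      (\<lambda>i. lat_vec M (y (Inr i))) (\<lambda>i. lat_vec M (y (Inl i))) \<longleftrightarrow> (\<chi> a. cvec (y a)) \<in> Sp_Z"
proof -
  let ?S = "{(\<Sum>i\<in>UNIV. of_int (m i) *\<^sub>R lat_vec M (y (Inr i))) + (\<Sum>i\<in>UNIV. of_int (n i) *\<^sub>R lat_vec M (y (Inl i)))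
      | (m :: 'n \<Rightarrow> int) (n :: 'n \<Rightarrow> int). True}"
  have comb: "(\<Sum>i\<in>UNIV. of_int (h (Inr i)) *\<^sub>R lat_vec M (y (Inr i))) + (\<Sum>i\<in>UNIV. of_int (h (Inl i)) *\<^sub>R lat_vec M (y (Inl i)))
      = lat_vec M (\<Sum>a\<in>UNIV. of_int (h a) *\<^sub>R y a)" for h :: "'n + 'n \<Rightarrow> int"
    by (simp add: linear_sum[OF linear_lat_vec] linear_cmul[OF linear_lat_vec]
        linear_add[OF linear_lat_vec] sum_UNIV_Plus add.commute)
  have S: "?S = {lat_vec M (\<Sum>a\<in>UNIV. of_int (h a) *\<^sub>R y a) | h :: 'n + 'n \<Rightarrow> int. True}"
  proof (intro set_eqI iffI)
    fix v assume "v \<in> ?S"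
    then obtain m n :: "'n \<Rightarrow> int" where "v = (\<Sum>i\<in>UNIV. of_int (m i) *\<^sub>R lat_vec M (y (Inr i))) + (\<Sum>i\<in>UNIV. of_int (n i) *\<^sub>R lat_vec M (y (Inl i)))"
      by auto
    with comb[of "case_sum n m"] show "v \<in> {lat_vec M (\<Sum>a\<in>UNIV. of_int (h a) *\<^sub>R y a) | h :: 'n + 'n \<Rightarrow> int. True}"
      by auto
  next
    fix v assume "v \<in> {lat_vec M (\<Sum>a\<in>UNIV. of_int (h a) *\<^sub>R y a) | h :: 'n + 'n \<Rightarrow> int. True}"
    then obtain h :: "'n + 'n \<Rightarrow> int" where "v = lat_vec M (\<Sum>a\<in>UNIV. of_int (h a) *\<^sub>R y a)"
      by auto
    then show "v \<in> ?S"
      unfolding comb[symmetric] mem_Collect_eq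
      by (intro exI[of _ "\<lambda>i. h (Inr i)"] exI[of _ "\<lambda>i. h (Inl i)"]) simp
  qed
  have "lattice_of M = ?S" if "(\<chi> a. cvec (y a)) \<in> Sp_Z"
  proof
    show "lattice_of M \<subseteq> ?S"
      unfolding S lattice_of_def using int_vecs_combination[OF that] by blast
    show "?S \<subseteq> lattice_of M"
      unfolding S lattice_of_def using that
      by (auto simp: cvec_rows_Sp_Z_iff intro!: imageI int_vecs_sum int_vecs_scale)
  qed
  moreover have "\<forall>a. y a \<in> int_vecs" if "lattice_of M = ?S"
  proof
    fix a
    \<comment> \<open>The indicator of a as coefficient family shows that each single basis vector
      lies in the lattice, so its coordinates are integral.\<close>
    have "(\<Sum>k\<in>UNIV. of_int (if k = a then 1 else 0) *\<^sub>R y k) = (\<Sum>k\<in>UNIV. if k = a then y k else 0)"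
      by (intro sum.cong) auto
    then have "lat_vec M (y a) = lat_vec M (\<Sum>k\<in>UNIV. of_int (if k = a then 1 else 0) *\<^sub>R y k)"
      by simp
    then have "lat_vec M (y a) \<in> lattice_of M"
      unfolding that S mem_Collect_eq by (intro exI[of _ "\<lambda>k. if k = a then 1 else 0"]) simp
    then show "y a \<in> int_vecs"
      using inj_lat_vec[OF M] by (auto simp: lattice_of_def dest: injD)
  qed
  ultimately show ?thesis
    unfolding symp_H1_basis_def polarization_of_lat_vec[OF M]
    using cvec_rows_Sp_Z_iff[of y] by blast
qed

lemma period_class_lattice_of:
  fixes M :: "('n::finite) cmat2"
  assumes M: "M \<in> bold_B"
  shows "period_class (lattice_of M) (polarization_of M) (\<lambda>j z. z $ j) (eta_of M) = cls M"
proof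
  show "cls M \<subseteq> period_class (lattice_of M) (polarization_of M) (\<lambda>j z. z $ j) (eta_of M)"
  proof
    fix N assume "N \<in> cls M"
    then obtain \<Gamma> where \<Gamma>: "\<Gamma> \<in> Sp_Z" "N = \<Gamma> ** M" by (auto simp: cls_def)
    then obtain y where y: "\<Gamma> = (\<chi> a. cvec (y a))" by (metis cvec_rows_eq)
    show "N \<in> period_class (lattice_of M) (polarization_of M) (\<lambda>j z. z $ j) (eta_of M)"
      unfolding period_class_def mem_Collect_eq \<Gamma>(2) y period_matrix_of[OF M, symmetric]
      using symp_H1_basis_iff[OF M, of y] \<Gamma>(1) y by blast
  qed
  show "period_class (lattice_of M) (polarization_of M) (\<lambda>j z. z $ j) (eta_of M) \<subseteq> cls M"
  proof
    fix N assume "N \<in> period_class (lattice_of M) (polarization_of M) (\<lambda>j z. z $ j) (eta_of M)"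
    then obtain \<gamma> \<delta> where
      N: "N = block (period_mat (eta_of M) \<delta>) (mat (1 / (2 * of_real pi * \<i>)) ** period_mat (\<lambda>j z. z $ j) \<delta>)
            (period_mat (eta_of M) \<gamma>) (mat (1 / (2 * of_real pi * \<i>)) ** period_mat (\<lambda>j z. z $ j) \<gamma>)"
      and b: "symp_H1_basis (lattice_of M) (polarization_of M) \<gamma> \<delta>"
      by (auto simp: period_class_def)
    define y where "y = (\<lambda>a. lat_coord M (case a of Inl i \<Rightarrow> \<delta> i | Inr i \<Rightarrow> \<gamma> i))"
    have y: "\<gamma> = (\<lambda>i. lat_vec M (y (Inr i)))" "\<delta> = (\<lambda>i. lat_vec M (y (Inl i)))"
      by (simp_all add: y_def lat_vec_lat_coord[OF M])
    have "(\<chi> a. cvec (y a)) \<in> Sp_Z" using b symp_H1_basis_iff[OF M, of y] y by simp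
    moreover have "N = (\<chi> a. cvec (y a)) ** M"
      using period_matrix_of[OF M, of y] N y by simp
    ultimately show "N \<in> cls M" by (auto simp: cls_def)
  qed
qed

text \<open>\<open>SOME\<close> is only known to return some triple with class \<open>cls M\<close>.
  But M lies in that class, so it is the period matrix of the triple for some symplectic basis. As
  \<omega>_j = dz_j, the second block column gives the basis vectors and hence L; the first one
  gives the \<eta>_j on this basis, hence everywhere by linearity.\<close>

lemma univ_triple_cls:
  fixes M :: "('n::finite) cmat2"
  assumes M: "M \<in> bold_B"
  shows univ_H1_cls: "univ_H1 (cls M) = lattice_of M"
    and univ_eta_cls: "univ_eta j (cls M) (lat_vec M x) = (cvec x v* M) $ Inl j"
proof -
  obtain L E \<eta> where T: "univ_triple (cls M) = (L, E, \<eta>)" by (metis surj_pair)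
  have "case univ_triple (cls M) of (L, E, \<eta>) \<Rightarrow> pp_torus L E \<and> sh_basis L E (\<lambda>j z. z $ j) \<eta> \<and>
     period_class L E (\<lambda>j z. z $ j) \<eta> = cls M"
    unfolding univ_triple_def
    by (rule someI[of _ "(lattice_of M, polarization_of M, eta_of M)"])
      (simp add: pp_torus_lattice_of sh_basis_eta_of period_class_lattice_of M)
  then have "sh_basis L E (\<lambda>j z. z $ j) \<eta>" and pc: "period_class L E (\<lambda>j z. z $ j) \<eta> = cls M"
    by (simp_all add: T)
  then have lin: "linear (\<eta> j)" for j by (simp add: sh_basis_def H1_dR_def)
  have "M \<in> period_class L E (\<lambda>j z. z $ j) \<eta>"
    using pc self_in_cls by blast
  then obtain \<gamma> \<delta> where
    N: "M = block (period_mat \<eta> \<delta>) (mat (1 / (2 * of_real pi * \<i>)) ** period_mat (\<lambda>j z. z $ j) \<delta>)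
          (period_mat \<eta> \<gamma>) (mat (1 / (2 * of_real pi * \<i>)) ** period_mat (\<lambda>j z. z $ j) \<gamma>)"
    and b: "symp_H1_basis L E \<gamma> \<delta>"
    by (auto simp: period_class_def)
  have M1: "M $ Inl i $ Inl j = \<eta> j (\<delta> i)" "M $ Inr i $ Inl j = \<eta> j (\<gamma> i)" for i j
    by (subst N, simp add: block_def period_mat_def)+
  have M2: "M $ Inl i $ Inr j = 1 / (2 * of_real pi * \<i>) * \<delta> i $ j"
    "M $ Inr i $ Inr j = 1 / (2 * of_real pi * \<i>) * \<gamma> i $ j" for i j
    by (subst N, simp add: block_def period_mat_def mat_mult_component)+
  have b': "lat_vec M (axis (Inl i) 1) = \<delta> i" "lat_vec M (axis (Inr i) 1) = \<gamma> i" for i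
    by (simp_all add: vec_eq_iff lat_vec_axis M2)
  have "univ_H1 (cls M) = L" by (simp add: univ_H1_def T)
  also have "L = lattice_of M"
  proof -
    have "(\<chi> a. cvec (axis a 1)) = (mat 1 :: 'n cmat2)"
      by (simp add: vec_eq_iff mat_def axis_def)
    then have "symp_H1_basis (lattice_of M) (polarization_of M) \<gamma> \<delta>"
      using symp_H1_basis_iff[OF M, of "\<lambda>a. axis a 1"] by (simp add: b' Sp_Z_one)
    with b show ?thesis by (simp add: symp_H1_basis_def)
  qed
  finally show "univ_H1 (cls M) = lattice_of M" .
  have "univ_eta j (cls M) (lat_vec M x) = \<eta> j (lat_vec M x)"
    by (simp add: univ_eta_def T)
  also have "\<dots> = (\<Sum>k\<in>UNIV. x $ k *\<^sub>R \<eta> j (lat_vec M (axis k 1)))"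
    using linear_axis_expansion[OF linear_compose[OF linear_lat_vec lin], unfolded comp_def] .
  also have "\<dots> = (\<Sum>k\<in>UNIV. x $ k *\<^sub>R M $ k $ Inl j)"
    by (simp add: sum_UNIV_Plus b' M1)
  also have "\<dots> = (cvec x v* M) $ Inl j"
    by (simp add: vector_matrix_mult_def scaleR_conv_of_real mult.commute)
  finally show "univ_eta j (cls M) (lat_vec M x) = (cvec x v* M) $ Inl j" .
qed


section \<open>The Gauss-Manin connection in period coordinates\<close>

lemma linear_vec_mult_component:
  "linear (\<lambda>N :: complex^'n^'m. (z v* N) $ k)"
proof (rule linearI)
  show "(z v* (N + N')) $ k = (z v* N) $ k + (z v* N') $ k" for N N' :: "complex^'n^'m"
    by (simp add: vector_matrix_mult_def algebra_simps sum.distrib)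
  show "(z v* (c *\<^sub>R N)) $ k = c *\<^sub>R (z v* N) $ k" for c and N :: "complex^'n^'m"
    by (simp add: vector_matrix_mult_def scaleR_right.sum)
qed

lemma bounded_bilinear_lat_vec: "bounded_bilinear (lat_vec :: ('n::finite) cmat2 \<Rightarrow> _)"
proof -
  have "bilinear (lat_vec :: 'n cmat2 \<Rightarrow> _)"
    unfolding bilinear_def
  proof (intro conjI allI)
    show "linear (lat_vec M)" for M :: "'n cmat2" by (rule linear_lat_vec)
    show "linear (\<lambda>M :: 'n cmat2. lat_vec M x)" for x
      by (rule linearI)
        (simp_all add: lat_vec_def vec_eq_iff distrib_left
          linear_add[OF linear_vec_mult_component] linear_cmul[OF linear_vec_mult_component])
  qed
  then show ?thesis by (simp add: bilinear_conv_bounded_bilinear)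
qed

lemma int_vecs_norm_less_1: assumes "x \<in> int_vecs" "norm x < 1" shows "x = 0"
proof -
  have "x $ k = 0" for k
  proof -
    have "\<bar>x $ k\<bar> < 1" using component_le_norm_cart[of x k] assms(2) by linarith
    moreover obtain n where "x $ k = of_int n" using assms(1) by (auto simp: int_vecs_def elim: Ints_cases)
    ultimately show ?thesis by simp
  qed
  then show ?thesis by (simp add: vec_eq_iff)
qed

text \<open>The integral coordinates x N of c N must be shown not to jump. They are not known to be
  bounded beforehand, so the estimate bounds their change in terms of itself and absorbs it; a
  change of norm below 1 is zero by integrality.\<close>

lemma H1_section_locally_constant:
  fixes M :: "('n::finite) cmat2"
  assumes W: "W \<subseteq> bold_B" "M \<in> W" and c: "H1_section W c"
  obtains x where "x \<in> int_vecs" "c M = lat_vec M x"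
    "\<forall>\<^sub>F N in at M within W. c N = lat_vec N x"
proof -
  interpret lv: bounded_bilinear "lat_vec :: 'n cmat2 \<Rightarrow> _" by (rule bounded_bilinear_lat_vec)
  have M: "M \<in> bold_B" using W by auto
  have "\<exists>x\<in>int_vecs. c N = lat_vec N x" if "N \<in> W" for N
  proof -
    have "c N \<in> univ_H1 (cls N)" using c that by (simp add: H1_section_def)
    then show ?thesis
      unfolding univ_H1_cls[OF subsetD[OF W(1) that]] lattice_of_def by blast
  qed
  then have "\<forall>N\<in>W. \<exists>x. x \<in> int_vecs \<and> c N = lat_vec N x" by blast
  from bchoice[OF this] obtain x
    where x: "\<And>N. N \<in> W \<Longrightarrow> x N \<in> int_vecs" "\<And>N. N \<in> W \<Longrightarrow> c N = lat_vec N (x N)"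
    by blast
  obtain b where b: "b > 0" "\<And>x. b * norm x \<le> norm (lat_vec M x)"
    by (rule linear_inj_bounded_below_pos[OF linear_lat_vec inj_lat_vec[OF M]]) blast
  obtain K where K: "K > 0" "\<And>(N :: 'n cmat2) x. norm (lat_vec N x) \<le> norm N * norm x * K"
    using lv.pos_bounded by blast
  have gen: "b / (4 * k * y) * k * y = b / 4" if "k > 0" "y \<noteq> 0" for k y :: real
    using that by simp
  \<comment> \<open>Chosen so that r K (1 + |x M|) = b/4, where b is the lower bound for
    \<open>lat_vec M\<close> and K the bilinear bound.\<close>
  define r where "r = b / (4 * K * (1 + norm (x M)))"
  have r: "r > 0" using b K by (simp add: r_def add_pos_nonneg)
  have "continuous (at M within W) c"
    using c W(2) by (simp add: H1_section_def continuous_on_eq_continuous_within)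
  then have "(c \<longlongrightarrow> c M) (at M within W)" by (simp add: continuous_within)
  then have "\<forall>\<^sub>F N in at M within W. dist (c N) (c M) < b / 4"
    by (rule tendstoD) (use b in simp)
  moreover have "\<forall>\<^sub>F N in at M within W. dist N M < r"
    using r by (auto simp: eventually_at)
  moreover have "\<forall>\<^sub>F N in at M within W. N \<in> W"
    by (auto simp: eventually_at_filter)
  ultimately have "\<forall>\<^sub>F N in at M within W. c N = lat_vec N (x M)"
  proof eventually_elim
    case (elim N)
    \<comment> \<open>Moving the basis from N back to M leaves an error linear in N - M, which is
      controlled by r.\<close>
    have "lat_vec M (x N - x M) = (c N - c M) - lat_vec (N - M) (x N)"
      using x(2)[OF \<open>N \<in> W\<close>] x(2)[OF W(2)] by (simp add: lv.diff_left lv.diff_right)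
    then have "b * norm (x N - x M) \<le> norm (c N - c M) + norm (lat_vec (N - M) (x N))"
      using b(2)[of "x N - x M"] norm_triangle_ineq4[of "c N - c M" "lat_vec (N - M) (x N)"] by simp
    also have "norm (lat_vec (N - M) (x N)) \<le> norm (N - M) * norm (x N) * K" by (rule K)
    also have "\<dots> \<le> r * norm (x N) * K"
      using elim(2) K(1) by (intro mult_right_mono) (auto simp: dist_norm)
    also have "r * norm (x N) * K \<le> r * (norm (x N - x M) + norm (x M)) * K"
      using norm_triangle_sub[of "x N" "x M"] r K(1) by (intro mult_right_mono mult_left_mono) auto
    also have "\<dots> \<le> b / 4 * (norm (x N - x M) + 1)"
    proof -
      have "1 + norm (x M) \<noteq> 0" using norm_ge_zero[of "x M"] by linarith
      then have rK: "r * K * (1 + norm (x M)) = b / 4"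
        unfolding r_def using gen K(1) by blast
      have "norm (x N - x M) + norm (x M) \<le> (1 + norm (x M)) * (norm (x N - x M) + 1)"
        by (simp add: algebra_simps)
      then have "r * K * (norm (x N - x M) + norm (x M)) \<le> r * K * ((1 + norm (x M)) * (norm (x N - x M) + 1))"
        using r K(1) by (intro mult_left_mono) auto
      also have "\<dots> = b / 4 * (norm (x N - x M) + 1)"
        by (simp only: mult.assoc[symmetric] rK)
      finally show ?thesis by (simp only: mult.assoc mult.commute[of _ K])
    qed
    finally have "b * norm (x N - x M) \<le> norm (c N - c M) + b / 4 * (norm (x N - x M) + 1)" by simp
    also have "norm (c N - c M) < b / 4" using elim(1) by (simp add: dist_norm)
    \<comment> \<open>A quarter of b |x N - x M| has been absorbed on the left; the remaining
      constants add up to b/2, so the change is less than 2/3.\<close>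
    finally have "b * norm (x N - x M) * 3 < b * 2" by (simp add: distrib_left)
    then have "b * (norm (x N - x M) * 3) < b * 2" by (simp only: mult.assoc)
    then have "norm (x N - x M) < 1" using b(1) by simp
    then have "x N - x M = 0"
      using x(1)[OF \<open>N \<in> W\<close>] x(1)[OF W(2)] by (intro int_vecs_norm_less_1) (auto simp: int_vecs_def)
    then show ?case using x(2)[OF \<open>N \<in> W\<close>] by simp
  qed
  with x W(2) show ?thesis by (intro that[of "x M"]) auto
qed

section \<open>Tangent vectors of the symplectic group\<close>

definition outer :: "complex^('k::finite) \<Rightarrow> complex^'k \<Rightarrow> complex^'k^'k" where
  "outer v w = (\<chi> i j. v $ i * w $ j)"

lemma outer_axis_component: "outer (axis a s) (axis b 1) $ i $ j = (if a = i \<and> b = j then s else 0)"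
  "outer (axis b 1) (axis a s) $ i $ j = (if a = j \<and> b = i then s else 0)"
  by (auto simp: outer_def axis_def)

lemma outer_sympJ_outer: "outer v v ** sympJ ** outer v v = 0"
proof -
  have "(outer v v ** (sympJ ** outer v v)) $ i $ j = v $ i * cdot v (sympJ *v v) * v $ j" for i j
    by (simp add: outer_def matrix_matrix_mult_def cdot_def matrix_vector_mult_def
        sum_distrib_left sum_distrib_right mult.assoc)
  moreover have "cdot v (sympJ *v v) = 0"
    by (simp add: cdot_sympJ_sum mult.commute)
  ultimately show ?thesis by (simp add: vec_eq_iff matrix_mul_assoc)
qed

text \<open>These are the symplectic transvections: the terms linear in t cancel by J^2 = -1, and
  the quadratic term contains v^T J v = 0.\<close>

lemma transvection_Sp_C:
  fixes v :: "complex^(('n::finite) + 'n)"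
  shows "mat 1 + t *\<^sub>R (outer v v ** sympJ) \<in> Sp_C"
proof -
  have tr: "transpose (outer v v) = outer v v"
    by (simp add: transpose_def outer_def vec_eq_iff mult.commute)
  have "transpose (mat 1 + t *\<^sub>R (outer v v ** sympJ)) = mat 1 - t *\<^sub>R (sympJ ** outer v v)"
    by (simp add: transpose_add transpose_scalar matrix_transpose_mul transpose_sympJ tr)
  moreover have "(mat 1 + t *\<^sub>R X) ** Y = Y + t *\<^sub>R (X ** Y)" for X Y :: "'n cmat2"
    by (simp add: matrix_add_rdistrib linear_cmul[OF linear_matrix_mult_right])
  moreover have "X ** (mat 1 - t *\<^sub>R Y) = X - t *\<^sub>R (X ** Y)" for X Y :: "'n cmat2"
    by (simp add: linear_diff[OF linear_matrix_mult_left] linear_cmul[OF linear_matrix_mult_left])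
  ultimately have "(mat 1 + t *\<^sub>R (outer v v ** sympJ)) ** sympJ ** transpose (mat 1 + t *\<^sub>R (outer v v ** sympJ))
     = (sympJ + t *\<^sub>R (outer v v ** (sympJ ** sympJ))) - t *\<^sub>R ((sympJ ** sympJ) ** outer v v
         + t *\<^sub>R ((outer v v ** (sympJ ** sympJ)) ** sympJ ** outer v v))"
    by (simp add: matrix_mul_assoc matrix_add_rdistrib linear_cmul[OF linear_matrix_mult_right])
  also have "\<dots> = sympJ"
    by (simp add: sympJ_sq outer_sympJ_outer)
  finally show ?thesis by (simp add: Sp_C_def)
qed

text \<open>
  Derivatives within \<open>bold_B\<close> are determined on tangent vectors only: the lines
  \<open>M + t v v\<^sup>T J M\<close> stay in the symplectic group, and the \<open>v v\<^sup>T J M\<close> span the tangent space.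
\<close>

lemma derivative_on_tangent_Sp:
  fixes M :: "('n::finite) cmat2" and l :: "'n cmat2 \<Rightarrow> complex"
  assumes M: "M \<in> bold_B" and W: "openin (top_of_set bold_B) W" "M \<in> W"
    and l: "linear l" and D: "(l has_derivative D) (at M within W)" and V: "V \<in> tangent_Sp M"
  shows "D V = l V"
proof -
  have linD: "linear D" using D by (rule has_derivative_linear)
  have line: "D (outer v v ** sympJ ** M) = l (outer v v ** sympJ ** M)" for v
  proof -
    let ?V = "outer v v ** sympJ ** M"
    let ?g = "\<lambda>t. M + t *\<^sub>R ?V"
    have Sp: "?g t \<in> Sp_C" for t
    proof -
      have "?g t = (mat 1 + t *\<^sub>R (outer v v ** sympJ)) ** M"
        by (simp add: matrix_add_rdistrib linear_cmul[OF linear_matrix_mult_right])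
      then show ?thesis
        using Sp_C_mult[OF transvection_Sp_C subsetD[OF bold_B_subset M]] by simp
    qed
    obtain e1 where e1: "e1 > 0" "\<And>N. N \<in> Sp_C \<Longrightarrow> dist N M < e1 \<Longrightarrow> N \<in> bold_B"
      by (rule bold_B_open[OF M]) blast
    obtain e2 where e2: "e2 > 0" "\<And>N. N \<in> bold_B \<Longrightarrow> dist N M < e2 \<Longrightarrow> N \<in> W"
      using W unfolding openin_euclidean_subtopology_iff by blast
    define e where "e = min e1 e2 / (1 + norm ?V)"
    have e: "e > 0" using e1(1) e2(1) by (simp add: e_def add_pos_nonneg)
    have gW: "?g ` {0<..<e} \<subseteq> W" "?g 0 = M"
    proof -
      have "?g t \<in> W" if "t \<in> {0<..<e}" for t
      proof -
        have "dist (?g t) M = t * norm ?V" using that by (simp add: dist_norm)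
        also have "\<dots> \<le> t * (1 + norm ?V)" using that by (intro mult_left_mono) auto
        also have "\<dots> < e * (1 + norm ?V)"
          using that by (intro mult_strict_right_mono) (auto simp: add_pos_nonneg)
        also have "\<dots> = min e1 e2"
        proof -
          have "1 + norm ?V \<noteq> 0" using norm_ge_zero[of ?V] by linarith
          then show ?thesis by (simp add: e_def)
        qed
        finally show ?thesis using e1(2)[OF Sp] e2(2) by simp
      qed
      then show "?g ` {0<..<e} \<subseteq> W" by auto
    qed simp
    have g: "(?g has_derivative (\<lambda>t. t *\<^sub>R ?V)) (at 0 within {0<..<e})"
      by (auto intro!: derivative_eq_intros)
    have 1: "((\<lambda>t. l (?g t)) has_derivative (\<lambda>t. D (t *\<^sub>R ?V))) (at 0 within {0<..<e})"
      by (rule has_derivative_in_compose[OF g]) (use D gW in \<open>auto intro: has_derivative_subset\<close>)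
    have "(l has_derivative l) (at (?g 0) within X)" for X
      by (rule bounded_linear_imp_has_derivative) (use l in \<open>simp add: linear_conv_bounded_linear\<close>)
    then have 2: "((\<lambda>t. l (?g t)) has_derivative (\<lambda>t. l (t *\<^sub>R ?V))) (at 0 within {0<..<e})"
      by (rule has_derivative_in_compose[OF g])
    have "at 0 within {0<..<e} \<noteq> bot"
      using e by (simp add: at_within_eq_bot_iff)
    then show ?thesis
      by (rule vector_derivative_unique_within)
        (use 1 2 in \<open>simp_all add: has_vector_derivative_def linear_cmul[OF linD] linear_cmul[OF l]\<close>)
  qed
  define k where "k = (\<lambda>S. D (S ** sympJ ** M) - l (S ** sympJ ** M))"
  have k: "linear k"
  proof -
    have "linear (\<lambda>S. h (S ** sympJ ** M))" if "linear h" for h :: "'n cmat2 \<Rightarrow> complex"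
      using linear_compose[OF linear_matrix_mult_right linear_compose[OF linear_matrix_mult_right that]]
      unfolding comp_def .
    then show ?thesis
      unfolding k_def using linD l by (intro linear_compose_sub) auto
  qed
  have k0: "k (outer v v) = 0" for v
    by (simp add: k_def line)
  \<comment> \<open>Polarization passes from the rank-one matrices v v^T to all symmetrized
    products.\<close>
  have k2: "k (outer v w + outer w v) = 0" for v w
  proof -
    have "outer v w + outer w v = outer (v + w) (v + w) - outer v v - outer w w"
      by (simp add: outer_def vec_eq_iff algebra_simps)
    then show ?thesis by (simp add: linear_diff[OF k] k0)
  qed
  \<comment> \<open>Right translation to the identity: V is tangent at M exactly when S = -X J is
    symmetric, and then V = S J M.\<close>
  define X where "X = V ** sp_inv M"
  have Sp: "M \<in> Sp_C" using M bold_B_subset by blast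
  have V_eq: "V = X ** M"
    by (simp add: X_def matrix_mul_assoc[symmetric] sp_inv_left[OF Sp])
  define S where "S = - (X ** sympJ)"
  have "X ** (M ** sympJ ** transpose M) + (M ** sympJ ** transpose M) ** transpose X = 0"
    using V by (simp add: tangent_Sp_def V_eq matrix_transpose_mul matrix_mul_assoc)
  then have "X ** sympJ + sympJ ** transpose X = 0"
    using Sp by (simp add: Sp_C_def)
  then have "sympJ ** transpose X = S"
    unfolding S_def by (simp add: add_eq_0_iff)
  then have "transpose S = S"
    by (simp add: S_def matrix_transpose_mul transpose_sympJ)
  then have "transpose S $ j $ i = S $ j $ i" for i j by simp
  then have sym: "S $ i $ j = S $ j $ i" for i j
    by (simp add: transpose_def)
  \<comment> \<open>The complex coefficient sits inside the vector because \<open>k\<close> is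
    linear over the reals only. Each entry of S is produced twice, whence the factor 1/2.\<close>
  let ?P = "\<lambda>a b. outer (axis a (S $ a $ b)) (axis b 1) + outer (axis b 1) (axis a (S $ a $ b))"
  have delta: "(\<Sum>a\<in>UNIV. \<Sum>b\<in>UNIV. if a = i \<and> b = j then f a b else 0) = f i j"
    for f :: "'n + 'n \<Rightarrow> 'n + 'n \<Rightarrow> complex" and i j
  proof -
    have "(\<Sum>b\<in>UNIV. if a = i \<and> b = j then f a b else 0) = (if a = i then f a j else 0)" for a
      by (cases "a = i") auto
    then show ?thesis by simp
  qed
  have S_eq: "S = (1 / 2) *\<^sub>R (\<Sum>a\<in>UNIV. \<Sum>b\<in>UNIV. ?P a b)"
  proof -
    have P: "?P a b $ i $ j = (if a = i \<and> b = j then S $ a $ b else 0)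
        + (if a = j \<and> b = i then S $ a $ b else 0)" for a b i j
      unfolding vector_add_component outer_axis_component ..
    have comp: "(\<Sum>a\<in>UNIV. \<Sum>b\<in>UNIV. ?P a b) $ i $ j = S $ i $ j + S $ j $ i" for i j
      by (simp only: sum_component P) (simp only: sum.distrib delta)
    have half: "S = (1 / 2) *\<^sub>R Y" if Y: "\<And>i j. Y $ i $ j = S $ i $ j + S $ j $ i" for Y
    proof -
      have "((1 / 2) *\<^sub>R Y) $ i $ j = S $ i $ j" for i j
        using Y[of i j] sym[of i j] by simp
      then show ?thesis unfolding vec_eq_iff by metis
    qed
    show ?thesis by (rule half) (rule comp)
  qed
  have "k S = 0"
    by (subst S_eq) (simp add: linear_cmul[OF k] linear_sum[OF k] k2)
  moreover have "S ** sympJ ** M = V"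
    by (simp add: S_def V_eq matrix_mul_assoc[symmetric] sympJ_sq)
  ultimately show ?thesis by (simp add: k_def)
qed

text \<open>One direction tests the connection on the global sections with unit coordinate vectors
  and uses that the derivative is determined on tangent vectors. The other replaces an arbitrary
  section near M by one with constant coordinates, for which the integral is linear in N.\<close>

lemma gauss_manin_eta_iff:
  fixes M :: "('n::finite) cmat2"
  assumes M: "M \<in> bold_B" and V: "V \<in> tangent_Sp M"
  shows "gauss_manin (univ_eta j) M V (\<lambda>_. 0) \<longleftrightarrow> (\<forall>a. V $ a $ Inl j = 0)"
proof
  assume gm: "gauss_manin (univ_eta j) M V (\<lambda>_. 0)"
  show "\<forall>a. V $ a $ Inl j = 0"
  proof
    fix a
    let ?c = "\<lambda>N :: 'n cmat2. lat_vec N (axis a 1)"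
    have "continuous_on bold_B ?c"
      by (intro linear_continuous_on bounded_bilinear.bounded_linear_left bounded_bilinear_lat_vec)
    then have "H1_section bold_B ?c"
      by (simp add: H1_section_def univ_H1_cls lattice_of_def axis_in_int_vecs)
    moreover have op: "openin (top_of_set bold_B) (bold_B :: 'n cmat2 set)" by simp
    ultimately obtain D where D: "((\<lambda>N. univ_eta j (cls N) (?c N)) has_derivative D) (at M within bold_B)" "D V = 0"
      using gm M unfolding gauss_manin_def by blast
    have "((\<lambda>N. (cvec (axis a 1) v* N) $ Inl j) has_derivative D) (at M within bold_B)"
      by (rule has_derivative_transform[OF M _ D(1)]) (simp add: univ_eta_cls)
    then have "D V = (cvec (axis a 1) v* V) $ Inl j"
      by (rule derivative_on_tangent_Sp[OF M op M linear_vec_mult_component _ V])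
    then show "V $ a $ Inl j = 0" using D(2) by (simp add: cvec_axis_mult)
  qed
next
  assume 0: "\<forall>a. V $ a $ Inl j = 0"
  show "gauss_manin (univ_eta j) M V (\<lambda>_. 0)"
    unfolding gauss_manin_def
  proof (intro conjI allI impI)
    show "(\<lambda>_ :: complex^'n. 0) \<in> H1_dR" by (simp add: H1_dR_def linear_zero)
    fix W c assume *: "openin (top_of_set bold_B) W \<and> M \<in> W \<and> H1_section W c"
    then have WB: "W \<subseteq> bold_B" by (auto dest: openin_imp_subset)
    obtain x where x: "c M = lat_vec M x" "\<forall>\<^sub>F N in at M within W. c N = lat_vec N x"
      by (rule H1_section_locally_constant[OF WB, of M c]) (use * in auto)
    let ?D = "\<lambda>N. (cvec x v* N) $ Inl j"
    have "(?D has_derivative ?D) (at M within W)"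
      by (rule bounded_linear_imp_has_derivative) (use linear_vec_mult_component in \<open>simp add: linear_conv_bounded_linear\<close>)
    moreover have "\<forall>\<^sub>F N in at M within W. ?D N = univ_eta j (cls N) (c N)"
    proof -
      have "\<forall>\<^sub>F N in at M within W. N \<in> W" by (auto simp: eventually_at_filter)
      with x(2) show ?thesis by eventually_elim (simp add: univ_eta_cls[OF subsetD[OF WB]])
    qed
    ultimately have "((\<lambda>N. univ_eta j (cls N) (c N)) has_derivative ?D) (at M within W)"
      by (rule has_derivative_transform_eventually) (use * in \<open>simp_all add: x(1) univ_eta_cls[OF M]\<close>)
    moreover have "?D V = 0" using 0 by (simp add: vector_matrix_mult_def)
    ultimately show "\<exists>D. ((\<lambda>N. univ_eta j (cls N) (c N)) has_derivative D) (at M within W) \<and> D V = 0"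
      by blast
  qed
qed

definition lie_U :: "('n::finite) cmat2 set" where
  "lie_U = {block 0 Z 0 0 | Z. transpose Z = Z}"

text \<open>For V = M X the vanishing of the first block column passes to X, and tangency becomes X
  J + J X^T = 0. For such X this kills the lower right block and makes the upper right one
  symmetric.\<close>

lemma ramanujan_dist_eq:
  assumes M: "M \<in> bold_B" shows "ramanujan_dist M = (\<lambda>X. M ** X) ` lie_U"
proof
  have Sp: "M \<in> Sp_C" using M bold_B_subset by blast
  show "(\<lambda>X. M ** X) ` lie_U \<subseteq> ramanujan_dist M"
  proof (clarsimp simp: lie_U_def)
    fix Z :: "'a cmat" assume Z: "transpose Z = Z"
    let ?X = "block 0 Z 0 0"
    obtain A B C D where blk: "M = block A B C D" by (rule block_cases)
    have "?X ** sympJ + sympJ ** transpose ?X = 0"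
      by (simp add: sympJ_def transpose_block block_mult block_add Z block_zero)
    then have "M ** (?X ** sympJ + sympJ ** transpose ?X) ** transpose M = 0" by simp
    then have t: "M ** ?X \<in> tangent_Sp M"
      by (simp add: tangent_Sp_def matrix_transpose_mul matrix_mul_assoc matrix_add_ldistrib matrix_add_rdistrib)
    have "(M ** ?X) $ a $ Inl j = 0" for a j
      by (simp add: blk block_mult) (simp add: block_def split: sum.split)
    with t show "M ** ?X \<in> ramanujan_dist M"
      by (simp add: ramanujan_dist_def gauss_manin_eta_iff[OF M t])
  qed
  show "ramanujan_dist M \<subseteq> (\<lambda>X. M ** X) ` lie_U"
  proof
    fix V assume "V \<in> ramanujan_dist M"
    then have t: "V \<in> tangent_Sp M" and "\<forall>j. gauss_manin (univ_eta j) M V (\<lambda>_. 0)"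
      by (auto simp: ramanujan_dist_def)
    then have 0: "V $ a $ Inl j = 0" for a j
      by (simp add: gauss_manin_eta_iff[OF M t])
    define X where "X = sp_inv M ** V"
    have V: "V = M ** X"
      by (simp add: X_def matrix_mul_assoc sp_inv_right[OF Sp])
    have X0: "X $ a $ Inl j = 0" for a j
      by (simp add: X_def matrix_matrix_mult_def 0)
    obtain P Z Q Y where X: "X = block P Z Q Y" by (rule block_cases)
    have PQ: "P = 0" "Q = 0"
      using X0[of "Inl _"] X0[of "Inr _"] by (simp_all add: X block_def vec_eq_iff)
    have "M ** (X ** sympJ + sympJ ** transpose X) ** transpose M = 0"
      using t by (simp add: tangent_Sp_def V matrix_transpose_mul matrix_mul_assoc matrix_add_ldistrib matrix_add_rdistrib)
    then have "sp_inv M ** (M ** (X ** sympJ + sympJ ** transpose X) ** transpose M) ** transpose (sp_inv M) = 0"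
      by simp
    then have "(sp_inv M ** M) ** (X ** sympJ + sympJ ** transpose X) ** (transpose M ** transpose (sp_inv M)) = 0"
      by (simp only: matrix_mul_assoc)
    moreover have "transpose M ** transpose (sp_inv M) = mat 1"
      by (simp only: matrix_transpose_mul[symmetric] sp_inv_left[OF Sp] transpose_mat)
    ultimately have "X ** sympJ + sympJ ** transpose X = 0"
      by (simp only: sp_inv_left[OF Sp] matrix_mul_lid matrix_mul_rid)
    then have "block (transpose Z - Z) (transpose Y) (- Y) 0 = block 0 0 0 0"
      by (simp add: X PQ sympJ_def transpose_block block_mult block_add block_zero)
    then have "transpose Z = Z" "Y = 0" by (simp_all add: block_eq_iff)
    then show "V \<in> (\<lambda>X. M ** X) ` lie_U"
      unfolding V X PQ lie_U_def by blast
  qed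
qed


section \<open>The parametrizations\<close>

lemma unipotent_Sp_C_iff: "block (mat 1) Z 0 Y \<in> Sp_C \<longleftrightarrow> Y = mat 1 \<and> transpose Z = Z"
  by (auto simp: Sp_C_def sympJ_def transpose_block block_mult block_eq_iff)

lemma sp_inv_sp_inv: assumes "M \<in> Sp_C" shows "sp_inv (sp_inv M) = M"
proof -
  have "sp_inv (sp_inv M) = (M ** sp_inv M) ** sp_inv (sp_inv M)"
    by (simp add: sp_inv_right[OF assms])
  also have "\<dots> = M"
    by (simp only: matrix_mul_assoc[symmetric] sp_inv_right[OF sp_inv_Sp_C[OF assms]] matrix_mul_rid)
  finally show ?thesis .
qed

text \<open>Applying \<delta> to the column (\<tau>, 1) gives (L, K) = (Z, 1) K with K = C \<tau> +
  D. The column is isotropic for J and \<delta> preserves J, so L^T K is symmetric, and hence so is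
  Z = L K^-1.\<close>

lemma psi_block:
  assumes \<delta>: "block A B C D \<in> Sp_C" and \<tau>: "transpose \<tau> = \<tau>" and K: "invertible (C ** \<tau> + D)"
  defines "Z \<equiv> moebius (block A B C D) \<tau>"
  shows "transpose Z = Z"
    and "sp_inv (block A B C D) ** block (mat 1) Z 0 (mat 1) ** block 0 0 0 (C ** \<tau> + D) = block 0 \<tau> 0 (mat 1)"
proof -
  define L where "L = A ** \<tau> + B"
  define K' where "K' = C ** \<tau> + D"
  have Z: "Z = L ** matrix_inv K'" by (simp add: Z_def moebius_def L_def K'_def)
  have inv: "invertible K'" using K by (simp add: K'_def)
  \<comment> \<open>The block column (\<tau>, 1) is padded by zero columns so that all products stay
    among square matrices.\<close>
  let ?\<delta> = "block A B C D" and ?T = "block 0 \<tau> 0 (mat 1)"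
  have \<delta>T: "?\<delta> ** ?T = block 0 L 0 K'"
    by (simp add: block_mult L_def K'_def)
  have "transpose ?T ** (transpose ?\<delta> ** sympJ ** ?\<delta>) ** ?T = transpose (?\<delta> ** ?T) ** sympJ ** (?\<delta> ** ?T)"
    by (simp only: matrix_transpose_mul matrix_mul_assoc)
  then have "transpose ?T ** sympJ ** ?T = transpose (block 0 L 0 K') ** sympJ ** block 0 L 0 K'"
    by (simp only: Sp_C_transpose[OF \<delta>] \<delta>T)
  then have LK: "transpose L ** K' = transpose K' ** L"
    by (simp add: sympJ_def transpose_block block_mult block_eq_iff \<tau>)
  have "transpose Z = transpose (matrix_inv K') ** transpose L ** (K' ** matrix_inv K')"
    by (simp add: Z matrix_transpose_mul matrix_inv_cancel[OF inv])
  also have "\<dots> = transpose (matrix_inv K') ** (transpose L ** K') ** matrix_inv K'"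
    by (simp only: matrix_mul_assoc)
  also have "\<dots> = transpose (K' ** matrix_inv K') ** (L ** matrix_inv K')"
    by (simp only: LK matrix_mul_assoc matrix_transpose_mul)
  finally show "transpose Z = Z"
    by (simp add: matrix_inv_cancel[OF inv] Z)
  have "L ** matrix_inv K' ** K' = L"
    by (simp only: matrix_mul_assoc[symmetric] matrix_inv_cancel[OF inv] matrix_mul_rid)
  then have "block (mat 1) Z 0 (mat 1) ** block 0 0 0 K' = ?\<delta> ** ?T"
    unfolding \<delta>T by (simp add: block_mult Z)
  then have "sp_inv ?\<delta> ** block (mat 1) Z 0 (mat 1) ** block 0 0 0 K' = (sp_inv ?\<delta> ** ?\<delta>) ** ?T"
    by (simp only: matrix_mul_assoc[symmetric])
  then show "sp_inv ?\<delta> ** block (mat 1) Z 0 (mat 1) ** block 0 0 0 (C ** \<tau> + D) = ?T"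
    by (simp only: sp_inv_left[OF \<delta>] matrix_mul_lid K'_def)
qed

text \<open>By \<open>psi_block\<close> the right blocks of \<open>psi \<delta> \<tau>\<close> are
  \<tau> K^-1 and K^-1 with K = C \<tau> + D. So \<tau> is recovered as the quotient of the two
  right blocks, and K as the inverse of the lower one; this works for any element of the coset in
  \<open>bold_B\<close>.\<close>

lemma psi_image:
  assumes \<delta>: "\<delta> \<in> Sp_C"
  shows "psi \<delta> ` U_dom \<delta> = {matrix_inv \<delta> ** u | u. u \<in> U_C} \<inter> bold_B"
proof
  obtain A B C D where d: "\<delta> = block A B C D" by (rule block_cases)
  have \<delta>': "block A B C D \<in> Sp_C" using \<delta> d by simp
  show "psi \<delta> ` U_dom \<delta> \<subseteq> {matrix_inv \<delta> ** u | u. u \<in> U_C} \<inter> bold_B"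
  proof
    fix N assume "N \<in> psi \<delta> ` U_dom \<delta>"
    then obtain \<tau> where \<tau>: "\<tau> \<in> siegel_H" "invertible (C ** \<tau> + D)" "N = psi \<delta> \<tau>"
      by (auto simp: U_dom_def d)
    let ?Z = "moebius \<delta> \<tau>" and ?K = "C ** \<tau> + D"
    have sym: "transpose \<tau> = \<tau>" using \<tau>(1) by (simp add: siegel_H_def)
    have Z: "transpose ?Z = ?Z" and eq: "N ** block 0 0 0 ?K = block 0 \<tau> 0 (mat 1)"
      using psi_block[OF \<delta>' sym \<tau>(2)] by (simp_all add: d[symmetric] \<tau>(3) psi_def matrix_inv_Sp_C[OF \<delta>])
    have NSp: "N \<in> Sp_C"
      unfolding \<tau>(3) psi_def matrix_inv_Sp_C[OF \<delta>]
      by (intro Sp_C_mult sp_inv_Sp_C \<delta>) (simp add: unipotent_Sp_C_iff Z)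
    obtain a b c e where N: "N = block a b c e" by (rule block_cases)
    have K: "b ** ?K = \<tau>" "e ** ?K = mat 1"
      using eq by (simp_all add: N block_mult block_eq_iff)
    then have K': "?K ** e = mat 1" by (simp add: matrix_left_right_inverse)
    then have inv: "invertible e" using K unfolding invertible_def by blast
    have "b = b ** (?K ** e)" by (simp add: K')
    also have "\<dots> = \<tau> ** e" by (simp only: matrix_mul_assoc K(1))
    finally have "b ** matrix_inv e = \<tau> ** (e ** matrix_inv e)" by (simp only: matrix_mul_assoc)
    then have "N \<in> bold_B"
      using NSp \<tau>(1) inv by (simp add: bold_B_def N matrix_inv_cancel[OF inv])
    moreover have "block (mat 1) ?Z 0 (mat 1) \<in> U_C" using Z by (auto simp: U_C_def)
    ultimately show "N \<in> {matrix_inv \<delta> ** u | u. u \<in> U_C} \<inter> bold_B"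
      unfolding \<tau>(3) psi_def by blast
  qed
  show "{matrix_inv \<delta> ** u | u. u \<in> U_C} \<inter> bold_B \<subseteq> psi \<delta> ` U_dom \<delta>"
  proof
    fix N assume "N \<in> {matrix_inv \<delta> ** u | u. u \<in> U_C} \<inter> bold_B"
    then obtain Z where Z: "transpose Z = Z" "N = matrix_inv \<delta> ** block (mat 1) Z 0 (mat 1)" and NB: "N \<in> bold_B"
      by (auto simp: U_C_def)
    obtain a b c e where N: "N = block a b c e" by (rule block_cases)
    define \<tau> where "\<tau> = b ** matrix_inv e"
    have inv: "invertible e" and \<tau>: "\<tau> \<in> siegel_H" using NB by (auto simp: bold_B_def N \<tau>_def)
    have "\<delta> ** N = (\<delta> ** sp_inv \<delta>) ** block (mat 1) Z 0 (mat 1)"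
      by (simp add: Z(2) matrix_inv_Sp_C[OF \<delta>] matrix_mul_assoc)
    then have "\<delta> ** N = block (mat 1) Z 0 (mat 1)" by (simp add: sp_inv_right[OF \<delta>])
    then have "\<delta> ** (N ** block 0 0 0 (matrix_inv e)) = block (mat 1) Z 0 (mat 1) ** block 0 0 0 (matrix_inv e)"
      by (simp add: matrix_mul_assoc)
    then have eq: "C ** \<tau> + D = matrix_inv e" "A ** \<tau> + B = Z ** matrix_inv e"
      by (simp_all add: N d block_mult block_eq_iff matrix_inv_cancel[OF inv] \<tau>_def)
    have inv': "invertible (matrix_inv e)"
      using matrix_inv_cancel[OF inv] unfolding invertible_def by blast
    have "moebius \<delta> \<tau> = Z ** (matrix_inv e ** matrix_inv (matrix_inv e))"
      by (simp add: moebius_def d eq matrix_mul_assoc)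
    then have "moebius \<delta> \<tau> = Z" by (simp add: matrix_inv_cancel[OF inv'])
    then have "N = psi \<delta> \<tau>" by (simp add: psi_def Z(2))
    moreover have "\<tau> \<in> U_dom \<delta>" using \<tau> inv' by (simp add: U_dom_def d eq)
    ultimately show "N \<in> psi \<delta> ` U_dom \<delta>" by blast
  qed
qed

section \<open>Continuity of the Moebius action; connected and nonempty domains\<close>

lemma continuous_on_matrix_mult:
  fixes f :: "'a::topological_space \<Rightarrow> complex^'n^'m"
  assumes "continuous_on S f" "continuous_on S g"
  shows "continuous_on S (\<lambda>x. f x ** g x)"
  unfolding matrix_matrix_mult_def using assms by (intro continuous_intros)

lemma continuous_on_det: "continuous_on S (det :: complex^'n^'n \<Rightarrow> complex)"
  unfolding det_def[abs_def] by (intro continuous_intros)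

text \<open>Cramer's rule for K x = e_l. It writes the inverse as quotients of polynomials in the
  entries, whence its continuity.\<close>

lemma matrix_inv_cramer:
  fixes K :: "complex^'n^'n"
  assumes "invertible K"
  shows "matrix_inv K $ k $ l = det (\<chi> i j. if j = k then axis l 1 $ i else K $ i $ j) / det K"
proof -
  have "K *v (matrix_inv K *v axis l 1) = axis l 1"
    by (simp add: matrix_vector_mul_assoc matrix_inv_cancel[OF assms])
  moreover have "det K \<noteq> 0" using assms by (simp add: invertible_det_nz)
  ultimately have "matrix_inv K *v axis l 1 = (\<chi> k. det (\<chi> i j. if j = k then axis l 1 $ i else K $ i $ j) / det K)"
    using cramer by blast
  then have "(matrix_inv K *v axis l 1) $ k = det (\<chi> i j. if j = k then axis l 1 $ i else K $ i $ j) / det K"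
    by (simp only: vec_lambda_beta)
  moreover have "(matrix_inv K *v axis l 1) $ k = matrix_inv K $ k $ l"
  proof -
    have "(matrix_inv K *v axis l 1) $ k = (\<Sum>j\<in>UNIV. if j = l then matrix_inv K $ k $ j else 0)"
      unfolding matrix_vector_mult_def vec_lambda_beta by (intro sum.cong) (auto simp: axis_def)
    then show ?thesis by simp
  qed
  ultimately show ?thesis by simp
qed

lemma continuous_on_matrix_inv:
  "continuous_on {K :: complex^'n^'n. invertible K} matrix_inv"
proof -
  have "continuous_on {K :: complex^'n^'n. invertible K}
      (\<lambda>K. \<chi> k l. det (\<chi> i j. if j = k then axis l 1 $ i else K $ i $ j) / det K)"
  proof (intro continuous_on_vec_lambda continuous_on_divide)
    fix k l :: 'n
    have c: "continuous_on X (\<lambda>K :: complex^'n^'n. \<chi> i j. if j = k then axis l 1 $ i else K $ i $ j)" for X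
    proof (intro continuous_on_vec_lambda)
      show "continuous_on X (\<lambda>K :: complex^'n^'n. if j = k then axis l 1 $ i else K $ i $ j)" for i j
        by (cases "j = k") (auto intro!: continuous_intros)
    qed
    show "continuous_on {K :: complex^'n^'n. invertible K} (\<lambda>K. det (\<chi> i j. if j = k then axis l 1 $ i else K $ i $ j))"
      by (rule continuous_on_compose2[OF continuous_on_det[of UNIV] c subset_UNIV])
    show "continuous_on {K :: complex^'n^'n. invertible K} det" by (rule continuous_on_det)
    show "\<forall>K\<in>{K :: complex^'n^'n. invertible K}. det K \<noteq> 0" by (simp add: invertible_det_nz)
  qed
  then show ?thesis
  proof (rule continuous_on_eq)
    fix K :: "complex^'n^'n" assume "K \<in> {K. invertible K}"
    then have "invertible K" by simp
    then show "(\<chi> k l. det (\<chi> i j. if j = k then axis l 1 $ i else K $ i $ j) / det K) = matrix_inv K"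
      by (intro vec_eq_iff[THEN iffD2] allI) (simp only: vec_lambda_beta matrix_inv_cramer)
  qed
qed

lemma continuous_on_moebius: "continuous_on (U_dom \<delta>) (moebius \<delta>)"
proof -
  have aff: "continuous_on S (\<lambda>\<tau>. X ** \<tau> + Y)" for X Y and S :: "'a cmat set"
    by (intro continuous_intros continuous_on_matrix_mult)
  have "continuous_on (U_dom \<delta>) (\<lambda>\<tau>. matrix_inv (blkC \<delta> ** \<tau> + blkD \<delta>))"
    by (rule continuous_on_compose2[OF continuous_on_matrix_inv aff]) (auto simp: U_dom_def)
  then show ?thesis
    unfolding moebius_def[abs_def] by (intro continuous_on_matrix_mult aff)
qed

lemma convex_siegel_H: "convex siegel_H"
proof (rule convexI)
  fix \<tau> \<sigma> :: "'a cmat" and u v :: real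
  assume *: "\<tau> \<in> siegel_H" "\<sigma> \<in> siegel_H" "0 \<le> u" "0 \<le> v" "u + v = 1"
  have "x \<bullet> ((\<chi> i j. Im ((u *\<^sub>R \<tau> + v *\<^sub>R \<sigma>) $ i $ j)) *v x) > 0" if "x \<noteq> 0" for x
  proof -
    have "(\<chi> i j. Im ((u *\<^sub>R \<tau> + v *\<^sub>R \<sigma>) $ i $ j)) *v x
        = u *\<^sub>R ((\<chi> i j. Im (\<tau> $ i $ j)) *v x) + v *\<^sub>R ((\<chi> i j. Im (\<sigma> $ i $ j)) *v x)"
      by (simp add: matrix_vector_mult_def vec_eq_iff sum.distrib sum_distrib_left algebra_simps)
    moreover have "0 < x \<bullet> ((\<chi> i j. Im (\<tau> $ i $ j)) *v x)" "0 < x \<bullet> ((\<chi> i j. Im (\<sigma> $ i $ j)) *v x)"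
      using * that by (auto simp: siegel_H_def)
    ultimately show ?thesis
      using * by (cases "u = 0") (auto simp: inner_add_right intro: add_pos_nonneg)
  qed
  moreover have "transpose (u *\<^sub>R \<tau> + v *\<^sub>R \<sigma>) = u *\<^sub>R \<tau> + v *\<^sub>R \<sigma>"
    using * by (simp add: siegel_H_def transpose_add transpose_scalar)
  ultimately show "u *\<^sub>R \<tau> + v *\<^sub>R \<sigma> \<in> siegel_H" by (simp add: siegel_H_def)
qed

text \<open>Transfers openness: through these matrices \<open>bold_B_open\<close> says that
  \<open>siegel_H\<close> is open among the symmetric matrices.\<close>

lemma block_unipotent_bold_B_iff: "block (mat 1) \<tau> 0 (mat 1) \<in> bold_B \<longleftrightarrow> \<tau> \<in> siegel_H"
proof -
  have "matrix_inv (mat 1 :: 'a cmat) = mat 1" "invertible (mat 1 :: 'a cmat)"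
    using matrix_inv_cancel(1)[of "mat 1 :: 'a cmat"] by (auto simp: invertible_def)
  then show ?thesis
    by (auto simp: bold_B_def unipotent_Sp_C_iff siegel_H_def)
qed

text \<open>
  Two points of \<open>U_dom \<delta>\<close> are joined inside the complex line through them: its intersection with the
  convex set \<open>siegel_H\<close> is convex and open, and only the finitely many zeros of the polynomial
  \<open>det (C \<tau> + D)\<close> in the line parameter are removed from it.
\<close>

lemma connected_U_dom: "connected (U_dom (\<delta> :: ('n::finite) cmat2))"
  unfolding connected_iff_connected_component
proof (intro ballI)
  fix \<tau>\<^sub>0 \<tau>\<^sub>1 assume \<tau>: "\<tau>\<^sub>0 \<in> U_dom \<delta>" "\<tau>\<^sub>1 \<in> U_dom \<delta>"
  let ?C = "blkC \<delta>" and ?D = "blkD \<delta>"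
  define \<iota> where "\<iota> = (\<lambda>s :: complex. (\<chi> i j. \<tau>\<^sub>0 $ i $ j + s * (\<tau>\<^sub>1 $ i $ j - \<tau>\<^sub>0 $ i $ j)) :: 'n cmat)"
  have \<iota>01: "\<iota> 0 = \<tau>\<^sub>0" "\<iota> 1 = \<tau>\<^sub>1" by (simp_all add: \<iota>_def vec_eq_iff)
  have cont: "continuous_on X \<iota>" for X
    unfolding \<iota>_def by (intro continuous_intros)
  define \<Omega> where "\<Omega> = {s. \<iota> s \<in> siegel_H}"
  have "\<iota> (u *\<^sub>R s + v *\<^sub>R t) = u *\<^sub>R \<iota> s + v *\<^sub>R \<iota> t" if "u + v = 1" for u v s t
  proof -
    have v: "v = 1 - u" using that by simp
    show ?thesis unfolding v by (simp add: \<iota>_def vec_eq_iff scaleR_conv_of_real[where 'a = complex] algebra_simps)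
  qed
  then have convex: "convex \<Omega>"
    using convex_siegel_H unfolding \<Omega>_def convex_def by auto
  have "\<exists>e>0. ball 0 e \<subseteq> \<Omega>"
  proof -
    have \<tau>0: "\<tau>\<^sub>0 \<in> siegel_H" using \<tau> by (simp add: U_dom_def)
    then have "block (mat 1) \<tau>\<^sub>0 0 (mat 1) \<in> bold_B" by (simp add: block_unipotent_bold_B_iff)
    then obtain e where e: "e > 0"
      "\<And>N. N \<in> Sp_C \<Longrightarrow> dist N (block (mat 1) \<tau>\<^sub>0 0 (mat 1)) < e \<Longrightarrow> N \<in> bold_B"
      by (rule bold_B_open) blast
    have "continuous_on UNIV (\<lambda>s. block (mat 1) (\<iota> s) 0 (mat 1))"
      unfolding block_def
    proof (intro continuous_on_vec_lambda)
      show "continuous_on UNIV (\<lambda>s. case i of Inl a \<Rightarrow> (case j of Inl b \<Rightarrow> mat 1 $ a $ b | Inr b \<Rightarrow> \<iota> s $ a $ b)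
        | Inr a \<Rightarrow> (case j of Inl b \<Rightarrow> 0 $ a $ b | Inr b \<Rightarrow> mat 1 $ a $ b))" for i j
        by (cases i; cases j) (auto intro!: continuous_intros cont)
    qed
    then obtain d where d: "d > 0"
      "\<And>s. dist s 0 < d \<Longrightarrow> dist (block (mat 1) (\<iota> s) 0 (mat 1)) (block (mat 1) (\<iota> 0) 0 (mat 1)) < e"
      using e(1) unfolding continuous_on_iff by blast
    have "transpose (\<iota> s) = \<iota> s" for s
    proof -
      have "transpose \<tau>\<^sub>0 = \<tau>\<^sub>0" "transpose \<tau>\<^sub>1 = \<tau>\<^sub>1" using \<tau> by (simp_all add: U_dom_def siegel_H_def)
      then have "\<tau>\<^sub>0 $ j $ i = \<tau>\<^sub>0 $ i $ j" "\<tau>\<^sub>1 $ j $ i = \<tau>\<^sub>1 $ i $ j" for i j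
        by (simp_all add: transpose_def vec_eq_iff)
      then show ?thesis by (simp add: transpose_def \<iota>_def vec_eq_iff)
    qed
    then have "block (mat 1) (\<iota> s) 0 (mat 1) \<in> Sp_C" for s
      by (simp add: unipotent_Sp_C_iff)
    then have "block (mat 1) (\<iota> s) 0 (mat 1) \<in> bold_B" if "dist s 0 < d" for s
      using e(2) d(2)[OF that] unfolding \<iota>01 by blast
    then have "\<iota> s \<in> siegel_H" if "dist s 0 < d" for s
      using that by (simp only: block_unipotent_bold_B_iff)
    then have "ball 0 d \<subseteq> \<Omega>" by (auto simp: \<Omega>_def dist_commute)
    with d(1) show ?thesis by blast
  qed
  then obtain e where e: "e > 0" "ball 0 e \<subseteq> \<Omega>" by blast
  \<comment> \<open>Removing points from a convex set keeps it connected only if the set is not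
    contained in a real line; here it contains a disc.\<close>
  have "\<not> collinear \<Omega>"
  proof
    assume "collinear \<Omega>"
    then have "aff_dim \<Omega> \<le> 1" by (simp add: collinear_aff_dim)
    moreover have "aff_dim (ball (0::complex) e) = 2"
      using e(1) by (subst aff_dim_open) auto
    ultimately show False using aff_dim_subset[OF e(2)] by simp
  qed
  \<comment> \<open>The Leibniz expansion of det(C \<tau> + D) along the line, whose entries are
    affine in s. It is nonzero at s = 0, so it has finitely many roots.\<close>
  define Q where "Q = (\<Sum>p | p permutes (UNIV :: 'n set). [:of_int (sign p):] *
      (\<Prod>i\<in>UNIV. [:(?C ** \<tau>\<^sub>0 + ?D) $ i $ p i, (?C ** (\<tau>\<^sub>1 - \<tau>\<^sub>0)) $ i $ p i:]))"
  have entry: "(?C ** \<iota> s + ?D) $ i $ j = poly [:(?C ** \<tau>\<^sub>0 + ?D) $ i $ j, (?C ** (\<tau>\<^sub>1 - \<tau>\<^sub>0)) $ i $ j:] s" for s i j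
    by (simp add: \<iota>_def matrix_matrix_mult_def sum.distrib sum_distrib_left algebra_simps sum_subtractf)
  have Q: "poly Q s = det (?C ** \<iota> s + ?D)" for s
    unfolding Q_def det_def entry by (simp add: poly_sum poly_prod)
  have "poly Q 0 \<noteq> 0"
    using \<tau> by (simp add: Q \<iota>01 U_dom_def invertible_det_nz)
  then have "Q \<noteq> 0" by auto
  then have "countable {s. poly Q s = 0}"
    by (intro countable_finite poly_roots_finite)
  then have "path_connected (\<Omega> - {s. poly Q s = 0})"
    using convex \<open>\<not> collinear \<Omega>\<close> by (intro path_connected_convex_diff_countable)
  then have "connected (\<iota> ` (\<Omega> - {s. poly Q s = 0}))"
    by (intro connected_continuous_image cont path_connected_imp_connected)
  moreover have "\<iota> ` (\<Omega> - {s. poly Q s = 0}) \<subseteq> U_dom \<delta>"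
    by (auto simp: \<Omega>_def U_dom_def Q invertible_det_nz)
  moreover have "\<tau>\<^sub>0 \<in> \<iota> ` (\<Omega> - {s. poly Q s = 0})"
    using \<tau> by (intro image_eqI[of _ _ 0]) (auto simp: \<iota>01 \<Omega>_def U_dom_def Q invertible_det_nz)
  moreover have "\<tau>\<^sub>1 \<in> \<iota> ` (\<Omega> - {s. poly Q s = 0})"
    using \<tau> by (intro image_eqI[of _ _ 1]) (auto simp: \<iota>01 \<Omega>_def U_dom_def Q invertible_det_nz)
  ultimately show "connected_component (U_dom \<delta>) \<tau>\<^sub>0 \<tau>\<^sub>1"
    unfolding connected_component_def by blast
qed

text \<open>The imaginary part gains w w^T, so its quadratic form gains the square of w . x.\<close>

lemma siegel_H_add_rank_one:
  assumes "\<tau> \<in> siegel_H"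
  shows "\<tau> + (\<chi> i j. \<i> * (of_real (w $ i) * of_real (w $ j))) \<in> siegel_H" (is "\<tau> + ?R \<in> _")
proof -
  have "x \<bullet> ((\<chi> i j. Im ((\<tau> + ?R) $ i $ j)) *v x) = x \<bullet> ((\<chi> i j. Im (\<tau> $ i $ j)) *v x) + (w \<bullet> x)\<^sup>2" for x
  proof -
    have "(\<chi> i j. Im ((\<tau> + ?R) $ i $ j)) *v x = (\<chi> i j. Im (\<tau> $ i $ j)) *v x + (w \<bullet> x) *\<^sub>R w"
      by (simp add: matrix_vector_mult_def vec_eq_iff sum.distrib sum_distrib_left inner_vec_def
          algebra_simps)
    then show ?thesis
      by (simp add: inner_add_right power2_eq_square inner_commute)
  qed
  moreover have "transpose (\<tau> + ?R) = \<tau> + ?R"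
    using assms by (simp add: siegel_H_def transpose_add) (simp add: transpose_def vec_eq_iff mult.commute)
  ultimately show ?thesis
    using assms by (auto simp: siegel_H_def intro: add_pos_nonneg)
qed

text \<open>
  Among the \<open>\<tau> \<in> siegel_H\<close> take one for which the kernel of \<open>C \<tau> + D\<close> has least dimension. If it
  were not zero, adding a suitable \<open>\<i> w w\<^sup>T\<close> with real \<open>w\<close> to \<open>\<tau>\<close> would cut the kernel down to its
  intersection with the hyperplane \<open>w\<^sup>\<bottom>\<close>.
\<close>

lemma U_dom_nonempty:
  fixes \<delta> :: "('n::finite) cmat2"
  assumes \<delta>: "\<delta> \<in> Sp_C" shows "U_dom \<delta> \<noteq> {}"
proof -
  obtain A B C D where d: "\<delta> = block A B C D" by (rule block_cases)
  let ?ker = "\<lambda>\<tau>. {v. (C ** \<tau> + D) *v v = 0}"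
  have i: "mat \<i> \<in> (siegel_H :: 'n cmat set)"
  proof -
    have "(\<chi> i j. Im ((mat \<i> :: 'n cmat) $ i $ j)) = mat 1"
      by (simp add: mat_def vec_eq_iff)
    then show ?thesis by (simp add: siegel_H_def)
  qed
  define \<tau> where "\<tau> = arg_min (\<lambda>\<tau>. dim (?ker \<tau>)) (\<lambda>\<tau>. \<tau> \<in> siegel_H)"
  have \<tau>: "\<tau> \<in> siegel_H" and min: "\<And>\<sigma>. \<sigma> \<in> siegel_H \<Longrightarrow> dim (?ker \<tau>) \<le> dim (?ker \<sigma>)"
    using arg_min_nat_lemma[of "\<lambda>\<tau>. \<tau> \<in> siegel_H", OF i, of "\<lambda>\<tau>. dim (?ker \<tau>)"]
    by (auto simp: \<tau>_def)
  let ?N = "C ** \<tau> + D"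
  have "invertible ?N"
  proof (rule ccontr)
    assume sing: "\<not> invertible ?N"
    then obtain x where x: "?N *v x = 0" "x \<noteq> 0"
      by (auto simp: invertible_left_inverse matrix_left_invertible_ker)
    have "\<not> invertible (transpose ?N)"
      using sing unfolding invertible_det_nz det_transpose .
    then obtain y where y: "transpose ?N *v y = 0" "y \<noteq> 0"
      unfolding invertible_left_inverse matrix_left_invertible_ker by blast
    \<comment> \<open>Here y is a left kernel vector of C \<tau> + D. If C^T y were zero, D^T y
      would be zero as well, and the lower rows of \<delta> would be dependent.\<close>
    define u where "u = transpose C *v y"
    have "u \<noteq> 0"
    proof
      assume u: "u = 0"
      have "transpose ?N *v y = transpose \<tau> *v u + transpose D *v y"
        unfolding u_def matrix_vector_mul_assoc transpose_add matrix_transpose_mul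
        by (simp only: matrix_vector_mult_add_rdistrib)
      then have D: "transpose D *v y = 0"
        by (simp only: y(1) u matrix_vector_mult_0_right add_0_left)
      have "transpose \<delta> *v vjoin 0 y = 0"
        unfolding d transpose_block block_mult_vjoin u_def[symmetric] D u
        by (simp only: matrix_vector_mult_0_right add_0_left vjoin_zero)
      moreover have "invertible (transpose \<delta>)"
        using invertible_Sp_C[OF \<delta>] unfolding invertible_det_nz det_transpose .
      ultimately have "vjoin 0 y = vjoin 0 0"
        unfolding vjoin_zero by (metis invertible_left_inverse matrix_left_invertible_ker)
      then show False using y(2) by (simp add: vjoin_eq_iff)
    qed
    \<comment> \<open>A real vector off two complex hyperplanes: u . w nonzero confines the new
      kernel to the old one, and x . w nonzero removes x from it. A unit vector or a sum of two
      suffices.\<close>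
    obtain w :: "real^'n" where w: "cdot u (cvec w) \<noteq> 0" "cdot x (cvec w) \<noteq> 0"
    proof -
      have ax: "cdot z (cvec (axis k 1)) = z $ k" for z :: "complex^'n" and k
      proof -
        have "cdot z (cvec (axis k 1)) = (\<Sum>i\<in>UNIV. if i = k then z $ i else 0)"
          unfolding cdot_def by (intro sum.cong) (auto simp: axis_def)
        then show ?thesis by simp
      qed
      have add: "cdot z (cvec (v + v')) = cdot z (cvec v) + cdot z (cvec v')" for z :: "complex^'n" and v v'
        by (simp add: cdot_def distrib_left sum.distrib)
      from \<open>u \<noteq> 0\<close> x(2) obtain a b where ab: "u $ a \<noteq> 0" "x $ b \<noteq> 0" by (auto simp: vec_eq_iff)
      consider "x $ a \<noteq> 0" | "u $ b \<noteq> 0" | "x $ a = 0" "u $ b = 0" by blast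
      then show thesis
      proof cases
        case 1 then show ?thesis using ab by (intro that[of "axis a 1"]) (auto simp: ax)
      next
        case 2 then show ?thesis using ab by (intro that[of "axis b 1"]) (auto simp: ax)
      next
        case 3 then show ?thesis using ab by (intro that[of "axis a 1 + axis b 1"]) (auto simp: ax add)
      qed
    qed
    let ?R = "(\<chi> i j. \<i> * (of_real (w $ i) * of_real (w $ j))) :: 'n cmat"
    have R: "(C ** (\<tau> + ?R) + D) *v v = ?N *v v + (\<i> * cdot (cvec w) v) *s (C *v cvec w)" for v
    proof -
      have "?R *v v = (\<i> * cdot (cvec w) v) *s cvec w"
        by (simp add: matrix_vector_mult_def cdot_def vec_eq_iff sum_distrib_left mult_ac)
      then have "(C ** ?R) *v v = (\<i> * cdot (cvec w) v) *s (C *v cvec w)"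
        by (simp only: matrix_vector_mul_assoc[symmetric] vector_scalar_commute)
      then show ?thesis
        by (simp add: matrix_add_ldistrib matrix_vector_mult_add_rdistrib)
    qed
    \<comment> \<open>Pairing with y removes the old matrix and leaves i (w . v)(u . w) = 0.\<close>
    have ker: "cdot (cvec w) v = 0 \<and> ?N *v v = 0" if "(C ** (\<tau> + ?R) + D) *v v = 0" for v
    proof -
      have "cdot (?N *v v + (\<i> * cdot (cvec w) v) *s (C *v cvec w)) y
          = cdot (?N *v v) y + (\<i> * cdot (cvec w) v) * cdot (C *v cvec w) y"
        by (simp add: cdot_def sum.distrib distrib_right sum_distrib_left mult.assoc)
      moreover have "cdot (?N *v v) y = 0"
        unfolding cdot_matrix_left y(1) by (simp add: cdot_def)
      moreover have "cdot (C *v cvec w) y = cdot u (cvec w)"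
        unfolding cdot_matrix_left u_def[symmetric] by (rule cdot_commute)
      moreover have "cdot (?N *v v + (\<i> * cdot (cvec w) v) *s (C *v cvec w)) y = 0"
        using that unfolding R by (simp add: cdot_def)
      ultimately have "cdot (cvec w) v = 0" using w(1) by simp
      moreover from this have "?N *v v = 0"
        using that unfolding R by simp
      ultimately show ?thesis by simp
    qed
    have sub: "subspace (?ker \<sigma>)" for \<sigma>
      by (auto simp: subspace_def matrix_vector_right_distrib linear_cmul[OF matrix_vector_mul_linear])
    have "?ker (\<tau> + ?R) \<subset> ?ker \<tau>"
      using ker x w(2) by (auto simp: cdot_commute)
    then have "dim (?ker (\<tau> + ?R)) < dim (?ker \<tau>)"
      using sub by (intro dim_psubset) (simp add: span_eq_iff[THEN iffD2, OF sub])
    moreover have "\<tau> + ?R \<in> siegel_H" by (rule siegel_H_add_rank_one[OF \<tau>])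
    ultimately show False using min by force
  qed
  then show ?thesis using \<tau> by (auto simp: U_dom_def d)
qed


section \<open>The leaf topology\<close>

lemma lie_U_subspace: "subspace lie_U"
  unfolding subspace_def
proof (intro conjI ballI allI)
  show "0 \<in> lie_U" unfolding lie_U_def by (auto simp: block_zero[symmetric] block_eq_iff)
  show "X + Y \<in> lie_U" if "X \<in> lie_U" "Y \<in> lie_U" for X Y :: "'a cmat2"
    using that by (auto simp: lie_U_def block_add block_eq_iff transpose_add)
  show "c *\<^sub>R X \<in> lie_U" if X: "X \<in> lie_U" for c and X :: "'a cmat2"
  proof -
    obtain Z where Z: "X = block 0 Z 0 0" "transpose Z = Z" using X by (auto simp: lie_U_def)
    have "c *\<^sub>R X = block 0 (c *\<^sub>R Z) 0 0"
      by (simp add: Z(1) block_def vec_eq_iff split: sum.split)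
    moreover have "transpose (c *\<^sub>R Z) = c *\<^sub>R Z" by (simp add: transpose_scalar Z(2))
    ultimately show ?thesis by (auto simp: lie_U_def)
  qed
qed

lemma lie_U_complex_subspace: "complex_subspace lie_U"
  unfolding complex_subspace_def
proof (intro conjI lie_U_subspace allI ballI)
  fix c and X :: "'a cmat2" assume "X \<in> lie_U"
  then obtain Z where Z: "X = block 0 Z 0 0" "transpose Z = Z" by (auto simp: lie_U_def)
  have sym: "Z $ i $ j = Z $ j $ i" for i j
    using arg_cong[OF Z(2), of "\<lambda>Y. Y $ j $ i"] by (simp add: transpose_def)
  have "mat c ** X = block 0 (mat c ** Z) 0 0"
    unfolding Z(1) vec_eq_iff mat_mult_component
    by (auto simp: block_def mat_mult_component split: sum.split)
  moreover have "transpose (mat c ** Z) = mat c ** Z"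
    unfolding vec_eq_iff mat_mult_component by (simp add: transpose_def mat_mult_component sym)
  ultimately show "mat c ** X \<in> lie_U" by (auto simp: lie_U_def)
qed

lemma lie_U_mult_zero: "X \<in> lie_U \<Longrightarrow> Y \<in> lie_U \<Longrightarrow> X ** Y = 0"
  by (auto simp: lie_U_def block_mult block_zero)

text \<open>Products in \<open>lie_U\<close> vanish, so X |-> 1 + X is the exponential map and turns
  addition into multiplication. Moving along a coset is therefore a translation of
  \<open>lie_U\<close>.\<close>

lemma unipotent_mult:
  assumes "X \<in> lie_U" "Y \<in> lie_U"
  shows "(mat 1 + X) ** (mat 1 + Y) = mat 1 + (X + Y)"
  by (simp add: matrix_add_ldistrib matrix_add_rdistrib lie_U_mult_zero[OF assms] add_ac)

lemma unipotent_in_Sp_C: "X \<in> lie_U \<Longrightarrow> mat 1 + X \<in> Sp_C"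
  by (auto simp: lie_U_def mat_1_block block_add unipotent_Sp_C_iff)

lemma U_C_eq: "U_C = (\<lambda>X. mat 1 + X) ` lie_U"
proof -
  have "block (mat 1) Z 0 (mat 1) = mat 1 + block 0 Z 0 0" for Z
    by (simp add: mat_1_block block_add)
  then show ?thesis unfolding U_C_def lie_U_def by auto
qed

section \<open>Plaques and the topology they generate\<close>

definition plaque :: "('n::finite) cmat2 \<Rightarrow> 'n cmat2 \<Rightarrow> 'n cmat2 set" where
  "plaque M X = cls (M ** (mat 1 + X))"

definition plaque_dom :: "('n::finite) cmat2 \<Rightarrow> 'n cmat2 set" where
  "plaque_dom M = {X \<in> lie_U. M ** (mat 1 + X) \<in> bold_B}"

lemma plaque_zero: "plaque M 0 = cls M"
  by (simp add: plaque_def)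

lemma zero_in_plaque_dom: "M \<in> bold_B \<Longrightarrow> 0 \<in> plaque_dom M"
  by (simp add: plaque_dom_def subspace_0[OF lie_U_subspace])

lemma plaque_shift:
  assumes "X \<in> lie_U" "Y \<in> lie_U" shows "M ** (mat 1 + X) ** (mat 1 + Y) = M ** (mat 1 + (X + Y))"
  by (simp add: matrix_mul_assoc[symmetric] unipotent_mult[OF assms])

lemma plaque_in_Sp_C: "M \<in> Sp_C \<Longrightarrow> X \<in> lie_U \<Longrightarrow> M ** (mat 1 + X) \<in> Sp_C"
  by (intro Sp_C_mult unipotent_in_Sp_C)

lemma continuous_on_unipotent: "continuous_on S (\<lambda>X. M ** (mat 1 + X))" for M :: "('n::finite) cmat2"
  by (intro continuous_on_matrix_mult continuous_intros)

lemma plaque_dom_open: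
  assumes M: "M \<in> Sp_C" shows "openin (top_of_set lie_U) (plaque_dom M)"
  unfolding openin_euclidean_subtopology_iff
proof (intro conjI ballI)
  show "plaque_dom M \<subseteq> lie_U" by (auto simp: plaque_dom_def)
  fix X assume "X \<in> plaque_dom M"
  then have X: "X \<in> lie_U" "M ** (mat 1 + X) \<in> bold_B" by (auto simp: plaque_dom_def)
  from X(2) obtain e where e: "e > 0" "\<And>N. N \<in> Sp_C \<Longrightarrow> dist N (M ** (mat 1 + X)) < e \<Longrightarrow> N \<in> bold_B"
    by (rule bold_B_open) blast
  obtain d where d: "d > 0" "\<And>Y. dist Y X < d \<Longrightarrow> dist (M ** (mat 1 + Y)) (M ** (mat 1 + X)) < e"
    using continuous_on_unipotent[of UNIV M] e(1) unfolding continuous_on_iff by blast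
  have "Y \<in> plaque_dom M" if "Y \<in> lie_U" "dist Y X < d" for Y
    using e(2)[OF plaque_in_Sp_C[OF M that(1)] d(2)[OF that(2)]] that(1) by (simp add: plaque_dom_def)
  with d(1) show "\<exists>e>0. \<forall>Y\<in>lie_U. dist Y X < e \<longrightarrow> Y \<in> plaque_dom M" by blast
qed

text \<open>Only displacements along \<open>lie_U\<close> are tested, none transverse to the cosets,
  so whole coset images become open. Every representative M of a point is tested, with a radius that
  may depend on M.\<close>

definition leaf_open :: "('n::finite) cmat2 set set \<Rightarrow> bool" where
  "leaf_open S \<longleftrightarrow> S \<subseteq> B_pts \<and>
     (\<forall>M\<in>bold_B. cls M \<in> S \<longrightarrow> (\<exists>e>0. \<forall>X\<in>lie_U. norm X < e \<longrightarrow> plaque M X \<in> S))"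

definition leaf_topology :: "('n::finite) cmat2 set topology" where
  "leaf_topology = topology leaf_open"

lemma openin_leaf_topology: "openin leaf_topology = leaf_open"
  unfolding leaf_topology_def
proof (rule topology_inverse', unfold istopology_def, intro conjI allI impI)
  fix S T :: "'a cmat2 set set" assume ST: "leaf_open S" "leaf_open T"
  show "leaf_open (S \<inter> T)"
    unfolding leaf_open_def
  proof (intro conjI ballI impI)
    show "S \<inter> T \<subseteq> B_pts" using ST by (auto simp: leaf_open_def)
    fix M :: "'a cmat2" assume "M \<in> bold_B" "cls M \<in> S \<inter> T"
    then have "cls M \<in> S" "cls M \<in> T" by auto
    with \<open>M \<in> bold_B\<close> ST obtain d e where "d > 0" "\<forall>X\<in>lie_U. norm X < d \<longrightarrow> plaque M X \<in> S"
      and "e > 0" "\<forall>X\<in>lie_U. norm X < e \<longrightarrow> plaque M X \<in> T"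
      unfolding leaf_open_def by meson
    then show "\<exists>e>0. \<forall>X\<in>lie_U. norm X < e \<longrightarrow> plaque M X \<in> S \<inter> T"
      by (intro exI[of _ "min d e"]) auto
  qed
next
  fix K :: "'a cmat2 set set set" assume "\<forall>S\<in>K. leaf_open S"
  then show "leaf_open (\<Union>K)"
    unfolding leaf_open_def by (meson Sup_least Union_iff)
qed

text \<open>If N = \<gamma> M (1 + X) with integral \<gamma>, then
  \<open>plaque N Y = plaque M (X + Y)\<close>: charts at different representatives differ by a
  translation.\<close>

lemma plaque_image_open:
  assumes M: "M \<in> Sp_C" and V: "openin (top_of_set (plaque_dom M)) V"
  shows "openin leaf_topology (plaque M ` V)"
  unfolding openin_leaf_topology leaf_open_def
proof (intro conjI ballI impI)
  have VU: "V \<subseteq> plaque_dom M" using openin_imp_subset[OF V] .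
  then show "plaque M ` V \<subseteq> B_pts"
    by (auto simp: plaque_def plaque_dom_def cls_in_B_pts_iff)
  fix N assume N: "N \<in> bold_B" "cls N \<in> plaque M ` V"
  then obtain X where X: "X \<in> V" "cls N = cls (M ** (mat 1 + X))" by (auto simp: plaque_def)
  from X(2) obtain \<gamma> where \<gamma>: "\<gamma> \<in> Sp_Z" "N = \<gamma> ** (M ** (mat 1 + X))" by (rule cls_eqD)
  have Xl: "X \<in> lie_U" using X(1) VU by (auto simp: plaque_dom_def)
  have "openin (top_of_set lie_U) V"
    using V plaque_dom_open[OF M] by (rule openin_trans)
  then obtain e where e: "e > 0" "\<And>Y. Y \<in> lie_U \<Longrightarrow> dist Y X < e \<Longrightarrow> Y \<in> V"
    using X(1) unfolding openin_euclidean_subtopology_iff by blast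
  have "plaque N Y \<in> plaque M ` V" if Y: "Y \<in> lie_U" "norm Y < e" for Y
  proof -
    have "N ** (mat 1 + Y) = \<gamma> ** (M ** (mat 1 + (X + Y)))"
      unfolding \<gamma>(2) plaque_shift[OF Xl Y(1), symmetric] by (simp only: matrix_mul_assoc)
    then have "plaque N Y = plaque M (X + Y)"
      by (simp add: plaque_def cls_mult_Sp_Z[OF \<gamma>(1)])
    moreover have "X + Y \<in> V"
      using e(2)[of "X + Y"] Y subspace_add[OF lie_U_subspace Xl Y(1)] by (simp add: dist_norm)
    ultimately show ?thesis by blast
  qed
  with e(1) show "\<exists>e>0. \<forall>Y\<in>lie_U. norm Y < e \<longrightarrow> plaque N Y \<in> plaque M ` V" by blast
qed

lemma leaf_open_B_pts: "leaf_open B_pts"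
  unfolding leaf_open_def
proof (intro conjI ballI impI)
  fix M :: "'a cmat2" assume M: "M \<in> bold_B" "cls M \<in> B_pts"
  have "M \<in> Sp_C" using M bold_B_subset by blast
  from plaque_dom_open[OF this] zero_in_plaque_dom[OF M(1)]
  obtain e where "e > 0" "\<And>X. X \<in> lie_U \<Longrightarrow> dist X 0 < e \<Longrightarrow> X \<in> plaque_dom M"
    unfolding openin_euclidean_subtopology_iff by blast
  then show "\<exists>e>0. \<forall>X\<in>lie_U. norm X < e \<longrightarrow> plaque M X \<in> B_pts"
    by (intro exI[of _ e]) (auto simp: plaque_dom_def plaque_def cls_in_B_pts_iff)
qed simp

lemma topspace_leaf_topology: "topspace leaf_topology = B_pts"
proof
  show "topspace leaf_topology \<subseteq> B_pts"
    unfolding topspace_def openin_leaf_topology leaf_open_def by blast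
  show "B_pts \<subseteq> topspace leaf_topology"
    by (rule openin_subset) (simp add: openin_leaf_topology leaf_open_B_pts)
qed

lemma continuous_map_plaque:
  assumes M: "M \<in> Sp_C" shows "continuous_map (top_of_set (plaque_dom M)) leaf_topology (plaque M)"
  unfolding continuous_map_def topspace_leaf_topology
proof (intro conjI allI impI)
  show "plaque M \<in> topspace (top_of_set (plaque_dom M)) \<rightarrow> B_pts"
    by (auto simp: plaque_def plaque_dom_def cls_in_B_pts_iff)
  fix S :: "'a cmat2 set set" assume "openin leaf_topology S"
  then have S: "leaf_open S" by (simp add: openin_leaf_topology)
  show "openin (top_of_set (plaque_dom M)) {X \<in> topspace (top_of_set (plaque_dom M)). plaque M X \<in> S}"
    unfolding openin_euclidean_subtopology_iff
  proof (intro conjI ballI)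
    fix X assume "X \<in> {X \<in> topspace (top_of_set (plaque_dom M)). plaque M X \<in> S}"
    then have X: "X \<in> plaque_dom M" "X \<in> lie_U" "M ** (mat 1 + X) \<in> bold_B" "cls (M ** (mat 1 + X)) \<in> S"
      by (auto simp: plaque_def plaque_dom_def)
    from S X(3,4) obtain e where e: "e > 0" "\<And>Y. Y \<in> lie_U \<Longrightarrow> norm Y < e \<Longrightarrow> plaque (M ** (mat 1 + X)) Y \<in> S"
      unfolding leaf_open_def by blast
    have "plaque M Y \<in> S" if Y: "Y \<in> plaque_dom M" "dist Y X < e" for Y
    proof -
      have d: "Y - X \<in> lie_U"
        using Y(1) X(2) subspace_diff[OF lie_U_subspace] by (auto simp: plaque_dom_def)
      have "plaque (M ** (mat 1 + X)) (Y - X) = plaque M Y"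
        unfolding plaque_def plaque_shift[OF X(2) d] by simp
      then show ?thesis using e(2)[OF d] Y(2) by (simp add: dist_norm)
    qed
    with e(1) show "\<exists>e>0. \<forall>Y\<in>plaque_dom M. dist Y X < e \<longrightarrow> Y \<in> {X \<in> topspace (top_of_set (plaque_dom M)). plaque M X \<in> S}"
      by auto
  qed auto
qed

text \<open>G is taken out so that the complement is a neighbourhood of G even when G is itself
  integral.\<close>

lemma closed_integer_matrices: "closed ({\<gamma> :: ('n::finite) cmat2. \<forall>i j. \<gamma> $ i $ j \<in> \<int>} - {G})"
proof (rule discrete_imp_closed[of 1])
  show "\<forall>x\<in>{\<gamma> :: 'n cmat2. \<forall>i j. \<gamma> $ i $ j \<in> \<int>} - {G}. \<forall>y\<in>{\<gamma>. \<forall>i j. \<gamma> $ i $ j \<in> \<int>} - {G}.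
      dist y x < 1 \<longrightarrow> y = x"
  proof (intro ballI impI)
    fix x y :: "'n cmat2"
    assume xy: "x \<in> {\<gamma>. \<forall>i j. \<gamma> $ i $ j \<in> \<int>} - {G}" "y \<in> {\<gamma>. \<forall>i j. \<gamma> $ i $ j \<in> \<int>} - {G}" "dist y x < 1"
    have "y $ i $ j = x $ i $ j" for i j
    proof -
      have "norm ((y - x) $ i $ j) \<le> norm ((y - x) $ i)" by (rule Finite_Cartesian_Product.norm_nth_le)
      also have "\<dots> \<le> norm (y - x)" by (rule Finite_Cartesian_Product.norm_nth_le)
      finally have "norm (y $ i $ j - x $ i $ j) < 1" using xy(3) by (simp add: dist_norm)
      moreover obtain m where m: "y $ i $ j - x $ i $ j = of_int m"
        using xy by (metis (mono_tags, lifting) DiffD1 Ints_cases Ints_diff mem_Collect_eq)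
      ultimately have "m = 0" by simp
      then show ?thesis using m by simp
    qed
    then show "y = x" by (simp add: vec_eq_iff)
  qed
qed simp

text \<open>
  If \<open>\<gamma> M (1 + X) = N (1 + Y)\<close> with \<open>X\<close>, \<open>Y\<close> small, then the integral matrix \<open>\<gamma>\<close> is close to
  \<open>N M\<^sup>-\<^sup>1\<close>, hence equal to it. This gives both the separation of points and the injectivity of small
  plaques.
\<close>

lemma plaques_separated:
  fixes M N :: "('n::finite) cmat2"
  assumes M: "M \<in> Sp_C" and N: "N \<in> Sp_C"
  obtains e where "e > 0"
    "\<And>X Y. X \<in> lie_U \<Longrightarrow> Y \<in> lie_U \<Longrightarrow> norm X < e \<Longrightarrow> norm Y < e \<Longrightarrow>
       plaque M X = plaque N Y \<Longrightarrow> cls M = cls N \<and> X = Y"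
proof -
  let ?G = "N ** sp_inv M"
  have "open (- ({\<gamma> :: 'n cmat2. \<forall>i j. \<gamma> $ i $ j \<in> \<int>} - {?G}))"
    using closed_integer_matrices by (rule open_Compl)
  then obtain d where d: "d > 0" "\<And>\<gamma>. dist \<gamma> ?G < d \<Longrightarrow> \<gamma> \<in> - ({\<gamma>. \<forall>i j. \<gamma> $ i $ j \<in> \<int>} - {?G})"
    unfolding open_dist by blast
  have "continuous_on UNIV (\<lambda>Z. N ** (mat 1 + Z) ** sp_inv M)"
    by (intro continuous_on_matrix_mult continuous_intros)
  then obtain e where e: "e > 0" "\<And>Z. dist Z 0 < e \<Longrightarrow> dist (N ** (mat 1 + Z) ** sp_inv M) (N ** (mat 1 + 0) ** sp_inv M) < d"
    using d(1) unfolding continuous_on_iff by blast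
  \<comment> \<open>Halving the radius is needed since \<gamma> = N (1 + (Y - X)) M^-1 depends on
    the difference of X and Y.\<close>
  show thesis
  proof (rule that[of "e / 2"])
    show "e / 2 > 0" using e by simp
    fix X Y :: "'n cmat2"
    assume X: "X \<in> lie_U" and Y: "Y \<in> lie_U" and n: "norm X < e / 2" "norm Y < e / 2"
      and eq: "plaque M X = plaque N Y"
    from eq have "cls (N ** (mat 1 + Y)) = cls (M ** (mat 1 + X))" by (simp add: plaque_def)
    then obtain \<gamma> where \<gamma>: "\<gamma> \<in> Sp_Z" "N ** (mat 1 + Y) = \<gamma> ** (M ** (mat 1 + X))" by (rule cls_eqD)
    have negX: "- X \<in> lie_U" using subspace_neg[OF lie_U_subspace X] .
    have "N ** (mat 1 + (Y + - X)) = N ** (mat 1 + Y) ** (mat 1 + - X)"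
      by (rule plaque_shift[OF Y negX, symmetric])
    also have "\<dots> = \<gamma> ** (M ** (mat 1 + X) ** (mat 1 + - X))"
      by (simp only: \<gamma>(2) matrix_mul_assoc)
    also have "\<dots> = \<gamma> ** M"
      by (simp only: plaque_shift[OF X negX]) simp
    finally have "N ** (mat 1 + (Y - X)) = \<gamma> ** M" by simp
    then have "N ** (mat 1 + (Y - X)) ** sp_inv M = \<gamma> ** (M ** sp_inv M)"
      by (simp only: matrix_mul_assoc)
    then have g: "\<gamma> = N ** (mat 1 + (Y - X)) ** sp_inv M"
      by (simp add: sp_inv_right[OF M])
    have "dist (Y - X) 0 < e"
      using n norm_triangle_ineq4[of Y X] by simp
    from e(2)[OF this] have "dist \<gamma> ?G < d" by (simp add: g)
    from d(2)[OF this] \<gamma>(1) have "\<gamma> = ?G" by (auto simp: Sp_Z_def)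
    then have NM: "\<gamma> ** M = N"
      by (simp only: matrix_mul_assoc[symmetric] sp_inv_left[OF M] matrix_mul_rid)
    then have "N ** (mat 1 + Y) = N ** (mat 1 + X)"
      using \<gamma>(2) by (simp only: matrix_mul_assoc)
    then have "sp_inv N ** (N ** (mat 1 + Y)) = sp_inv N ** (N ** (mat 1 + X))" by simp
    then have "mat 1 + Y = mat 1 + X"
      by (simp only: matrix_mul_assoc sp_inv_left[OF N] matrix_mul_lid)
    then show "cls M = cls N \<and> X = Y"
      using cls_mult_Sp_Z[OF \<gamma>(1), of M] NM by simp
  qed
qed

lemma openin_plaque_ball:
  "openin (top_of_set (plaque_dom M)) (plaque_dom M \<inter> ball 0 e)"
  by (simp add: openin_open_Int)

lemma Hausdorff_leaf_topology: "Hausdorff_space leaf_topology"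
  unfolding Hausdorff_space_def topspace_leaf_topology
proof (intro allI impI)
  fix x y :: "'a cmat2 set" assume "x \<in> B_pts \<and> y \<in> B_pts \<and> x \<noteq> y"
  then obtain M N where MN: "M \<in> bold_B" "N \<in> bold_B" "x = cls M" "y = cls N" "cls M \<noteq> cls N"
    by (auto simp: B_pts_def)
  then have Sp: "M \<in> Sp_C" "N \<in> Sp_C" using bold_B_subset by auto
  from Sp obtain e where e: "e > 0" "\<And>X Y. X \<in> lie_U \<Longrightarrow> Y \<in> lie_U \<Longrightarrow> norm X < e \<Longrightarrow> norm Y < e \<Longrightarrow>
       plaque M X = plaque N Y \<Longrightarrow> cls M = cls N \<and> X = Y"
    by (rule plaques_separated) blast
  let ?U = "\<lambda>K. plaque K ` (plaque_dom K \<inter> ball 0 e)"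
  have "openin leaf_topology (?U M)" "openin leaf_topology (?U N)"
    by (intro plaque_image_open openin_plaque_ball Sp)+
  moreover have "x \<in> ?U M" "y \<in> ?U N"
    using MN zero_in_plaque_dom e(1) plaque_zero by (auto intro!: image_eqI[of _ _ 0])
  moreover have "disjnt (?U M) (?U N)"
    using e(2) MN(5) by (force simp: disjnt_def plaque_dom_def)
  ultimately show "\<exists>U V. openin leaf_topology U \<and> openin leaf_topology V \<and> x \<in> U \<and> y \<in> V \<and> disjnt U V"
    by blast
qed

section \<open>The coset images as integral manifolds\<close>

text \<open>M ranges over \<open>Sp_C\<close> and may lie outside \<open>bold_B\<close>, as
  \<delta>^-1 does for a general \<delta>; the point \<open>cls M\<close> need not belong to the set
  then.\<close>

definition leaf_through :: "('n::finite) cmat2 \<Rightarrow> 'n cmat2 set set" where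
  "leaf_through M = plaque M ` plaque_dom M"

lemma openin_leaf_through: "M \<in> Sp_C \<Longrightarrow> openin leaf_topology (leaf_through M)"
  unfolding leaf_through_def by (rule plaque_image_open) auto

lemma leaf_through_subset: "leaf_through M \<subseteq> B_pts"
  by (auto simp: leaf_through_def plaque_def plaque_dom_def cls_in_B_pts_iff)

lemma cls_in_leaf_through: "M \<in> bold_B \<Longrightarrow> cls M \<in> leaf_through M"
  unfolding leaf_through_def using zero_in_plaque_dom plaque_zero by (metis image_eqI)

text \<open>A common point gives N (1 + Y) = \<gamma> M (1 + X), so the whole coset of N is the
  \<gamma>-translate of that of M. Exchanging M and N shows that two such sets are equal or
  disjoint.\<close>

lemma leaf_through_meet_subset:
  assumes "x \<in> leaf_through M" "x \<in> leaf_through N" shows "leaf_through N \<subseteq> leaf_through M"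
proof
  obtain X Y where X: "X \<in> lie_U" "x = cls (M ** (mat 1 + X))" and Y: "Y \<in> lie_U" "x = cls (N ** (mat 1 + Y))"
    using assms by (auto simp: leaf_through_def plaque_dom_def plaque_def)
  then have "cls (N ** (mat 1 + Y)) = cls (M ** (mat 1 + X))" by simp
  then obtain \<gamma> where \<gamma>: "\<gamma> \<in> Sp_Z" "N ** (mat 1 + Y) = \<gamma> ** (M ** (mat 1 + X))" by (rule cls_eqD)
  fix z assume "z \<in> leaf_through N"
  then obtain W where W: "W \<in> lie_U" "N ** (mat 1 + W) \<in> bold_B" "z = cls (N ** (mat 1 + W))"
    by (auto simp: leaf_through_def plaque_dom_def plaque_def)
  have WY: "W - Y \<in> lie_U" by (rule subspace_diff[OF lie_U_subspace W(1) Y(1)])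
  have XWY: "X + (W - Y) \<in> lie_U" by (rule subspace_add[OF lie_U_subspace X(1) WY])
  have "N ** (mat 1 + W) = N ** (mat 1 + Y) ** (mat 1 + (W - Y))"
    unfolding plaque_shift[OF Y(1) WY] by simp
  also have "\<dots> = \<gamma> ** (M ** (mat 1 + X) ** (mat 1 + (W - Y)))"
    by (simp only: \<gamma>(2) matrix_mul_assoc)
  finally have eq: "N ** (mat 1 + W) = \<gamma> ** (M ** (mat 1 + (X + (W - Y))))"
    by (simp only: plaque_shift[OF X(1) WY])
  then have z: "z = plaque M (X + (W - Y))"
    by (simp add: W(3) plaque_def cls_mult_Sp_Z[OF \<gamma>(1)])
  moreover have "X + (W - Y) \<in> plaque_dom M"
    using W(2) XWY z by (simp add: W(3) plaque_dom_def plaque_def flip: cls_in_B_pts_iff)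
  ultimately show "z \<in> leaf_through M" by (auto simp: leaf_through_def)
qed

text \<open>The sets \<open>leaf_through N\<close> are open and partition \<open>B_pts\<close>, so
  the complement of each one is a union of others and open too.\<close>

lemma connectedin_subset_leaf_through:
  assumes S: "connectedin leaf_topology S" and M: "M \<in> Sp_C" and meet: "S \<inter> leaf_through M \<noteq> {}"
  shows "S \<subseteq> leaf_through M"
proof (rule ccontr)
  assume neg: "\<not> S \<subseteq> leaf_through M"
  let ?V = "\<Union>{leaf_through N | N. N \<in> bold_B \<and> leaf_through N \<inter> leaf_through M = {}}"
  have SB: "S \<subseteq> B_pts" using connectedin_subset_topspace[OF S] by (simp add: topspace_leaf_topology)
  have cover: "x \<in> ?V" if "x \<in> S" "x \<notin> leaf_through M" for x
  proof -
    from that SB obtain N where N: "N \<in> bold_B" "x = cls N" by (auto simp: B_pts_def)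
    then have x: "x \<in> leaf_through N" using cls_in_leaf_through by blast
    have "leaf_through N \<inter> leaf_through M = {}"
    proof (rule ccontr)
      assume "leaf_through N \<inter> leaf_through M \<noteq> {}"
      then have "leaf_through N \<subseteq> leaf_through M" using leaf_through_meet_subset by blast
      with x that(2) show False by blast
    qed
    with N(1) x show ?thesis by blast
  qed
  have 1: "openin leaf_topology ?V"
    using openin_leaf_through bold_B_subset by (intro openin_Union) blast
  have 2: "S \<subseteq> leaf_through M \<union> ?V" using cover by blast
  have 3: "leaf_through M \<inter> ?V \<inter> S = {}" by blast
  have 4: "leaf_through M \<inter> S \<noteq> {}" using meet by blast
  have 5: "?V \<inter> S \<noteq> {}" using neg cover by blast
  show False by (rule connectedinD[OF S openin_leaf_through[OF M] 1 2 3 4 5])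
qed

lemma mat_commute: "A ** mat c = mat c ** A" for A :: "complex^'n^'n"
proof -
  have "(A ** mat c) $ i $ j = (\<Sum>k\<in>UNIV. if k = j then c * A $ i $ k else 0)" for i j
    unfolding matrix_matrix_mult_def vec_lambda_beta by (intro sum.cong) (auto simp: mat_def)
  then show ?thesis by (simp add: vec_eq_iff mat_mult_component)
qed

lemma integral_immersion_plaque:
  assumes U: "openin (top_of_set lie_U) U" and UN: "U \<subseteq> plaque_dom N" and N: "N \<in> Sp_C"
  shows "integral_immersion lie_U U (\<lambda>X. N ** (mat 1 + X))"
  unfolding integral_immersion_def
proof (intro conjI ballI lie_U_complex_subspace U)
  show "(\<lambda>X. N ** (mat 1 + X)) ` U \<subseteq> bold_B" using UN by (auto simp: plaque_dom_def)
  fix t assume t: "t \<in> U"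
  then have tl: "t \<in> lie_U" and tB: "N ** (mat 1 + t) \<in> bold_B"
    using UN by (auto simp: plaque_dom_def)
  have "((\<lambda>X. N ** X) has_derivative (\<lambda>X. N ** X)) (at t within U)"
    by (rule bounded_linear_imp_has_derivative)
      (use linear_matrix_mult_left in \<open>simp add: linear_conv_bounded_linear\<close>)
  then have "((\<lambda>X. N + N ** X) has_derivative (\<lambda>X. N ** X)) (at t within U)"
    by (auto intro!: derivative_eq_intros)
  then have der: "((\<lambda>X. N ** (mat 1 + X)) has_derivative (\<lambda>X. N ** X)) (at t within U)"
    by (simp add: matrix_add_ldistrib)
  have inj: "inj_on (\<lambda>X. N ** X) lie_U"
  proof (rule inj_onI)
    fix X Y assume "N ** X = N ** Y"
    then have "sp_inv N ** (N ** X) = sp_inv N ** (N ** Y)" by simp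
    then show "X = Y" by (simp only: matrix_mul_assoc sp_inv_left[OF N] matrix_mul_lid)
  qed
  \<comment> \<open>The derivative X |-> N X does not depend on t, and its image is still the fibre
    at N (1 + t) because t X = 0.\<close>
  have "N ** (mat 1 + t) ** X = N ** X" if "X \<in> lie_U" for X
    unfolding matrix_mul_assoc[symmetric]
    by (simp add: matrix_add_rdistrib lie_U_mult_zero[OF tl that])
  then have "(\<lambda>X. N ** X) ` lie_U = ramanujan_dist (N ** (mat 1 + t))"
    unfolding ramanujan_dist_eq[OF tB] by (intro image_cong) auto
  moreover have "N ** (mat c ** X) = mat c ** (N ** X)" for c X
    by (metis mat_commute matrix_mul_assoc)
  ultimately show "\<exists>D. ((\<lambda>X. N ** (mat 1 + X)) has_derivative D) (at t within U) \<and>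
      (\<forall>c. \<forall>X\<in>lie_U. D (mat c ** X) = mat c ** D X) \<and> inj_on D lie_U \<and>
      D ` lie_U = ramanujan_dist (N ** (mat 1 + t))"
    using der inj by blast
qed

lemma second_countable_top_of_set: "second_countable (top_of_set (S :: 'a::second_countable_topology set))"
proof (rule second_countable_subtopology)
  show "second_countable (euclidean :: 'a topology)"
    unfolding second_countable_def
  proof -
    obtain \<B> :: "'a set set" where "countable \<B>" "\<And>C. C \<in> \<B> \<Longrightarrow> open C"
      "\<And>S. open S \<Longrightarrow> \<exists>U. U \<subseteq> \<B> \<and> S = \<Union>U"
      by (metis univ_second_countable)
    then show "\<exists>\<B>. countable \<B> \<and> (\<forall>V\<in>\<B>. openin euclidean V) \<and>
        (\<forall>U (x::'a). openin euclidean U \<and> x \<in> U \<longrightarrow> (\<exists>V\<in>\<B>. x \<in> V \<and> V \<subseteq> U))"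
      by (intro exI[of _ \<B>]) (metis UnionE Union_upper open_openin subset_iff)
  qed
qed

text \<open>The whole set is the open continuous image of one subset of \<open>lie_U\<close>, hence
  second countable. That map can fail to be injective, so the charts are small balls around a
  representative N of each point, with \<open>plaques_separated\<close> applied to the pair N,
  N.\<close>

lemma leaf_through_integral_manifold:
  fixes M :: "('n::finite) cmat2"
  assumes M: "M \<in> Sp_C"
  shows "integral_manifold (subtopology leaf_topology (leaf_through M))"
  unfolding integral_manifold_def
proof (intro conjI ballI)
  let ?T = "subtopology leaf_topology (leaf_through M)"
  have ts: "topspace ?T = leaf_through M"
    using leaf_through_subset by (auto simp: topspace_leaf_topology)
  show "topspace ?T \<subseteq> B_pts" unfolding ts by (rule leaf_through_subset)
  show "Hausdorff_space ?T" by (intro Hausdorff_space_subtopology Hausdorff_leaf_topology)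
  show "second_countable ?T"
  proof (rule second_countable_open_map_image[of "top_of_set (plaque_dom M)" ?T "plaque M"])
    show "continuous_map (top_of_set (plaque_dom M)) ?T (plaque M)"
      using continuous_map_plaque[OF M]
      by (auto simp: continuous_map_in_subtopology leaf_through_def)
    show "open_map (top_of_set (plaque_dom M)) ?T (plaque M)"
      unfolding open_map_def openin_open_subtopology[OF openin_leaf_through[OF M]]
      using plaque_image_open[OF M] openin_imp_subset by (fastforce simp: leaf_through_def)
    show "plaque M ` topspace (top_of_set (plaque_dom M)) = topspace ?T"
      unfolding ts by (simp add: leaf_through_def)
  qed (rule second_countable_top_of_set)
  fix x assume "x \<in> topspace ?T"
  then have x: "x \<in> leaf_through M" unfolding ts .
  then obtain N where N: "N \<in> bold_B" "x = cls N"
    using leaf_through_subset by (auto simp: B_pts_def)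
  have Sp: "N \<in> Sp_C" using N(1) bold_B_subset by blast
  have NM: "leaf_through N \<subseteq> leaf_through M"
    using leaf_through_meet_subset[OF x] cls_in_leaf_through[OF N(1)] N(2) by blast
  obtain e where e: "e > 0" "\<And>X Y. X \<in> lie_U \<Longrightarrow> Y \<in> lie_U \<Longrightarrow> norm X < e \<Longrightarrow> norm Y < e \<Longrightarrow>
       plaque N X = plaque N Y \<Longrightarrow> cls N = cls N \<and> X = Y"
    by (rule plaques_separated[OF Sp Sp]) blast
  let ?U = "plaque_dom N \<inter> ball 0 e" and ?F = "\<lambda>X. N ** (mat 1 + X)"
  let ?W = "plaque N ` ?U"
  have W: "openin leaf_topology ?W" "?W \<subseteq> leaf_through M"
    using plaque_image_open[OF Sp openin_plaque_ball] NM by (auto simp: leaf_through_def)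
  have U: "openin (top_of_set lie_U) ?U"
    using openin_plaque_ball plaque_dom_open[OF Sp] by (rule openin_trans)
  have sub: "subtopology ?T ?W = subtopology leaf_topology ?W"
    using W(2) by (simp add: subtopology_subtopology Int_absorb1)
  have "homeomorphic_map (top_of_set ?U) (subtopology leaf_topology ?W) (plaque N)"
  proof (rule bijective_open_imp_homeomorphic_map)
    show "continuous_map (top_of_set ?U) (subtopology leaf_topology ?W) (plaque N)"
      using continuous_map_from_subtopology_mono[OF continuous_map_plaque[OF Sp], of ?U]
      by (auto simp: continuous_map_in_subtopology)
    show "open_map (top_of_set ?U) (subtopology leaf_topology ?W) (plaque N)"
      unfolding open_map_def openin_open_subtopology[OF W(1)]
    proof (intro allI impI conjI)
      fix V assume V: "openin (top_of_set ?U) V"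
      then show "openin leaf_topology (plaque N ` V)"
        by (intro plaque_image_open[OF Sp] openin_trans[OF V openin_plaque_ball])
      show "plaque N ` V \<subseteq> ?W" using openin_imp_subset[OF V] by (rule image_mono)
    qed
    show "plaque N ` topspace (top_of_set ?U) = topspace (subtopology leaf_topology ?W)"
      using openin_subset[OF W(1)] by auto
    show "inj_on (plaque N) (topspace (top_of_set ?U))"
      by (rule inj_onI) (use e(2) in \<open>simp add: plaque_dom_def\<close>)
  qed
  moreover have "cls \<circ> ?F = plaque N" by (auto simp: plaque_def)
  ultimately have "homeomorphic_map (top_of_set ?U) (subtopology ?T ?W) (cls \<circ> ?F)"
    unfolding sub by simp
  moreover have "integral_immersion lie_U ?U ?F"
    by (rule integral_immersion_plaque[OF U _ Sp]) auto
  moreover have "openin ?T ?W"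
    using W by (simp add: openin_open_subtopology openin_leaf_through[OF M])
  moreover have "x \<in> ?W"
    using N zero_in_plaque_dom e(1) plaque_zero by (auto intro!: image_eqI[of _ _ 0])
  ultimately show "\<exists>P U F W. integral_immersion P U F \<and> openin ?T W \<and> x \<in> W \<and>
      homeomorphic_map (top_of_set U) (subtopology ?T W) (cls \<circ> F)"
    by blast
qed


section \<open>Leaves\<close>

text \<open>The derivative of an immersion is controlled on P only, whereas constancy requires the
  zero map. Difference quotients inside P see nothing else of D, so D may be replaced by
  zero.\<close>

lemma has_derivative_zero_on_subspace:
  assumes f: "(f has_derivative D) (at t within C)" and C: "C \<subseteq> P" "t \<in> P" and P: "subspace P"
    and D: "\<And>X. X \<in> P \<Longrightarrow> D X = 0"
  shows "(f has_derivative (\<lambda>_. 0)) (at t within C)"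
proof -
  have "((\<lambda>y. (1 / norm (y - t)) *\<^sub>R (f y - (f t + D (y - t)))) \<longlongrightarrow> 0) (at t within C)"
    using f by (simp add: has_derivative_within)
  moreover have "\<forall>\<^sub>F y in at t within C. (1 / norm (y - t)) *\<^sub>R (f y - (f t + D (y - t)))
      = (1 / norm (y - t)) *\<^sub>R (f y - (f t + 0))"
    unfolding eventually_at_filter using C D subspace_diff[OF P] by (intro always_eventually) auto
  ultimately have "((\<lambda>y. (1 / norm (y - t)) *\<^sub>R (f y - (f t + 0))) \<longlongrightarrow> 0) (at t within C)"
    by (rule Lim_transform_eventually)
  then show ?thesis by (simp add: has_derivative_within)
qed

text \<open>
  Along an integral immersion the first block column is constant, hence the immersion stays in one
  coset \<open>M U_C\<close> locally.
\<close>

lemma integral_immersion_local: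
  fixes F :: "('n::finite) cmat2 \<Rightarrow> 'n cmat2"
  assumes im: "integral_immersion P U F" and t0: "t\<^sub>0 \<in> U" and e: "e > 0"
  obtains r where "r > 0"
    "\<And>t. t \<in> U \<Longrightarrow> dist t t\<^sub>0 < r \<Longrightarrow> \<exists>X\<in>lie_U. norm X < e \<and> F t = F t\<^sub>0 ** (mat 1 + X)"
proof -
  have P: "subspace P" and U: "openin (top_of_set P) U" and FB: "F ` U \<subseteq> bold_B"
    using im by (auto simp: integral_immersion_def complex_subspace_def)
  have UP: "U \<subseteq> P" using openin_imp_subset[OF U] .
  have M: "F t\<^sub>0 \<in> bold_B" using FB t0 by blast
  then have Sp: "F t\<^sub>0 \<in> Sp_C" using bold_B_subset by blast
  obtain r1 where r1: "r1 > 0" "\<And>t. t \<in> P \<Longrightarrow> dist t t\<^sub>0 < r1 \<Longrightarrow> t \<in> U"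
    using U t0 unfolding openin_euclidean_subtopology_iff by blast
  \<comment> \<open>A ball of P around the base point: its convexity lets a vanishing derivative
    imply constancy.\<close>
  define C where "C = ball t\<^sub>0 r1 \<inter> P"
  have CU: "C \<subseteq> U" using r1(2) by (auto simp: C_def dist_commute)
  have convex: "convex C"
    unfolding C_def by (intro convex_Int convex_ball subspace_imp_convex P)
  have t0C: "t\<^sub>0 \<in> C" using t0 UP r1(1) by (auto simp: C_def)
  have col: "F t $ a $ Inl j = F t\<^sub>0 $ a $ Inl j" if "t \<in> C" for t a j
  proof -
    have "((\<lambda>s. F s $ a $ Inl j) has_derivative (\<lambda>_. 0)) (at s within C)" if s: "s \<in> C" for s
    proof -
      have sU: "s \<in> U" using s CU by blast
      then obtain D where D: "(F has_derivative D) (at s within U)" "D ` P = ramanujan_dist (F s)"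
        using im by (auto simp: integral_immersion_def)
      have "bounded_linear (\<lambda>N :: 'n cmat2. N $ a $ Inl j)"
        unfolding linear_conv_bounded_linear[symmetric] by (rule linearI) simp_all
      from bounded_linear.has_derivative[OF this has_derivative_subset[OF D(1) CU]]
      have der: "((\<lambda>s. F s $ a $ Inl j) has_derivative (\<lambda>X. D X $ a $ Inl j)) (at s within C)" .
      have "D X $ a $ Inl j = 0" if "X \<in> P" for X
      proof -
        have DX: "D X \<in> ramanujan_dist (F s)" using D(2) that by blast
        have "F s \<in> bold_B" using FB sU by blast
        from gauss_manin_eta_iff[OF this] DX show ?thesis by (auto simp: ramanujan_dist_def)
      qed
      with der show ?thesis
        using CU UP s P by (intro has_derivative_zero_on_subspace[of _ "\<lambda>X. D X $ a $ Inl j"]) auto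
    qed
    from has_derivative_zero_constant[OF convex this] t0C that show ?thesis by metis
  qed
  \<comment> \<open>The displacement of F t from the base point inside its coset. Equal first block
    columns make the first block column of the quotient that of the identity, and the symplectic
    relation then puts the displacement in \<open>lie_U\<close>.\<close>
  let ?X = "\<lambda>t. sp_inv (F t\<^sub>0) ** F t - mat 1"
  have X: "?X t \<in> lie_U" if t: "t \<in> C" for t
  proof -
    have "F t \<in> Sp_C" using t CU FB bold_B_subset by blast
    then have GSp: "sp_inv (F t\<^sub>0) ** F t \<in> Sp_C" by (intro Sp_C_mult sp_inv_Sp_C Sp)
    have "(sp_inv (F t\<^sub>0) ** F t) $ a $ Inl j = (sp_inv (F t\<^sub>0) ** F t\<^sub>0) $ a $ Inl j" for a j
      by (simp add: matrix_matrix_mult_def col[OF t])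
    then have c: "(sp_inv (F t\<^sub>0) ** F t) $ a $ Inl j = mat 1 $ a $ Inl j" for a j
      by (simp only: sp_inv_left[OF Sp])
    obtain A Z B Y where G: "sp_inv (F t\<^sub>0) ** F t = block A Z B Y" by (rule block_cases)
    have "A = mat 1" "B = 0"
      using c[of "Inl _"] c[of "Inr _"] unfolding G by (simp_all add: block_def mat_def vec_eq_iff)
    then have "Y = mat 1" "transpose Z = Z" and G': "sp_inv (F t\<^sub>0) ** F t = block (mat 1) Z 0 (mat 1)"
      using GSp unfolding G by (simp_all add: unipotent_Sp_C_iff)
    have "?X t = block 0 Z 0 0"
      unfolding G' by (simp add: mat_1_block diff_conv_add_uminus block_minus block_add del: add_uminus_conv_diff)
    then show ?thesis using \<open>transpose Z = Z\<close> by (auto simp: lie_U_def)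
  qed
  have "\<exists>D. (F has_derivative D) (at t\<^sub>0 within U)" using im t0 by (auto simp: integral_immersion_def)
  then have "continuous (at t\<^sub>0 within U) F" using has_derivative_continuous by blast
  moreover have "isCont (\<lambda>N. sp_inv (F t\<^sub>0) ** N - mat 1) (F t\<^sub>0)"
    by (intro continuous_intros linear_continuous_at)
      (use linear_matrix_mult_left in \<open>simp add: linear_conv_bounded_linear\<close>)
  ultimately have "continuous (at t\<^sub>0 within U) ?X"
    by (rule continuous_within_compose3[rotated])
  then obtain r2 where r2: "r2 > 0" "\<And>t. t \<in> U \<Longrightarrow> dist t t\<^sub>0 < r2 \<Longrightarrow> dist (?X t) (?X t\<^sub>0) < e"
    using e unfolding continuous_within_eps_delta by blast
  have X0: "?X t\<^sub>0 = 0" by (simp add: sp_inv_left[OF Sp])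
  show thesis
  proof (rule that[of "min r1 r2"])
    fix t assume t: "t \<in> U" "dist t t\<^sub>0 < min r1 r2"
    then have "t \<in> C" using UP by (auto simp: C_def dist_commute)
    then have "?X t \<in> lie_U" by (rule X)
    moreover have "norm (?X t) < e" using r2(2)[of t] t X0 by simp
    moreover have "F t = F t\<^sub>0 ** (mat 1 + ?X t)"
      by (simp add: matrix_mul_assoc sp_inv_right[OF Sp])
    ultimately show "\<exists>X\<in>lie_U. norm X < e \<and> F t = F t\<^sub>0 ** (mat 1 + X)" by blast
  qed (use r1 r2 in auto)
qed

text \<open>Near any of its points a chart of T stays in a small plaque by
  \<open>integral_immersion_local\<close>; the image of a small chart ball is open in T because
  charts are homeomorphisms onto open sets.\<close>

lemma integral_manifold_leaf_continuous:
  fixes T :: "('n::finite) cmat2 set topology"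
  assumes T: "integral_manifold T"
  shows "continuous_map T leaf_topology id"
  unfolding continuous_map_def topspace_leaf_topology
proof (intro conjI allI impI)
  show "id \<in> topspace T \<rightarrow> B_pts" using T by (auto simp: integral_manifold_def)
  fix S :: "'n cmat2 set set" assume S: "openin leaf_topology S"
  have "\<exists>V. openin T V \<and> x \<in> V \<and> V \<subseteq> {x \<in> topspace T. id x \<in> S}" if x: "x \<in> topspace T" "x \<in> S" for x
  proof -
    from T x(1) obtain P U F W where im: "integral_immersion P U F" and W: "openin T W" "x \<in> W"
      and h: "homeomorphic_map (top_of_set U) (subtopology T W) (cls \<circ> F)"
      unfolding integral_manifold_def by blast
    have "topspace (subtopology T W) = W" using openin_subset[OF W(1)] by auto
    then have "(cls \<circ> F) ` U = W"
      using homeomorphic_imp_surjective_map[OF h] by simp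
    then obtain t\<^sub>0 where t0: "t\<^sub>0 \<in> U" "x = cls (F t\<^sub>0)" using W(2) by auto
    have "F t\<^sub>0 \<in> bold_B" using im t0 by (auto simp: integral_immersion_def)
    then obtain e where e: "e > 0" "\<And>X. X \<in> lie_U \<Longrightarrow> norm X < e \<Longrightarrow> plaque (F t\<^sub>0) X \<in> S"
      using S x(2) t0(2) unfolding openin_leaf_topology leaf_open_def by blast
    obtain r where r: "r > 0"
      "\<And>t. t \<in> U \<Longrightarrow> dist t t\<^sub>0 < r \<Longrightarrow> \<exists>X\<in>lie_U. norm X < e \<and> F t = F t\<^sub>0 ** (mat 1 + X)"
      using integral_immersion_local[OF im t0(1) e(1)] by blast
    let ?V = "(cls \<circ> F) ` (U \<inter> ball t\<^sub>0 r)"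
    have "openin (subtopology T W) ?V"
      using homeomorphic_imp_open_map[OF h] unfolding open_map_def by (simp add: openin_open_Int)
    then have V: "openin T ?V" using W(1) openin_trans_full by blast
    moreover have "?V \<subseteq> S"
    proof
      fix z assume "z \<in> ?V"
      then obtain t where t: "t \<in> U" "dist t t\<^sub>0 < r" "z = cls (F t)" by (auto simp: dist_commute)
      from r(2)[OF t(1,2)] obtain X where "X \<in> lie_U" "norm X < e" "F t = F t\<^sub>0 ** (mat 1 + X)" by blast
      then show "z \<in> S" using e(2)[of X] t(3) by (simp add: plaque_def)
    qed
    moreover have "x \<in> ?V" using t0 r(1) by auto
    ultimately show ?thesis using openin_subset[OF V] by auto
  qed
  then show "openin T {x \<in> topspace T. id x \<in> S}"
    by (subst openin_subopen) auto
qed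

text \<open>Gives both the maximality of the coset images and the fact that every leaf lies in one
  of them.\<close>

lemma connected_integral_manifold_subset:
  assumes T: "integral_manifold T" "connected_space T" and M: "M \<in> Sp_C"
    and meet: "topspace T \<inter> leaf_through M \<noteq> {}"
  shows "topspace T \<subseteq> leaf_through M"
proof -
  have "connectedin leaf_topology (id ` topspace T)"
    using T(2) by (intro connectedin_continuous_map_image[OF integral_manifold_leaf_continuous[OF T(1)]])
      (simp only: connectedin_def subset_refl subtopology_topspace simp_thms)
  then show ?thesis using connectedin_subset_leaf_through[OF _ M] meet by simp
qed

section \<open>Identification of the leaves with the images of \<open>phi\<close>\<close>

lemma psi_eq: "\<delta> \<in> Sp_C \<Longrightarrow> psi \<delta> \<tau> = sp_inv \<delta> ** (mat 1 + block 0 (moebius \<delta> \<tau>) 0 0)"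
  by (simp add: psi_def matrix_inv_Sp_C mat_1_block block_add)

lemma psi_image_plaque:
  assumes \<delta>: "\<delta> \<in> Sp_C"
  shows "psi \<delta> ` U_dom \<delta> = (\<lambda>X. sp_inv \<delta> ** (mat 1 + X)) ` plaque_dom (sp_inv \<delta>)"
  unfolding psi_image[OF \<delta>] U_C_eq matrix_inv_Sp_C[OF \<delta>] by (auto simp: plaque_dom_def)

text \<open>Cancelling \<delta>^-1 in the two descriptions of the coset exhibits
  \<open>plaque_dom\<close> as a continuous image of the connected set
  \<open>U_dom \<delta>\<close>.\<close>

lemma plaque_dom_eq:
  assumes \<delta>: "\<delta> \<in> Sp_C"
  shows "plaque_dom (sp_inv \<delta>) = (\<lambda>\<tau>. block 0 (moebius \<delta> \<tau>) 0 0) ` U_dom \<delta>"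
proof -
  have inj: "inj (\<lambda>X. sp_inv \<delta> ** (mat 1 + X))"
  proof (rule injI)
    fix X Y assume "sp_inv \<delta> ** (mat 1 + X) = sp_inv \<delta> ** (mat 1 + Y)"
    then have "\<delta> ** (sp_inv \<delta> ** (mat 1 + X)) = \<delta> ** (sp_inv \<delta> ** (mat 1 + Y))" by simp
    then show "X = Y" by (simp add: matrix_mul_assoc sp_inv_right[OF \<delta>])
  qed
  have "(\<lambda>X. sp_inv \<delta> ** (mat 1 + X)) ` plaque_dom (sp_inv \<delta>)
      = (\<lambda>X. sp_inv \<delta> ** (mat 1 + X)) ` ((\<lambda>\<tau>. block 0 (moebius \<delta> \<tau>) 0 0) ` U_dom \<delta>)"
    unfolding psi_image_plaque[OF \<delta>, symmetric] image_image psi_eq[OF \<delta>] ..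
  then show ?thesis using inj by (simp add: inj_image_eq_iff)
qed

lemma phi_image: "\<delta> \<in> Sp_C \<Longrightarrow> phi \<delta> ` U_dom \<delta> = leaf_through (sp_inv \<delta>)"
  using psi_image_plaque[of \<delta>] unfolding phi_def leaf_through_def plaque_def by (metis image_image)

lemma connected_plaque_dom:
  assumes \<delta>: "\<delta> \<in> Sp_C" shows "connected (plaque_dom (sp_inv \<delta>))"
  unfolding plaque_dom_eq[OF \<delta>]
proof (intro connected_continuous_image connected_U_dom)
  show "continuous_on (U_dom \<delta>) (\<lambda>\<tau>. block 0 (moebius \<delta> \<tau>) 0 0)"
    unfolding block_def
  proof (intro continuous_on_vec_lambda)
    show "continuous_on (U_dom \<delta>) (\<lambda>\<tau>. case i of Inl a \<Rightarrow> (case j of Inl b \<Rightarrow> 0 $ a $ b | Inr b \<Rightarrow> moebius \<delta> \<tau> $ a $ b)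
      | Inr a \<Rightarrow> (case j of Inl b \<Rightarrow> 0 $ a $ b | Inr b \<Rightarrow> 0 $ a $ b))" for i j
      by (cases i; cases j) (auto intro!: continuous_intros continuous_on_moebius)
  qed
qed

text \<open>A connected integral manifold containing this nonempty set meets it, and is therefore
  contained in it; this is the maximality.\<close>

lemma ramanujan_leaf_through:
  assumes \<delta>: "\<delta> \<in> Sp_C" shows "ramanujan_leaf (leaf_through (sp_inv \<delta>))"
proof -
  let ?M = "sp_inv \<delta>" and ?T = "subtopology leaf_topology (leaf_through (sp_inv \<delta>))"
  have M: "?M \<in> Sp_C" by (rule sp_inv_Sp_C[OF \<delta>])
  have ts: "topspace ?T = leaf_through ?M"
    using leaf_through_subset by (auto simp: topspace_leaf_topology)
  have ne: "leaf_through ?M \<noteq> {}"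
    using phi_image[OF \<delta>] U_dom_nonempty[OF \<delta>] by auto
  have "connectedin (top_of_set (plaque_dom ?M)) (plaque_dom ?M)"
    using connected_plaque_dom[OF \<delta>] by (simp add: connectedin_subtopology)
  then have "connectedin leaf_topology (leaf_through ?M)"
    unfolding leaf_through_def by (rule connectedin_continuous_map_image[OF continuous_map_plaque[OF M]])
  then have "connected_space ?T" by (simp add: connectedin_def)
  moreover have "topspace T = leaf_through ?M"
    if "integral_manifold T" "connected_space T" "leaf_through ?M \<subseteq> topspace T" for T
    using connected_integral_manifold_subset[OF that(1,2) M] that(3) ne by blast
  ultimately show ?thesis
    unfolding ramanujan_leaf_def using ne ts leaf_through_integral_manifold[OF M] by blast
qed

text \<open>For any point \<open>cls N\<close> of S, the leaf lies in \<open>leaf_through N\<close>,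
  which is itself a connected integral manifold; maximality of S forces equality, so \<delta> is the
  inverse of N.\<close>

lemma ramanujan_leaf_imp:
  assumes S: "ramanujan_leaf S" obtains \<delta> where "\<delta> \<in> Sp_C" "S = leaf_through (sp_inv \<delta>)"
proof -
  from S obtain T where T: "integral_manifold T" "connected_space T" "topspace T = S" and "S \<noteq> {}"
    by (auto simp: ramanujan_leaf_def)
  then obtain N where N: "N \<in> bold_B" "cls N \<in> S"
    by (auto simp: integral_manifold_def B_pts_def)
  have Sp: "N \<in> Sp_C" using N(1) bold_B_subset by blast
  have "S \<subseteq> leaf_through N"
    using connected_integral_manifold_subset[OF T(1,2) Sp] T(3) N cls_in_leaf_through by blast
  moreover have "sp_inv N \<in> Sp_C" "sp_inv (sp_inv N) = N"
    using Sp by (simp_all add: sp_inv_Sp_C sp_inv_sp_inv)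
  moreover from this have "ramanujan_leaf (leaf_through N)"
    using ramanujan_leaf_through by metis
  ultimately show ?thesis
    using S that[of "sp_inv N"] unfolding ramanujan_leaf_def by metis
qed

theorem proposition16p4:
  shows "(\<forall>\<delta> \<in> (Sp_C :: ('n::finite) cmat2 set).
            ramanujan_leaf (phi \<delta> ` U_dom \<delta>) \<and>
            phi \<delta> ` U_dom \<delta> = cls ` ({matrix_inv \<delta> ** u | u. u \<in> U_C} \<inter> bold_B)) \<and>
         (\<forall>S :: 'n cmat2 set set. ramanujan_leaf S \<longrightarrow> (\<exists>\<delta> \<in> Sp_C. S = phi \<delta> ` U_dom \<delta>))"
proof (intro conjI ballI allI impI)
  fix \<delta> :: "'n cmat2" assume \<delta>: "\<delta> \<in> Sp_C"
  show "ramanujan_leaf (phi \<delta> ` U_dom \<delta>)"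
    unfolding phi_image[OF \<delta>] by (rule ramanujan_leaf_through[OF \<delta>])
  show "phi \<delta> ` U_dom \<delta> = cls ` ({matrix_inv \<delta> ** u | u. u \<in> U_C} \<inter> bold_B)"
    unfolding psi_image[OF \<delta>, symmetric] image_image phi_def ..
next
  fix S :: "'n cmat2 set set" assume "ramanujan_leaf S"
  then obtain \<delta> where "\<delta> \<in> Sp_C" "S = leaf_through (sp_inv \<delta>)" by (rule ramanujan_leaf_imp)
  then show "\<exists>\<delta>\<in>Sp_C. S = phi \<delta> ` U_dom \<delta>" using phi_image by blast
qed

end
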